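(* Suppose that $\mathcal{X}$ and $\mathcal{Y}=(y_j)_{j\in\mathbb{Z}}$ are complete interpolating sequences for $PW_\pi$, $\psi$ satisfies (A1) and (A2), and $f\in V(\psi,\mathcal{X})$. If $\phi$ satisfies (A1) and (A2), then there exists a unique sequence $(a_j)\in\ell_2$ such that the function $I_\phi^{\mathcal{Y}}f(x):=\sum_{j\in\mathbb{Z}}a_j\phi(x-y_j)$ satisfies: (i) $I_\phi^{\mathcal{Y}}f(y_k)=f(y_k)$ for all $k\in\mathbb{Z}$, and (ii) $I_\phi^{\mathcal{Y}}f\in C_0(\mathbb{R})\cap L_2(\mathbb{R})$.
   Context: Fourier transform: $\widehat f(\xi)=\frac{1}{\sqrt{2\pi}}\int_{\mathbb{R}}f(x)e^{-i\xi x}\,dx$. $\mathbb{T}=[-\pi,\pi)$. $\|g\|_{W(L_\infty,\ell_1)}:=\sum_{k\in\mathbb{Z}}\|g(\cdot+2\pi k)\|_{L_\infty(\mathbb{T})}$. $C_0(\mathbb{R})$: continuous functions vanishing at infinity. $PW_\pi=\{f\in L_2(\mathbb{R}):\widehat f=0\text{ a.e. outside }[-\pi,\pi]\}$. A sequence $\mathcal{X}=(x_j)\subset\mathbb{R}$ is a complete interpolating sequence for $PW_\pi$ if for every $(c_j)\in\ell_2$ there is a unique $f\in PW_\pi$ with $f(x_j)=c_j$ for all $j$ (equivalently $(e^{-ix_j\cdot})_j$ is a Riesz basis of $L_2(\mathbb{T})$). A function $\psi$ satisfies (A1) if $\psi\in L_2(\mathbb{R})$ is positive definite; (A2) if $\widehat\psi\in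 W(L_\infty,\ell_1)$, $\inf_{\xi\in\mathbb{T}}|\widehat\psi(\xi)|>0$ and $\sum_{j\neq0}\|\widehat\psi(\cdot+2\pi j)\|_{L_\infty(\mathbb{T})}/\inf_{\xi\in\mathbb{T}}|\widehat\psi(\xi)|<\infty$. $V(\psi,\mathcal{X})$ is the $L_2(\mathbb{R})$-closure of the span of $\{\psi(\cdot-x_j):j\in\mathbb{Z}\}$; its elements are continuous functions. *)

theory Defs
  imports "HOL-Analysis.Analysis" "HOL-Probability.Essential_Supremum"
begin

definition sq_int :: "(real \<Rightarrow> complex) \<Rightarrow> bool" where
  "sq_int f \<longleftrightarrow> f \<in> borel_measurable lborel \<and>
     (\<integral>\<^sup>+ x. ennreal ((cmod (f x))\<^sup>2) \<partial>lborel) < \<infinity>"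

definition L2dist2 :: "(real \<Rightarrow> complex) \<Rightarrow> (real \<Rightarrow> complex) \<Rightarrow> ennreal" where
  "L2dist2 f g = (\<integral>\<^sup>+ x. ennreal ((cmod (f x - g x))\<^sup>2) \<partial>lborel)"

definition trunc_fourier :: "(real \<Rightarrow> complex) \<Rightarrow> real \<Rightarrow> real \<Rightarrow> complex" where
  "trunc_fourier f R \<xi> =
     complex_of_real (1 / sqrt (2 * pi)) *
       (LINT x:{-R..R}|lborel. f x * exp (- \<i> * complex_of_real (\<xi> * x)))"

definition fourier_L2 :: "(real \<Rightarrow> complex) \<Rightarrow> (real \<Rightarrow> complex) \<Rightarrow> bool" where
  "fourier_L2 f F \<longleftrightarrow> sq_int f \<and> sq_int F \<and>
     ((\<lambda>R. L2dist2 (trunc_fourier f R) F) \<longlongrightarrow> 0) at_top"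

text \<open>Paley--Wiener space (continuous representatives).\<close>
definition PW_pi :: "(real \<Rightarrow> complex) \<Rightarrow> bool" where
  "PW_pi f \<longleftrightarrow> continuous_on UNIV f \<and> sq_int f \<and>
     (\<exists>F. fourier_L2 f F \<and> (AE \<xi> in lborel. \<xi> \<notin> {-pi..pi} \<longrightarrow> F \<xi> = 0))"

definition l2_seq :: "(int \<Rightarrow> complex) \<Rightarrow> bool" where
  "l2_seq c \<longleftrightarrow> (\<lambda>j. (cmod (c j))\<^sup>2) summable_on UNIV"

definition complete_interpolating :: "(int \<Rightarrow> real) \<Rightarrow> bool" where
  "complete_interpolating X \<longleftrightarrow>
     (\<forall>c. l2_seq c \<longrightarrow> (\<exists>!f. PW_pi f \<and> (\<forall>j. f (X j) = c j)))"

definition pos_def :: "(real \<Rightarrow> complex) \<Rightarrow> bool" where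
  "pos_def \<psi> \<longleftrightarrow> continuous_on UNIV \<psi> \<and>
     (\<forall>(n::nat) (x::nat \<Rightarrow> real) (c::nat \<Rightarrow> complex).
        Im (\<Sum>j<n. \<Sum>k<n. c j * cnj (c k) * \<psi> (x j - x k)) = 0 \<and>
        Re (\<Sum>j<n. \<Sum>k<n. c j * cnj (c k) * \<psi> (x j - x k)) \<ge> 0)"

definition A1 :: "(real \<Rightarrow> complex) \<Rightarrow> bool" where
  "A1 \<psi> \<longleftrightarrow> sq_int \<psi> \<and> pos_def \<psi>"

definition torus :: "real set" where "torus = {-pi..<pi}"

definition Linf_T :: "(real \<Rightarrow> complex) \<Rightarrow> ennreal" where
  "Linf_T g = esssup (restrict_space lborel torus) (\<lambda>\<xi>. ennreal (cmod (g \<xi>)))"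

definition essinf_T :: "(real \<Rightarrow> complex) \<Rightarrow> ennreal" where
  "essinf_T g = Sup {\<delta>. AE \<xi> in restrict_space lborel torus. \<delta> \<le> ennreal (cmod (g \<xi>))}"

definition amalgam_norm :: "(real \<Rightarrow> complex) \<Rightarrow> ennreal" where
  "amalgam_norm g = (\<Sum>\<^sub>\<infinity>k\<in>(UNIV::int set). Linf_T (\<lambda>\<xi>. g (\<xi> + 2 * pi * of_int k)))"

definition A2 :: "(real \<Rightarrow> complex) \<Rightarrow> bool" where
  "A2 \<psi> \<longleftrightarrow> (\<exists>F. fourier_L2 \<psi> F \<and> amalgam_norm F < \<infinity> \<and> essinf_T F > 0 \<and>
     (\<Sum>\<^sub>\<infinity>j\<in>(UNIV::int set) - {0}. Linf_T (\<lambda>\<xi>. F (\<xi> + 2 * pi * of_int j))) / essinf_T F < \<infinity>)"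

definition V_space :: "(real \<Rightarrow> complex) \<Rightarrow> (int \<Rightarrow> real) \<Rightarrow> (real \<Rightarrow> complex) set" where
  "V_space \<psi> X = {f. continuous_on UNIV f \<and> sq_int f \<and>
     (\<forall>\<epsilon>>0. \<exists>S c. finite S \<and>
        L2dist2 f (\<lambda>x. \<Sum>j\<in>S. c j * \<psi> (x - X j)) < ennreal \<epsilon>)}"

definition series_rep :: "(real \<Rightarrow> complex) \<Rightarrow> (int \<Rightarrow> real) \<Rightarrow> (int \<Rightarrow> complex) \<Rightarrow> (real \<Rightarrow> complex) \<Rightarrow> bool" where
  "series_rep \<phi> Y a I \<longleftrightarrow>
     (\<forall>x. (\<lambda>N::nat. \<Sum>j\<in>{- int N..int N}. a j * \<phi> (x - Y j)) \<longlonglongrightarrow> I x)"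

definition C0 :: "(real \<Rightarrow> complex) \<Rightarrow> bool" where
  "C0 g \<longleftrightarrow> continuous_on UNIV g \<and> (g \<longlongrightarrow> 0) at_infinity"

end

theory Submission
  imports Defs "HOL-Probability.Characteristic_Functions"
begin

text \<open>
  Write \<open>p\<^sub>a(\<xi>) = \<Sum>\<^sub>j a\<^sub>j exp(-i y\<^sub>j \<xi>)\<close>.  By the uniform boundedness principle, solvability of
  the interpolation problem gives the lower Riesz bound \<open>\<parallel>a\<parallel> \<le> C \<parallel>p\<^sub>a\<parallel>\<close> in \<open>L\<^sub>2(\<T>)\<close>.
  Applied to two-term sums it shows that the nodes are separated, and separation yields the upper
  (Bessel) bound by comparing \<open>\<T>\<close> with a Gaussian weight.  Fourier inversion turns
  \<open>\<Sum> a\<^sub>j cnj(a\<^sub>k) \<phi>(y\<^sub>k - y\<^sub>j)\<close> into a multiple of \<open>\<integral> F |p\<^sub>a|\<^sup>2\<close>, where \<open>F\<close> is the transform of \<open>\<phi>\<close>.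
  Positive definiteness makes \<open>F \<ge> 0\<close>, so this is at least a multiple of \<open>\<integral>\<^sub>\<T> |p\<^sub>a|\<^sup>2\<close>, while
  the amalgam norm bounds it from above, each translate of \<open>\<T>\<close> seeing the same Bessel bound.
  Hence \<open>(\<phi>(y\<^sub>k - y\<^sub>j))\<close> is bounded and coercive on \<open>\<ell>\<^sub>2\<close>, so invertible by Lax--Milgram.  The same two
  bounds for \<open>\<psi>\<close> and \<open>X\<close> show that the samples \<open>f(y\<^sub>k)\<close> form an \<open>\<ell>\<^sub>2\<close> sequence.
\<close>

section \<open>The Hilbert space of square-summable sequences\<close>

text \<open>\<open>complete_interpolating\<close> asserts solvability for each single sequence and
  carries no estimate, and \<open>fourier_L2\<close> gives the transform only as an L2 limit of
  truncated integrals. These two facts shape the proof. The missing estimate comes from Baire's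
  theorem: for fixed c, the interpolant of c turns the pairing of c with a into an integral of its
  transform against conj p_a, which stays bounded over all a with torus norm at most 1. Pointwise
  information on F is won by pairing: Parseval is proved for truncations and box functions and
  passed to the limit, boxes shrinking to x give inversion, and Gaussians give the sign of F. The
  Bessel bound needs a Gaussian weight because on the torus itself the Gram entries decay only like
  the reciprocal distance of the nodes, so that absolute row sums may diverge. Every estimate is
  proved for finite sums, with constants independent of the index set, and only then extended to all
  of l2. For a in l2 the series is then automatically continuous, vanishing at infinity and
  square-integrable, so that existence and uniqueness reduce to one linear equation.\<close>

lemma l2_seq_add:
  assumes "l2_seq a" "l2_seq b"
  shows "l2_seq (\<lambda>j. a j + b j)"
proof -
  have "(\<lambda>j. 2 * ((cmod (a j))\<^sup>2 + (cmod (b j))\<^sup>2)) summable_on UNIV"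
    using assms unfolding l2_seq_def by (intro summable_on_cmult_right summable_on_add)
  moreover have "(cmod (a j + b j))\<^sup>2 \<le> 2 * ((cmod (a j))\<^sup>2 + (cmod (b j))\<^sup>2)" for j
  proof -
    have "(cmod (a j + b j))\<^sup>2 \<le> (cmod (a j) + cmod (b j))\<^sup>2"
      by (simp add: norm_triangle_ineq power_mono)
    also have "\<dots> \<le> 2 * ((cmod (a j))\<^sup>2 + (cmod (b j))\<^sup>2)"
      using sum_squares_bound[of "cmod (a j)" "cmod (b j)"] by (simp add: power2_sum)
    finally show ?thesis .
  qed
  ultimately show ?thesis
    unfolding l2_seq_def by (rule summable_on_comparison_test) auto
qed

lemma l2_seq_cmult: "l2_seq a \<Longrightarrow> l2_seq (\<lambda>j. z * a j)"
  unfolding l2_seq_def by (simp add: norm_mult power_mult_distrib summable_on_cmult_right)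

lemma l2_seq_uminus: "l2_seq a \<Longrightarrow> l2_seq (\<lambda>j. - a j)"
  unfolding l2_seq_def by simp

lemma l2_seq_zero: "l2_seq (\<lambda>j. 0)"
  unfolding l2_seq_def by simp

lemma l2_seq_diff: "l2_seq a \<Longrightarrow> l2_seq b \<Longrightarrow> l2_seq (\<lambda>j. a j - b j)"
  using l2_seq_add[of a "\<lambda>j. - b j"] l2_seq_uminus[of b] by simp

lemma l2_seq_finite: "finite S \<Longrightarrow> l2_seq (\<lambda>j. if j \<in> S then a j else 0)"
  unfolding l2_seq_def
  by (rule finite_nonzero_values_imp_summable_on, rule finite_subset[of _ S]) auto

lemma l2_seq_bounded_sums:
  assumes "\<And>K. finite K \<Longrightarrow> (\<Sum>j\<in>K. (cmod (a j))\<^sup>2) \<le> C"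
  shows "l2_seq a"
  unfolding l2_seq_def
proof (rule nonneg_bdd_above_summable_on)
  show "bdd_above (sum (\<lambda>j. (cmod (a j))\<^sup>2) ` {F. F \<subseteq> UNIV \<and> finite F})"
    using assms by (auto intro!: bdd_aboveI)
qed auto

lemma l2_seq_mult_abs_summable:
  assumes "l2_seq a" "l2_seq b"
  shows "(\<lambda>j. norm (a j * b j)) summable_on UNIV"
proof -
  have "(\<lambda>j. (cmod (a j))\<^sup>2 + (cmod (b j))\<^sup>2) summable_on UNIV"
    using assms unfolding l2_seq_def by (intro summable_on_add)
  moreover have "norm (a j * b j) \<le> (cmod (a j))\<^sup>2 + (cmod (b j))\<^sup>2" for j
    using sum_squares_bound[of "cmod (a j)" "cmod (b j)"]
      zero_le_power2[of "cmod (a j)"] zero_le_power2[of "cmod (b j)"] unfolding norm_mult by linarith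
  ultimately show ?thesis
    by (rule summable_on_comparison_test) auto
qed

lemma l2_seq_cnj: "l2_seq a \<Longrightarrow> l2_seq (\<lambda>j. cnj (a j))"
  unfolding l2_seq_def by simp

text \<open>A type of its own lets the sequences form an instance of \<open>real_inner\<close> and
  \<open>complete_space\<close>, where Baire's theorem and the Banach fixed point theorem
  apply.\<close>

typedef l2 = "{a. l2_seq a}"
  morphisms seq_of Abs_l2
  using l2_seq_zero by blast

setup_lifting type_definition_l2

lemma l2_seq_seq_of [simp]: "l2_seq (seq_of a)"
  using seq_of by blast

lemma seq_of_summable: "(\<lambda>j. (cmod (seq_of a j))\<^sup>2) summable_on UNIV"
  using l2_seq_seq_of unfolding l2_seq_def .

lemma seq_of_inner_summable: "(\<lambda>j. Re (seq_of a j * cnj (seq_of b j))) summable_on UNIV"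
  by (rule summable_on_Re, rule abs_summable_summable, rule l2_seq_mult_abs_summable)
    (auto intro: l2_seq_cnj)

instantiation l2 :: real_vector
begin

lift_definition zero_l2 :: l2 is "\<lambda>j. 0" by (rule l2_seq_zero)
lift_definition plus_l2 :: "l2 \<Rightarrow> l2 \<Rightarrow> l2" is "\<lambda>a b j. a j + b j" by (rule l2_seq_add)
lift_definition minus_l2 :: "l2 \<Rightarrow> l2 \<Rightarrow> l2" is "\<lambda>a b j. a j - b j" by (rule l2_seq_diff)
lift_definition uminus_l2 :: "l2 \<Rightarrow> l2" is "\<lambda>a j. - a j" by (rule l2_seq_uminus)
lift_definition scaleR_l2 :: "real \<Rightarrow> l2 \<Rightarrow> l2" is "\<lambda>r a j. complex_of_real r * a j"
  by (rule l2_seq_cmult)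

instance
  by standard (transfer; simp add: algebra_simps)+

end

instantiation l2 :: real_inner
begin

text \<open>The real part of the Hermitian product: the complex sequence space is treated as a real
  Hilbert space. The norm is the same, and coercivity is a statement about a real part
  anyway.\<close>

definition inner_l2 :: "l2 \<Rightarrow> l2 \<Rightarrow> real"
  where "inner_l2 a b = (\<Sum>\<^sub>\<infinity>j. Re (seq_of a j * cnj (seq_of b j)))"
definition norm_l2 :: "l2 \<Rightarrow> real" where "norm_l2 a = sqrt (inner a a)"
definition sgn_l2 :: "l2 \<Rightarrow> l2" where "sgn_l2 a = a /\<^sub>R norm a"
definition dist_l2 :: "l2 \<Rightarrow> l2 \<Rightarrow> real" where "dist_l2 a b = norm (a - b)"
definition uniformity_l2 :: "(l2 \<times> l2) filter"
  where "uniformity_l2 = (INF e\<in>{0<..}. principal {(x, y). dist x y < e})"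
definition open_l2 :: "l2 set \<Rightarrow> bool"
  where "open_l2 U = (\<forall>x\<in>U. \<forall>\<^sub>F (x', y) in uniformity. x' = x \<longrightarrow> y \<in> U)"

instance
proof
  fix a b c :: l2 and r :: real
  show "sgn a = a /\<^sub>R norm a" "dist a b = norm (a - b)" "norm a = sqrt (inner a a)"
    "uniformity = (INF e\<in>{0<..}. principal {(x, y). dist x (y::l2) < e})"
    by (simp_all add: sgn_l2_def dist_l2_def norm_l2_def uniformity_l2_def)
  show "open U \<longleftrightarrow> (\<forall>x\<in>U. \<forall>\<^sub>F (x', y) in uniformity. x' = x \<longrightarrow> y \<in> U)" for U :: "l2 set"
    by (simp add: open_l2_def)
  show "inner a b = inner b a"
    unfolding inner_l2_def by (simp add: algebra_simps)
  show "inner (a + b) c = inner a c + inner b c"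
    unfolding inner_l2_def
    by (subst infsum_add[OF seq_of_inner_summable seq_of_inner_summable, symmetric],
        rule infsum_cong) (simp add: plus_l2.rep_eq algebra_simps)
  show "inner (r *\<^sub>R a) b = r * inner a b"
    unfolding inner_l2_def
    by (subst infsum_cmult_right[OF seq_of_inner_summable, symmetric],
        rule infsum_cong) (simp add: scaleR_l2.rep_eq algebra_simps)
  have sq: "inner a a = (\<Sum>\<^sub>\<infinity>j. (cmod (seq_of a j))\<^sup>2)" for a :: l2
    unfolding inner_l2_def by (simp add: cmod_power2 flip: power2_eq_square)
  show "0 \<le> inner a a"
    unfolding sq by (rule infsum_nonneg) simp
  show "inner a a = 0 \<longleftrightarrow> a = 0"
  proof
    assume "inner a a = 0"
    then have "(cmod (seq_of a j))\<^sup>2 = 0" for j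
      using nonneg_infsum_le_0D[of "\<lambda>j. (cmod (seq_of a j))\<^sup>2" UNIV j] seq_of_summable[of a]
      by (simp add: sq)
    then show "a = 0" by transfer auto
  qed (simp add: sq zero_l2.rep_eq)
qed

end

lemma norm_l2_power2: "(norm a)\<^sup>2 = (\<Sum>\<^sub>\<infinity>j. (cmod (seq_of a j))\<^sup>2)"
  unfolding power2_norm_eq_inner[where 'a=l2] inner_l2_def
  by (simp add: cmod_power2 flip: power2_eq_square)

lemma sum_le_norm_l2: "finite K \<Longrightarrow> (\<Sum>j\<in>K. (cmod (seq_of a j))\<^sup>2) \<le> (norm a)\<^sup>2"
  unfolding norm_l2_power2 by (rule finite_sum_le_infsum[OF seq_of_summable]) auto

lemma seq_of_le_norm: "cmod (seq_of a j) \<le> norm a"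
  using sum_le_norm_l2[of "{j}" a] by (auto intro: power2_le_imp_le)

lemma norm_l2_le:
  assumes "\<And>K. finite K \<Longrightarrow> (\<Sum>j\<in>K. (cmod (seq_of a j))\<^sup>2) \<le> C\<^sup>2" "0 \<le> C"
  shows "norm a \<le> C"
proof -
  have "(norm a)\<^sup>2 \<le> C\<^sup>2"
    unfolding norm_l2_power2 by (rule infsum_le_finite_sums[OF seq_of_summable]) (use assms in auto)
  then show ?thesis using assms(2) by (rule power2_le_imp_le)
qed

lemma bounded_linear_seq_of: "bounded_linear (\<lambda>a. seq_of a j)"
  by (rule bounded_linear_intro[where K=1])
    (auto simp: plus_l2.rep_eq scaleR_l2.rep_eq scaleR_conv_of_real seq_of_le_norm)

text \<open>Coordinates are bounded functionals, so a Cauchy sequence has a coordinatewise limit.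
  The Cauchy estimate passes to that limit on each finite index set K with a bound independent of K,
  which gives both membership and norm convergence.\<close>

instance l2 :: complete_space
proof
  fix X :: "nat \<Rightarrow> l2"
  assume X: "Cauchy X"
  have "\<exists>l. (\<lambda>n. seq_of (X n) j) \<longlonglongrightarrow> l" for j
    using bounded_linear.Cauchy[OF bounded_linear_seq_of X] by (simp add: Cauchy_convergent convergentD)
  then obtain l where l: "\<And>j. (\<lambda>n. seq_of (X n) j) \<longlonglongrightarrow> l j" by metis
  have lim: "(\<Sum>j\<in>K. (cmod (l j - seq_of (X m) j))\<^sup>2) \<le> e\<^sup>2"
    if "\<And>n. n \<ge> N \<Longrightarrow> dist (X n) (X m) < e" "finite K" for e N m K
  proof (rule LIMSEQ_le_const2)
    show "(\<lambda>n. \<Sum>j\<in>K. (cmod (seq_of (X n) j - seq_of (X m) j))\<^sup>2) \<longlonglongrightarrow>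
        (\<Sum>j\<in>K. (cmod (l j - seq_of (X m) j))\<^sup>2)"
      by (intro tendsto_intros l)
    have "(\<Sum>j\<in>K. (cmod (seq_of (X n) j - seq_of (X m) j))\<^sup>2) \<le> e\<^sup>2" if "n \<ge> N" for n
    proof -
      have "(\<Sum>j\<in>K. (cmod (seq_of (X n) j - seq_of (X m) j))\<^sup>2) \<le> (dist (X n) (X m))\<^sup>2"
        using sum_le_norm_l2[OF \<open>finite K\<close>, of "X n - X m"] by (simp add: minus_l2.rep_eq dist_norm)
      also have "\<dots> \<le> e\<^sup>2"
        using \<open>\<And>n. n \<ge> N \<Longrightarrow> dist (X n) (X m) < e\<close>[OF that] by (intro power_mono) auto
      finally show ?thesis .
    qed
    then show "\<exists>N. \<forall>n\<ge>N. (\<Sum>j\<in>K. (cmod (seq_of (X n) j - seq_of (X m) j))\<^sup>2) \<le> e\<^sup>2" by blast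
  qed
  have cau: "\<exists>N. \<forall>m\<ge>N. \<forall>n\<ge>N. dist (X n) (X m) < e" if "e > 0" for e
    using X that unfolding Cauchy_def by metis
  obtain N where N: "\<And>m n. m \<ge> N \<Longrightarrow> n \<ge> N \<Longrightarrow> dist (X n) (X m) < 1"
    using cau[of 1] by auto
  \<comment> \<open>Square-summability of \<open>l\<close> is reached through its difference from
    one fixed member, to which \<open>lim\<close> applies.\<close>
  have "l2_seq (\<lambda>j. l j - seq_of (X N) j)"
    using lim[of N N 1] N by (intro l2_seq_bounded_sums[of _ 1]) auto
  then have "l2_seq l"
    using l2_seq_add[OF _ l2_seq_seq_of, of "\<lambda>j. l j - seq_of (X N) j" "X N"] by simp
  define L where "L = Abs_l2 l"
  have L: "seq_of L = l" using \<open>l2_seq l\<close> by (simp add: L_def Abs_l2_inverse)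
  have "X \<longlonglongrightarrow> L"
  proof (rule metric_LIMSEQ_I)
    fix e :: real assume "e > 0"
    then obtain M where M: "\<And>m n. m \<ge> M \<Longrightarrow> n \<ge> M \<Longrightarrow> dist (X n) (X m) < e / 2"
      using cau[of "e/2"] by auto
    have "dist (X m) L < e" if "m \<ge> M" for m
    proof -
      have "norm (L - X m) \<le> e / 2"
        using lim[of M m "e/2"] M that \<open>e > 0\<close>
        by (intro norm_l2_le) (auto simp: minus_l2.rep_eq L)
      then show ?thesis using \<open>e > 0\<close> by (simp add: dist_norm norm_minus_commute)
    qed
    then show "\<exists>no. \<forall>n\<ge>no. dist (X n) L < e" by blast
  qed
  then show "convergent X" by (rule convergentI)
qed

text \<open>A solution is a fixed point of x - t(Tx - y), and this map is a contraction for a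
  suitable t: expanding the square bounds the squared Lipschitz constant by 1 - 2tc + t^2
  C'^2.\<close>

lemma lax_milgram_surj:
  fixes T :: "'a::{real_inner,complete_space} \<Rightarrow> 'a"
  assumes "bounded_linear T" "c > 0" "\<And>x. c * (norm x)\<^sup>2 \<le> inner (T x) x"
  shows "\<exists>x. T x = y"
proof -
  interpret T: bounded_linear T by fact
  obtain C where C: "C > 0" "\<And>x. norm (T x) \<le> norm x * C"
    using T.pos_bounded by blast
  \<comment> \<open>The maximum with c ensures c <= C', so that the square root defining
    \<open>q\<close> is taken of a number in [0,1).\<close>
  define C' where "C' = max C c"
  have C': "C' > 0" "c \<le> C'" "\<And>x. norm (T x) \<le> C' * norm x"
    using C(1) unfolding C'_def
    by (auto intro!: order_trans[OF C(2)] mult_left_mono simp: mult.commute[of _ "norm _"])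
  \<comment> \<open>The minimiser of 1 - 2tc + t^2 C'^2; the minimum is \<open>q\<close>
    squared.\<close>
  define t where "t = c / C'\<^sup>2"
  define q where "q = sqrt (1 - c\<^sup>2 / C'\<^sup>2)"
  have q2: "0 \<le> 1 - c\<^sup>2 / C'\<^sup>2" "1 - c\<^sup>2 / C'\<^sup>2 < 1"
    using C' assms(2) by (auto simp: divide_simps power_mono)
  have lip: "norm (x - t *\<^sub>R T x) \<le> q * norm x" for x
  proof (rule power2_le_imp_le)
    have "(norm (x - t *\<^sub>R T x))\<^sup>2 = (norm x)\<^sup>2 - 2 * t * inner (T x) x + t\<^sup>2 * (norm (T x))\<^sup>2"
      unfolding power2_norm_eq_inner
      by (simp add: inner_diff_left inner_diff_right inner_commute power2_eq_square algebra_simps)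
    also have "\<dots> \<le> (norm x)\<^sup>2 - 2 * t * (c * (norm x)\<^sup>2) + t\<^sup>2 * (C' * norm x)\<^sup>2"
      using assms(3)[of x] C'(3)[of x] assms(2) C'(1)
      by (intro add_mono diff_mono mult_left_mono power_mono) (auto simp: t_def)
    also have "\<dots> = (1 - c\<^sup>2 / C'\<^sup>2) * (norm x)\<^sup>2"
      using C'(1) by (simp add: t_def field_simps power2_eq_square)
    also have "\<dots> = (q * norm x)\<^sup>2"
      using q2 by (simp add: q_def power_mult_distrib)
    finally show "(norm (x - t *\<^sub>R T x))\<^sup>2 \<le> (q * norm x)\<^sup>2" .
    show "0 \<le> q * norm x" using q2 by (simp add: q_def)
  qed
  have "\<exists>!x. (x - t *\<^sub>R T x + t *\<^sub>R y) = x"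
  proof (rule banach_fix_type)
    show "0 \<le> q" "q < 1" using q2 by (auto simp: q_def real_sqrt_lt_1_iff)
    show "\<forall>x z. dist (x - t *\<^sub>R T x + t *\<^sub>R y) (z - t *\<^sub>R T z + t *\<^sub>R y) \<le> q * dist x z"
      using lip by (auto simp: dist_norm T.diff algebra_simps scaleR_diff_right
          intro!: order_trans[OF _ lip[of "x - z" for x z]])
  qed
  then obtain x where "x - t *\<^sub>R T x + t *\<^sub>R y = x" by blast
  then have "t *\<^sub>R T x = t *\<^sub>R y" by (simp add: algebra_simps del: scaleR_cancel_left)
  moreover have "t \<noteq> 0" using assms(2) C'(1) by (simp add: t_def)
  ultimately show ?thesis by auto
qed

text \<open>The uniform boundedness principle, with the members of E acting as functionals. The
  closed sets \<open>G n\<close> cover the space, so by Baire one of them contains a ball, and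
  differences of points of that ball bound the norms in E.\<close>

lemma pointwise_bounded_imp_bounded:
  fixes E :: "'a::{real_inner,complete_space} set"
  assumes "\<And>c. \<exists>M. \<forall>a\<in>E. \<bar>inner c a\<bar> \<le> M"
  shows "bounded E"
proof -
  define G where "G n = {c. \<forall>a\<in>E. \<bar>inner c a\<bar> \<le> real n}" for n :: nat
  have closed: "closed (G n)" for n
  proof -
    have "G n = (\<Inter>a\<in>E. {c. \<bar>inner c a\<bar> \<le> real n})" by (auto simp: G_def)
    moreover have "closed {c. \<bar>inner c a\<bar> \<le> real n}" for a
      by (intro closed_Collect_le continuous_intros)
    ultimately show ?thesis by auto
  qed
  have UN: "\<Union> (range G) = UNIV"
  proof (intro equalityI subsetI)
    fix c :: 'a
    obtain M where "\<forall>a\<in>E. \<bar>inner c a\<bar> \<le> M" using assms by blast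
    then have "c \<in> G (nat \<lceil>M\<rceil>)" unfolding G_def
      by (auto intro: order_trans[OF _ real_nat_ceiling_ge])
    then show "c \<in> \<Union> (range G)" by blast
  qed auto
  have "\<exists>n. interior (G n) \<noteq> {}"
  proof (rule ccontr)
    assume "\<not> ?thesis"
    then have "euclidean interior_of \<Union> (range G) = {}"
      using closed by (intro Baire_category_alt) (auto simp: completely_metrizable_space_euclidean)
    then show False by (simp add: UN)
  qed
  then obtain n c where "c \<in> interior (G n)" by auto
  then obtain r where r: "r > 0" "ball c r \<subseteq> G n"
    by (meson mem_interior)
  have "norm a \<le> 4 * real n / r" if "a \<in> E" for a
  proof (cases "a = 0")
    case True then show ?thesis using r by simp
  next
    case False
    \<comment> \<open>A vector of length r/2 along a: both c and c + v lie in the ball, so |<v,a>| =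
      (r/2)|a| is at most 2n. This is the origin of 4n/r.\<close>
    define v where "v = (r / 2 / norm a) *\<^sub>R a"
    have "norm v < r" using r False by (simp add: v_def)
    then have "c + v \<in> G n" "c \<in> G n" using r by (auto simp: dist_norm)
    then have "\<bar>inner (c + v) a\<bar> \<le> n" "\<bar>inner c a\<bar> \<le> n" using that by (auto simp: G_def)
    then have "\<bar>inner v a\<bar> \<le> 2 * n" by (simp add: inner_add_left)
    moreover have "inner v a = r / 2 * norm a"
      using False by (simp add: v_def flip: power2_norm_eq_inner) (simp add: power2_eq_square)
    ultimately show ?thesis using r by (simp add: field_simps)
  qed
  then show ?thesis by (rule boundedI)
qed


section \<open>Infinite matrices acting on square-summable sequences\<close>

lift_definition restrict_l2 :: "int set \<Rightarrow> l2 \<Rightarrow> l2" is "\<lambda>S a j. if j \<in> S then a j else 0"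
  unfolding l2_seq_def by (rule summable_on_comparison_test) auto

lemma norm_restrict_l2_split:
  assumes "finite S"
  shows "(norm a)\<^sup>2 = (\<Sum>j\<in>S. (cmod (seq_of a j))\<^sup>2) + (norm (a - restrict_l2 S a))\<^sup>2"
proof -
  have "(norm (a - restrict_l2 S a))\<^sup>2 = (\<Sum>\<^sub>\<infinity>j\<in>-S. (cmod (seq_of a j))\<^sup>2)"
    unfolding norm_l2_power2
    by (rule infsum_cong_neutral) (auto simp: minus_l2.rep_eq restrict_l2.rep_eq)
  moreover have "(norm a)\<^sup>2 = (\<Sum>\<^sub>\<infinity>j\<in>S \<union> -S. (cmod (seq_of a j))\<^sup>2)"
    by (simp add: norm_l2_power2)
  moreover have "\<dots> = (\<Sum>\<^sub>\<infinity>j\<in>S. (cmod (seq_of a j))\<^sup>2) + (\<Sum>\<^sub>\<infinity>j\<in>-S. (cmod (seq_of a j))\<^sup>2)"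
    by (rule infsum_Un_disjoint) (auto intro: summable_on_subset_banach[OF seq_of_summable])
  ultimately show ?thesis using assms by simp
qed

text \<open>By the orthogonal splitting the squared error is the squared norm of a minus a partial
  sum of its series. This density of finitely supported sequences carries finite estimates over to
  all of \<open>l2\<close>.\<close>

lemma restrict_l2_tendsto:
  "((\<lambda>S. restrict_l2 S a) \<longlongrightarrow> a) (finite_subsets_at_top UNIV)"
proof -
  have "((\<lambda>S. \<Sum>j\<in>S. (cmod (seq_of a j))\<^sup>2) \<longlongrightarrow> (norm a)\<^sup>2) (finite_subsets_at_top UNIV)"
    unfolding norm_l2_power2 using infsum_tendsto[OF seq_of_summable] .
  then have "((\<lambda>S. sqrt ((norm a)\<^sup>2 - (\<Sum>j\<in>S. (cmod (seq_of a j))\<^sup>2))) \<longlongrightarrow> sqrt ((norm a)\<^sup>2 - (norm a)\<^sup>2))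
      (finite_subsets_at_top UNIV)"
    by (intro tendsto_intros)
  moreover have "\<forall>\<^sub>F S in finite_subsets_at_top UNIV.
      sqrt ((norm a)\<^sup>2 - (\<Sum>j\<in>S. (cmod (seq_of a j))\<^sup>2)) = norm (restrict_l2 S a - a)"
    by (rule eventually_finite_subsets_at_top_weakI)
      (use norm_restrict_l2_split[of _ a] in \<open>simp add: norm_minus_commute\<close>)
  ultimately have "((\<lambda>S. norm (restrict_l2 S a - a)) \<longlongrightarrow> 0) (finite_subsets_at_top UNIV)"
    using tendsto_cong by force
  then show ?thesis by (simp add: tendsto_norm_zero_iff LIM_zero_iff)
qed

text \<open>The bound is imposed on finite sections only, the form in which sampling estimates
  arrive; convergence of the full row sums is a consequence.\<close>

locale bounded_matrix =
  fixes M :: "int \<Rightarrow> int \<Rightarrow> complex" and C :: real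
  assumes C_nonneg: "0 \<le> C"
    and bound: "\<And>S K a. finite S \<Longrightarrow> finite K \<Longrightarrow>
      (\<Sum>k\<in>K. (cmod (\<Sum>j\<in>S. M k j * a j))\<^sup>2) \<le> C\<^sup>2 * (\<Sum>j\<in>S. (cmod (a j))\<^sup>2)"
begin

text \<open>Testing the bound on the conjugated row itself, with K = {k}, gives s^2 <= C^2 s for the
  partial sum s of squares, hence s <= C^2.\<close>

lemma row_l2: "l2_seq (M k)"
proof (rule l2_seq_bounded_sums)
  fix S :: "int set" assume S: "finite S"
  define s where "s = (\<Sum>j\<in>S. (cmod (M k j))\<^sup>2)"
  have "(\<Sum>j\<in>S. M k j * cnj (M k j)) = of_real s"
    unfolding s_def by (simp add: complex_norm_square del: of_real_power)
  then have "(cmod (\<Sum>j\<in>S. M k j * cnj (M k j)))\<^sup>2 = s\<^sup>2" by simp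
  then have "s\<^sup>2 \<le> C\<^sup>2 * s"
    using bound[OF S, of "{k}" "\<lambda>j. cnj (M k j)"] by (simp only: s_def) simp
  then have "s * (s - C\<^sup>2) \<le> 0" by (simp add: algebra_simps power2_eq_square)
  moreover have "s * (s - C\<^sup>2) > 0" if "s > C\<^sup>2"
    using that order.strict_trans1[OF zero_le_power2 that] by (intro mult_pos_pos) auto
  ultimately show "s \<le> C\<^sup>2" by (meson not_le)
qed

lemma row_summable: "l2_seq a \<Longrightarrow> (\<lambda>j. norm (M k j * a j)) summable_on UNIV"
  by (intro l2_seq_mult_abs_summable row_l2)

lemma row_summable': "l2_seq a \<Longrightarrow> (\<lambda>j. M k j * a j) summable_on UNIV"
  by (rule abs_summable_summable) (rule row_summable)

definition row_sums :: "(int \<Rightarrow> complex) \<Rightarrow> int \<Rightarrow> complex"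
  where "row_sums a k = (\<Sum>\<^sub>\<infinity>j. M k j * a j)"

lemma row_sums_bound:
  assumes "finite K"
  shows "(\<Sum>k\<in>K. (cmod (row_sums (seq_of a) k))\<^sup>2) \<le> (C * norm a)\<^sup>2"
proof (rule tendsto_upperbound)
  show "((\<lambda>S. \<Sum>k\<in>K. (cmod (\<Sum>j\<in>S. M k j * seq_of a j))\<^sup>2) \<longlongrightarrow>
      (\<Sum>k\<in>K. (cmod (row_sums (seq_of a) k))\<^sup>2)) (finite_subsets_at_top UNIV)"
    unfolding row_sums_def by (intro tendsto_intros infsum_tendsto row_summable') simp
  show "\<forall>\<^sub>F S in finite_subsets_at_top UNIV.
      (\<Sum>k\<in>K. (cmod (\<Sum>j\<in>S. M k j * seq_of a j))\<^sup>2) \<le> (C * norm a)\<^sup>2"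
  proof (rule eventually_finite_subsets_at_top_weakI)
    fix S :: "int set" assume S: "finite S"
    show "(\<Sum>k\<in>K. (cmod (\<Sum>j\<in>S. M k j * seq_of a j))\<^sup>2) \<le> (C * norm a)\<^sup>2"
      unfolding power_mult_distrib
      by (rule order_trans[OF bound[OF S assms]])
        (intro mult_left_mono sum_le_norm_l2 S zero_le_power2)
  qed
qed simp

lemma l2_seq_row_sums: "l2_seq a \<Longrightarrow> l2_seq (row_sums a)"
  using row_sums_bound[of _ "Abs_l2 a"] by (intro l2_seq_bounded_sums) (auto simp: Abs_l2_inverse)

lift_definition matrix_op :: "l2 \<Rightarrow> l2" is row_sums
  by (rule l2_seq_row_sums)

lemma bounded_linear_matrix_op: "bounded_linear matrix_op"
proof (rule bounded_linear_intro)
  fix a b :: l2 and r :: real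
  show "matrix_op (a + b) = matrix_op a + matrix_op b"
    by transfer (simp add: row_sums_def[abs_def] distrib_left infsum_add row_summable')
  show "matrix_op (r *\<^sub>R a) = r *\<^sub>R matrix_op a"
  proof (transfer, rule ext)
    fix r a k assume "l2_seq a"
    have "row_sums (\<lambda>j. complex_of_real r * a j) k = (\<Sum>\<^sub>\<infinity>j. complex_of_real r * (M k j * a j))"
      unfolding row_sums_def by (simp add: mult.left_commute)
    also have "\<dots> = complex_of_real r * row_sums a k"
      unfolding row_sums_def by (rule infsum_cmult_right) (rule row_summable'[OF \<open>l2_seq a\<close>])
    finally show "row_sums (\<lambda>j. complex_of_real r * a j) k = complex_of_real r * row_sums a k" .
  qed
  show "norm (matrix_op a) \<le> norm a * C"
    using row_sums_bound[of _ a] C_nonneg by (intro norm_l2_le) (auto simp: matrix_op.rep_eq mult.commute)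
qed

lemma inner_matrix_op_restrict:
  assumes "finite S"
  shows "inner (matrix_op (restrict_l2 S a)) (restrict_l2 S a) =
    Re (\<Sum>k\<in>S. \<Sum>j\<in>S. M k j * seq_of a j * cnj (seq_of a k))"
proof -
  have *: "row_sums (seq_of (restrict_l2 S a)) k = (\<Sum>j\<in>S. M k j * seq_of a j)" for k
  proof -
    have "row_sums (seq_of (restrict_l2 S a)) k = (\<Sum>\<^sub>\<infinity>j\<in>S. M k j * seq_of a j)"
      unfolding row_sums_def by (rule infsum_cong_neutral) (auto simp: restrict_l2.rep_eq)
    then show ?thesis using assms by simp
  qed
  have "inner (matrix_op (restrict_l2 S a)) (restrict_l2 S a) =
      (\<Sum>\<^sub>\<infinity>k\<in>S. Re ((\<Sum>j\<in>S. M k j * seq_of a j) * cnj (seq_of a k)))"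
    unfolding inner_l2_def matrix_op.rep_eq *
    by (rule infsum_cong_neutral) (auto simp: restrict_l2.rep_eq)
  then show ?thesis using assms by (simp add: sum_distrib_right)
qed

text \<open>Both sides are continuous in a, and on finite truncations the claim is the assumed
  inequality for finite sums.\<close>

lemma coercive_matrix_op:
  assumes "\<And>S a. finite S \<Longrightarrow> c * (\<Sum>j\<in>S. (cmod (a j))\<^sup>2) \<le>
    Re (\<Sum>k\<in>S. \<Sum>j\<in>S. M k j * a j * cnj (a k))"
  shows "c * (norm a)\<^sup>2 \<le> inner (matrix_op a) a"
proof (rule tendsto_le)
  show "((\<lambda>S. inner (matrix_op (restrict_l2 S a)) (restrict_l2 S a)) \<longlongrightarrow> inner (matrix_op a) a)
      (finite_subsets_at_top UNIV)"
    by (intro tendsto_intros restrict_l2_tendsto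
        bounded_linear.tendsto[OF bounded_linear_matrix_op])
  show "((\<lambda>S. c * (\<Sum>j\<in>S. (cmod (seq_of a j))\<^sup>2)) \<longlongrightarrow> c * (norm a)\<^sup>2) (finite_subsets_at_top UNIV)"
    unfolding norm_l2_power2 by (intro tendsto_intros infsum_tendsto[OF seq_of_summable])
  show "\<forall>\<^sub>F S in finite_subsets_at_top UNIV. c * (\<Sum>j\<in>S. (cmod (seq_of a j))\<^sup>2) \<le>
      inner (matrix_op (restrict_l2 S a)) (restrict_l2 S a)"
    by (rule eventually_finite_subsets_at_top_weakI) (simp only: inner_matrix_op_restrict assms)
qed simp

text \<open>Existence is Lax-Milgram. For uniqueness, coercivity is applied to the difference of two
  solutions, which \<open>matrix_op\<close> sends to 0.\<close>

lemma ex1_solution: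
  assumes "c > 0"
    and "\<And>S a. finite S \<Longrightarrow> c * (\<Sum>j\<in>S. (cmod (a j))\<^sup>2) \<le>
      Re (\<Sum>k\<in>S. \<Sum>j\<in>S. M k j * a j * cnj (a k))"
    and d: "l2_seq d"
  shows "\<exists>!a. l2_seq a \<and> (\<forall>k. (\<Sum>\<^sub>\<infinity>j. M k j * a j) = d k)"
proof -
  note co = coercive_matrix_op[OF assms(2)]
  obtain x where x: "matrix_op x = Abs_l2 d"
    using lax_milgram_surj[OF bounded_linear_matrix_op assms(1) co] by blast
  have sol: "(\<forall>k. (\<Sum>\<^sub>\<infinity>j. M k j * seq_of y j) = d k) \<longleftrightarrow> matrix_op y = Abs_l2 d" for y
    using d by (auto simp: seq_of_inject[symmetric] matrix_op.rep_eq Abs_l2_inverse row_sums_def fun_eq_iff)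
  have uniq: "y = x" if "matrix_op y = Abs_l2 d" for y
  proof -
    have "matrix_op (y - x) = 0"
      using that x bounded_linear_matrix_op by (simp add: linear_diff bounded_linear.linear)
    then have "c * (norm (y - x))\<^sup>2 \<le> 0" using co[of "y - x"] by simp
    then show ?thesis using assms(1) by (simp add: mult_le_0_iff)
  qed
  show ?thesis
  proof (rule ex1I[of _ "seq_of x"])
    show "l2_seq (seq_of x) \<and> (\<forall>k. (\<Sum>\<^sub>\<infinity>j. M k j * seq_of x j) = d k)"
      using sol x by simp
    fix a assume a: "l2_seq a \<and> (\<forall>k. (\<Sum>\<^sub>\<infinity>j. M k j * a j) = d k)"
    then have "seq_of (Abs_l2 a) = a" by (simp add: Abs_l2_inverse)
    then show "a = seq_of x" using uniq sol a by metis
  qed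
qed

end

section \<open>Parseval's identity for truncations\<close>

lemma measurable_cis [measurable (raw)]:
  "f \<in> borel_measurable M \<Longrightarrow> (\<lambda>x. cis (f x)) \<in> borel_measurable M"
  unfolding cis_conv_exp by measurable

lemma measurable_cnj [measurable (raw)]:
  "f \<in> borel_measurable M \<Longrightarrow> (\<lambda>x. cnj (f x)) \<in> borel_measurable M"
  by (rule borel_measurable_continuous_on) (intro continuous_intros)

lemma tendsto_cis [tendsto_intros]: "(f \<longlongrightarrow> a) F \<Longrightarrow> ((\<lambda>x. cis (f x)) \<longlongrightarrow> cis a) F"
  unfolding cis_conv_exp by (intro tendsto_intros)

lemma integrable_mult_bounded:
  fixes f w :: "real \<Rightarrow> complex"
  assumes "integrable lborel f" "w \<in> borel_measurable borel" "\<And>x. cmod (w x) \<le> B"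
  shows "integrable lborel (\<lambda>x. f x * w x)"
proof (rule Bochner_Integration.integrable_bound)
  show "integrable lborel (\<lambda>x. B * norm (f x))" using assms(1) by auto
  show "(\<lambda>x. f x * w x) \<in> borel_measurable lborel" using assms(1,2) by measurable
  show "AE x in lborel. norm (f x * w x) \<le> norm (B * norm (f x))"
    using assms(3) by (auto simp: norm_mult mult.commute[of B] abs_mult
        intro!: mult_left_mono order_trans[OF _ abs_ge_self])
qed

text \<open>Since |k| <= 1, the product |h(x)||K(y)| is an integrable majorant. The exchanges of
  integrals in the Fourier arguments have this shape, with a character or a Gaussian as k.\<close>

lemma fubini_kernel:
  fixes h K :: "real \<Rightarrow> complex" and k :: "real \<Rightarrow> real \<Rightarrow> complex"
  assumes h: "integrable lborel h" and K: "integrable lborel K"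
    and [measurable]: "case_prod k \<in> borel_measurable (borel \<Otimes>\<^sub>M borel)"
    and k: "\<And>x y. cmod (k x y) \<le> 1"
  shows "(LINT y|lborel. (LINT x|lborel. h x * k x y) * K y) =
    (LINT x|lborel. h x * (LINT y|lborel. K y * k x y))"
proof -
  note [measurable] = borel_measurable_integrable[OF h] borel_measurable_integrable[OF K]
  define f where "f = (\<lambda>x y. h x * K y * k x y)"
  have fm [measurable]: "case_prod f \<in> borel_measurable (lborel \<Otimes>\<^sub>M lborel)"
    unfolding f_def by measurable
  have i1: "integrable lborel (\<lambda>y. f x y)" for x
    unfolding f_def by (intro integrable_mult_bounded[of _ _ 1] integrable_mult_right K k) auto
  have "integrable (lborel \<Otimes>\<^sub>M lborel) (case_prod f)"
  proof (rule lborel_pair.Fubini_integrable[OF fm])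
    show "AE x in lborel. integrable lborel (\<lambda>y. case_prod f (x, y))" using i1 by simp
    show "integrable lborel (\<lambda>x. LINT y|lborel. norm (case_prod f (x, y)))"
    proof (rule Bochner_Integration.integrable_bound)
      show "integrable lborel (\<lambda>x. norm (h x) * (LINT y|lborel. norm (K y)))"
        using h by auto
      have "(LINT y|lborel. norm (f x y)) \<le> (LINT y|lborel. norm (h x) * norm (K y))" for x
        using k K i1[of x] by (intro integral_mono integrable_norm integrable_mult_right)
          (auto simp: f_def norm_mult intro!: mult_left_le)
      then show "AE x in lborel. norm (LINT y|lborel. norm (case_prod f (x, y))) \<le>
          norm (norm (h x) * (LINT y|lborel. norm (K y)))"
        by (auto intro!: AE_I2 simp: abs_mult)
    qed measurable
  qed
  from lborel_pair.Fubini_integral[OF this]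
  have "(LINT y|lborel. LINT x|lborel. f x y) = (LINT x|lborel. LINT y|lborel. f x y)" .
  moreover have "(LINT x|lborel. f x y) = (LINT x|lborel. h x * k x y) * K y" for y
    unfolding f_def by (subst integral_mult_left_zero[symmetric]) (simp add: mult_ac)
  moreover have "(LINT y|lborel. f x y) = h x * (LINT y|lborel. K y * k x y)" for x
    unfolding f_def by (subst integral_mult_right_zero[symmetric]) (simp add: mult_ac)
  ultimately show ?thesis by simp
qed

section \<open>Gaussians: their transforms and averages against them\<close>

lemma gaussian_fourier:
  "(LINT x|lborel. complex_of_real (std_normal_density x) * cis (t * x)) =
    complex_of_real (exp (- t\<^sup>2 / 2))"
proof -
  have "char std_normal_distribution t =
      (LINT x|lborel. complex_of_real (std_normal_density x) * cis (t * x))"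
    unfolding char_def
    by (subst integral_density) (auto simp: scaleR_conv_of_real cis_conv_exp)
  then show ?thesis by (simp add: char_std_normal_distribution)
qed

lemma gaussian_fourier_scaled:
  assumes "s > 0"
  shows "(LINT x|lborel. complex_of_real (std_normal_density (s * x)) * cis (t * x)) =
    complex_of_real (sqrt (2 * pi) / s * std_normal_density (t / s))"
proof -
  have "complex_of_real (exp (- (t / s)\<^sup>2 / 2)) =
      s *\<^sub>R (LINT x|lborel. complex_of_real (std_normal_density (s * x)) * cis (t / s * (s * x)))"
    unfolding gaussian_fourier[symmetric]
    by (subst lborel_integral_real_affine[where c = s and t = 0]) (use assms in auto)
  then show ?thesis
    using assms by (simp add: std_normal_density_def field_simps scaleR_conv_of_real
        real_sqrt_mult)
qed

lemma integrable_gaussian: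
  "s > 0 \<Longrightarrow> integrable lborel (\<lambda>x. std_normal_density (s * x))"
  using lborel_integrable_real_affine[of std_normal_density s 0] by simp

text \<open>In this form the density is fixed and the argument of w is contracted towards x, so
  dominated convergence needs only boundedness of w and continuity at the single point x.\<close>

lemma approx_identity:
  fixes w :: "real \<Rightarrow> complex"
  assumes [measurable]: "w \<in> borel_measurable borel" and B: "\<And>x. cmod (w x) \<le> B"
    and cont: "isCont w x"
  shows "(\<lambda>m. LINT t|lborel. w (x + t / real (Suc m)) * complex_of_real (std_normal_density t))
    \<longlonglongrightarrow> w x"
proof -
  have "(\<lambda>m. LINT t|lborel. w (x + t / real (Suc m)) * complex_of_real (std_normal_density t))
      \<longlonglongrightarrow> (LINT t|lborel. w x * complex_of_real (std_normal_density t))"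
  proof (rule integral_dominated_convergence[where w = "\<lambda>t. B * std_normal_density t"])
    show "AE t in lborel. (\<lambda>m. w (x + t / real (Suc m)) * complex_of_real (std_normal_density t))
        \<longlonglongrightarrow> w x * complex_of_real (std_normal_density t)"
    proof (intro AE_I2 tendsto_mult tendsto_const)
      fix t :: real
      have "(\<lambda>m. t / real (Suc m)) \<longlonglongrightarrow> 0"
        using LIMSEQ_Suc[OF lim_const_over_n[of t]] by simp
      then have "(\<lambda>m. x + t / real (Suc m)) \<longlonglongrightarrow> x + 0" by (intro tendsto_intros)
      then show "(\<lambda>m. w (x + t / real (Suc m))) \<longlonglongrightarrow> w x"
        using isCont_tendsto_compose[OF cont] by simp
    qed
    show "AE t in lborel. norm (w (x + t / real (Suc m)) * complex_of_real (std_normal_density t))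
        \<le> B * std_normal_density t" for m
      using B by (auto simp: norm_mult intro!: mult_right_mono)
  qed auto
  then show ?thesis by simp
qed

lemma approx_identity_bound:
  fixes w :: "real \<Rightarrow> complex"
  assumes [measurable]: "w \<in> borel_measurable borel" and B: "\<And>x. cmod (w x) \<le> B"
  shows "cmod (LINT t|lborel. w (x + t / m) * complex_of_real (std_normal_density t)) \<le> B"
proof -
  have wi: "integrable lborel (\<lambda>t. w (x + t / m) * complex_of_real (std_normal_density t))"
    by (subst mult.commute, rule integrable_mult_bounded[of _ _ B]) (use B in auto)
  have "norm (LINT t|lborel. w (x + t / m) * complex_of_real (std_normal_density t)) \<le>
      (LINT t|lborel. B * std_normal_density t)"
    by (rule Bochner_Integration.integral_norm_bound_integral[OF wi])
      (use B in \<open>auto simp: norm_mult intro!: mult_right_mono\<close>)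
  then show ?thesis by simp
qed

text \<open>Passes from the form convenient for limits to a convolution with a narrow Gaussian, the
  form that Fubini and the Fourier transform of a wide Gaussian produce.\<close>

lemma gaussian_average_rescale:
  fixes w :: "real \<Rightarrow> complex"
  assumes [measurable]: "w \<in> borel_measurable borel"
  shows "(LINT t|lborel. w (x + t / real (Suc m)) * complex_of_real (std_normal_density t)) =
    complex_of_real (real (Suc m)) *
      (LINT y|lborel. w y * complex_of_real (std_normal_density (real (Suc m) * (y - x))))"
proof -
  have "(LINT t|lborel. w (x + t / real (Suc m)) * complex_of_real (std_normal_density t)) =
      real (Suc m) *\<^sub>R (LINT y|lborel.
        w (x + (- real (Suc m) * x + real (Suc m) * y) / real (Suc m)) *
        complex_of_real (std_normal_density (- real (Suc m) * x + real (Suc m) * y)))"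
    by (subst lborel_integral_real_affine[where c = "real (Suc m)" and t = "- real (Suc m) * x"]) auto
  also have "\<dots> = real (Suc m) *\<^sub>R (LINT y|lborel. w y *
      complex_of_real (std_normal_density (real (Suc m) * (y - x))))"
    by (intro arg_cong2[where f = scaleR] refl Bochner_Integration.integral_cong)
       (simp_all add: field_simps del: of_nat_Suc)
  finally show ?thesis by (simp only: scaleR_conv_of_real)
qed

definition ft :: "(real \<Rightarrow> complex) \<Rightarrow> real \<Rightarrow> complex"
  where "ft h \<xi> = complex_of_real (1 / sqrt (2 * pi)) * (LINT x|lborel. h x * cis (- (\<xi> * x)))"

lemma borel_measurable_ft [measurable]:
  assumes [measurable]: "h \<in> borel_measurable borel"
  shows "ft h \<in> borel_measurable borel"
proof -
  have "(\<lambda>\<xi>. LINT x|lborel. h x * cis (- (\<xi> * x))) \<in> borel_measurable borel"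
    by measurable
  then show ?thesis unfolding ft_def[abs_def] by measurable
qed

lemma cmod_ft_le:
  "cmod (ft h \<xi>) \<le> 1 / sqrt (2 * pi) * (LINT x|lborel. cmod (h x))"
proof -
  have "cmod (LINT x|lborel. h x * cis (- (\<xi> * x))) \<le> (LINT x|lborel. cmod (h x * cis (- (\<xi> * x))))"
    by (rule integral_norm_bound)
  then show ?thesis by (simp add: ft_def norm_mult norm_divide divide_right_mono)
qed

text \<open>Truncations and box functions belong to this class. Almost everywhere continuity is what lets Gaussian
  averages of such a function converge to it almost everywhere.\<close>

definition nice :: "(real \<Rightarrow> complex) \<Rightarrow> bool" where
  "nice h \<longleftrightarrow> h \<in> borel_measurable borel \<and> (\<exists>B. \<forall>x. cmod (h x) \<le> B) \<and>
     (\<exists>M. \<forall>x. x \<notin> {-M..M} \<longrightarrow> h x = 0) \<and> (AE x in lborel. isCont h x)"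

lemma nice_integrable:
  assumes "nice h"
  shows "integrable lborel h"
proof -
  obtain B M where "h \<in> borel_measurable borel" "\<And>x. cmod (h x) \<le> B" "\<And>x. x \<notin> {-M..M} \<Longrightarrow> h x = 0"
    using assms unfolding nice_def by blast
  then show ?thesis
    by (intro integrableI_bounded_set[where A = "{-M..M}" and B = B])
      (auto simp: emeasure_lborel_Icc_eq)
qed

text \<open>The Gaussian factor makes both applications of Fubini legitimate; its transform is an approximate identity.\<close>

lemma parseval_gaussian:
  assumes "nice h" "nice u"
  shows "(\<lambda>m. LINT \<xi>|lborel. ft h \<xi> * cnj (ft u \<xi>) *
       complex_of_real (sqrt (2 * pi) * std_normal_density (inverse (real (Suc m)) * \<xi>)))
    \<longlonglongrightarrow> (LINT x|lborel. h x * cnj (u x))"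
proof -
  obtain B where B: "\<And>x. cmod (u x) \<le> B" using assms unfolding nice_def by blast
  have [measurable]: "h \<in> borel_measurable borel" "u \<in> borel_measurable borel"
    using assms unfolding nice_def by auto
  have hi: "integrable lborel h" and ui: "integrable lborel u"
    using assms nice_integrable by auto
  \<comment> \<open>The factor sqrt(2 pi) normalises the value at 0 to 1: \<open>g m\<close> is
    exp(-\<xi>^2 / (2 (m+1)^2)), which tends to 1 everywhere.\<close>
  define g where "g m \<xi> = complex_of_real (sqrt (2 * pi) * std_normal_density (inverse (real (Suc m)) * \<xi>))"
    for m \<xi>
  have gi: "integrable lborel (g m)" for m
    unfolding g_def using integrable_gaussian[of "inverse (real (Suc m))"]
    by (intro integrable_of_real integrable_mult_right) auto
  define A where "A m x = (LINT t|lborel. cnj (u (x + t / real (Suc m))) * complex_of_real (std_normal_density t))"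
    for m x
  have inner: "(LINT \<xi>|lborel. cnj (ft u \<xi>) * g m \<xi> * cis (- (\<xi> * x))) = sqrt (2 * pi) * A m x" for m x
  proof -
    have gc: "integrable lborel (\<lambda>\<xi>. g m \<xi> * cis (- (\<xi> * x)))"
      by (intro integrable_mult_bounded[of _ _ 1] gi) auto
    have cf: "cnj (ft u \<xi>) = complex_of_real (1 / sqrt (2 * pi)) *
        (LINT y|lborel. cnj (u y) * cis (\<xi> * y))" for \<xi>
    proof -
      have "cnj (LINT x|lborel. u x * cis (- (\<xi> * x))) = (LINT y|lborel. cnj (u y) * cis (\<xi> * y))"
        unfolding Bochner_Integration.integral_cnj[symmetric] by (simp add: cis_cnj)
      then show ?thesis by (simp add: ft_def)
    qed
    have "(LINT \<xi>|lborel. cnj (ft u \<xi>) * g m \<xi> * cis (- (\<xi> * x))) =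
      complex_of_real (1 / sqrt (2 * pi)) *
        (LINT \<xi>|lborel. (LINT y|lborel. cnj (u y) * cis (\<xi> * y)) * (g m \<xi> * cis (- (\<xi> * x))))"
      by (subst integral_mult_right_zero[symmetric])
        (simp only: cf mult_ac)
    also have "(LINT \<xi>|lborel. (LINT y|lborel. cnj (u y) * cis (\<xi> * y)) * (g m \<xi> * cis (- (\<xi> * x)))) =
      (LINT y|lborel. cnj (u y) * (LINT \<xi>|lborel. g m \<xi> * cis (- (\<xi> * x)) * cis (\<xi> * y)))"
      using ui gc by (intro fubini_kernel) auto
    also have "(\<lambda>y. LINT \<xi>|lborel. g m \<xi> * cis (- (\<xi> * x)) * cis (\<xi> * y)) =
      (\<lambda>y. complex_of_real (2 * pi * real (Suc m) * std_normal_density (real (Suc m) * (y - x))))"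
    proof
      fix y
      have "g m \<xi> * cis (- (\<xi> * x)) * cis (\<xi> * y) = complex_of_real (sqrt (2 * pi)) *
        (complex_of_real (std_normal_density (inverse (real (Suc m)) * \<xi>)) * cis ((y - x) * \<xi>))" for \<xi>
        unfolding g_def mult.assoc cis_mult of_real_mult by (simp add: algebra_simps)
      then have "(LINT \<xi>|lborel. g m \<xi> * cis (- (\<xi> * x)) * cis (\<xi> * y)) =
        complex_of_real (sqrt (2 * pi)) *
        (LINT \<xi>|lborel. complex_of_real (std_normal_density (inverse (real (Suc m)) * \<xi>)) * cis ((y - x) * \<xi>))"
        by (simp only: integral_mult_right_zero)
      also have "\<dots> = complex_of_real (2 * pi * real (Suc m) * std_normal_density (real (Suc m) * (y - x)))"
        by (subst gaussian_fourier_scaled) (auto simp: divide_inverse mult_ac simp flip: of_real_mult)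
      finally show "(LINT \<xi>|lborel. g m \<xi> * cis (- (\<xi> * x)) * cis (\<xi> * y)) = \<dots>" .
    qed
    also have "(LINT y|lborel. cnj (u y) *
        complex_of_real (2 * pi * real (Suc m) * std_normal_density (real (Suc m) * (y - x)))) = 2 * pi * A m x"
    proof -
      have A: "A m x = (LINT y|lborel. complex_of_real (real (Suc m)) * (cnj (u y) *
          complex_of_real (std_normal_density (real (Suc m) * (y - x)))))"
        unfolding A_def by (subst gaussian_average_rescale) auto
      have "(LINT y|lborel. cnj (u y) *
          complex_of_real (2 * pi * real (Suc m) * std_normal_density (real (Suc m) * (y - x)))) =
        (LINT y|lborel. complex_of_real (2 * pi) * (complex_of_real (real (Suc m)) * (cnj (u y) *
          complex_of_real (std_normal_density (real (Suc m) * (y - x))))))"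
        by (simp only: of_real_mult mult_ac)
      then show ?thesis unfolding A by simp
    qed
    finally have "(LINT \<xi>|lborel. cnj (ft u \<xi>) * g m \<xi> * cis (- (\<xi> * x))) =
        complex_of_real (1 / sqrt (2 * pi)) * complex_of_real (2 * pi) * A m x"
      by (simp only: mult.assoc)
    moreover have "complex_of_real (1 / sqrt (2 * pi)) * complex_of_real (2 * pi) =
        complex_of_real (sqrt (2 * pi))"
      by (simp only: of_real_mult[symmetric] of_real_eq_iff) (simp add: real_div_sqrt)
    ultimately show ?thesis by (simp only:)
  qed
  have lhs: "(LINT \<xi>|lborel. ft h \<xi> * cnj (ft u \<xi>) * g m \<xi>) = (LINT x|lborel. h x * A m x)" for m
  proof -
    have gu: "integrable lborel (\<lambda>\<xi>. cnj (ft u \<xi>) * g m \<xi>)"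
      by (subst mult.commute, rule integrable_mult_bounded[OF gi]) (use cmod_ft_le in auto)
    have "(LINT \<xi>|lborel. ft h \<xi> * cnj (ft u \<xi>) * g m \<xi>) =
      complex_of_real (1 / sqrt (2 * pi)) *
        (LINT \<xi>|lborel. (LINT x|lborel. h x * cis (- (\<xi> * x))) * (cnj (ft u \<xi>) * g m \<xi>))"
      by (subst integral_mult_right_zero[symmetric]) (simp add: ft_def mult_ac)
    also have "(LINT \<xi>|lborel. (LINT x|lborel. h x * cis (- (\<xi> * x))) * (cnj (ft u \<xi>) * g m \<xi>)) =
      (LINT x|lborel. h x * (LINT \<xi>|lborel. cnj (ft u \<xi>) * g m \<xi> * cis (- (\<xi> * x))))"
      using hi gu by (intro fubini_kernel) auto
    also have "\<dots> = (LINT x|lborel. complex_of_real (sqrt (2 * pi)) * (h x * A m x))"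
      unfolding inner by (simp only: mult.left_commute)
    also have "\<dots> = complex_of_real (sqrt (2 * pi)) * (LINT x|lborel. h x * A m x)"
      by (simp only: integral_mult_right_zero)
    finally show ?thesis by simp
  qed
  have "(\<lambda>m. LINT x|lborel. h x * A m x) \<longlonglongrightarrow> (LINT x|lborel. h x * cnj (u x))"
  proof (rule integral_dominated_convergence[where w = "\<lambda>x. cmod (h x) * B"])
    show "AE x in lborel. (\<lambda>m. h x * A m x) \<longlonglongrightarrow> h x * cnj (u x)"
    proof -
      have "AE x in lborel. isCont u x" using assms(2) by (simp add: nice_def)
      then show ?thesis
      proof eventually_elim
        case (elim x)
        have "(\<lambda>m. A m x) \<longlonglongrightarrow> cnj (u x)" unfolding A_def
          by (rule approx_identity[of _ B]) (use B elim in auto)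
        then show ?case by (intro tendsto_intros)
      qed
    qed
    show "AE x in lborel. norm (h x * A m x) \<le> cmod (h x) * B" for m
      unfolding A_def norm_mult
      by (intro AE_I2 mult_left_mono approx_identity_bound) (use B in auto)
    show "(\<lambda>x. h x * A m x) \<in> borel_measurable lborel" for m
      unfolding A_def by measurable
  qed (use hi in auto)
  then show ?thesis unfolding lhs[symmetric] g_def .
qed


section \<open>Square-integrability, and Parseval without the Gaussian factor\<close>

lemma sq_int_iff:
  "sq_int f \<longleftrightarrow> f \<in> borel_measurable borel \<and> integrable lborel (\<lambda>x. (cmod (f x))\<^sup>2)"
  unfolding sq_int_def by (auto simp: integrable_iff_bounded)

lemma sq_int_measurable [measurable_dest]: "sq_int f \<Longrightarrow> f \<in> borel_measurable borel"
  by (simp add: sq_int_iff)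

lemma sq_int_integrable: "sq_int f \<Longrightarrow> integrable lborel (\<lambda>x. (cmod (f x))\<^sup>2)"
  by (simp add: sq_int_iff)

lemma integrable_sq_int_mult:
  assumes "sq_int f" "sq_int g" and [measurable]: "w \<in> borel_measurable borel"
    and w: "\<And>x. cmod (w x) \<le> 1"
  shows "integrable lborel (\<lambda>x. f x * cnj (g x) * w x)"
proof (rule Bochner_Integration.integrable_bound)
  note [measurable] = sq_int_measurable[OF assms(1)] sq_int_measurable[OF assms(2)]
  show "integrable lborel (\<lambda>x. (cmod (f x))\<^sup>2 + (cmod (g x))\<^sup>2)"
    using assms(1,2) by (intro Bochner_Integration.integrable_add sq_int_integrable)
  show "(\<lambda>x. f x * cnj (g x) * w x) \<in> borel_measurable lborel" by measurable
  have "cmod (f x) * cmod (g x) * cmod (w x) \<le> (cmod (f x))\<^sup>2 + (cmod (g x))\<^sup>2" for x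
  proof -
    have "cmod (f x) * cmod (g x) * cmod (w x) \<le> cmod (f x) * cmod (g x)"
      using w by (intro mult_left_le) auto
    also have "\<dots> \<le> (cmod (f x))\<^sup>2 + (cmod (g x))\<^sup>2"
      using sum_squares_bound[of "cmod (f x)" "cmod (g x)"]
        zero_le_power2[of "cmod (f x)"] zero_le_power2[of "cmod (g x)"] by linarith
    finally show ?thesis .
  qed
  then show "AE x in lborel. norm (f x * cnj (g x) * w x) \<le> norm ((cmod (f x))\<^sup>2 + (cmod (g x))\<^sup>2)"
    by (auto simp: norm_mult)
qed

text \<open>Taking u = h in \<open>parseval_gaussian\<close>, the Gaussian-damped integrals of |ft
  h|^2 converge to the squared norm of h. The damping tends to 1 pointwise, so Fatou's lemma bounds
  the undamped integral.\<close>

lemma nice_ft_sq_int: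
  assumes "nice h"
  shows "sq_int (ft h)"
proof -
  have [measurable]: "h \<in> borel_measurable borel" using assms by (simp add: nice_def)
  have [measurable]: "ft h \<in> borel_measurable borel" by simp
  define g where "g m \<xi> = sqrt (2 * pi) * std_normal_density (inverse (real (Suc m)) * \<xi>)" for m \<xi>
  have g1: "(\<lambda>m. g m \<xi>) \<longlonglongrightarrow> 1" for \<xi>
  proof -
    have "(\<lambda>m. exp (- ((inverse (real (Suc m)) * \<xi>)\<^sup>2) / 2)) \<longlonglongrightarrow> exp (- ((0 * \<xi>)\<^sup>2) / 2)"
      by (intro tendsto_intros LIMSEQ_inverse_real_of_nat) auto
    then show ?thesis by (simp add: g_def std_normal_density_def real_sqrt_mult)
  qed
  have gi: "integrable lborel (g m)" for m
    unfolding g_def using integrable_gaussian[of "inverse (real (Suc m))"] by simp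
  have g0: "0 \<le> g m \<xi>" for m \<xi> by (simp add: g_def)
  have int: "integrable lborel (\<lambda>\<xi>. (cmod (ft h \<xi>))\<^sup>2 * g m \<xi>)" for m
  proof (rule Bochner_Integration.integrable_bound)
    show "integrable lborel (\<lambda>\<xi>. (1 / sqrt (2 * pi) * (LINT x|lborel. cmod (h x)))\<^sup>2 * g m \<xi>)"
      using gi by simp
    show "AE \<xi> in lborel. norm ((cmod (ft h \<xi>))\<^sup>2 * g m \<xi>) \<le>
        norm ((1 / sqrt (2 * pi) * (LINT x|lborel. cmod (h x)))\<^sup>2 * g m \<xi>)"
      using g0 cmod_ft_le[of h] by (intro AE_I2) (auto simp: abs_mult intro!: mult_right_mono power_mono)
  qed (simp add: g_def)
  have "(\<lambda>m. complex_of_real (LINT \<xi>|lborel. (cmod (ft h \<xi>))\<^sup>2 * g m \<xi>)) \<longlonglongrightarrow>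
      (LINT x|lborel. h x * cnj (h x))"
  proof -
    have "complex_of_real (LINT \<xi>|lborel. (cmod (ft h \<xi>))\<^sup>2 * g m \<xi>) =
        (LINT \<xi>|lborel. ft h \<xi> * cnj (ft h \<xi>) * complex_of_real (g m \<xi>))" for m
      unfolding integral_complex_of_real[symmetric] of_real_mult complex_norm_square ..
    then show ?thesis using parseval_gaussian[OF assms assms] by (simp only: g_def)
  qed
  then have lim: "(\<lambda>m. LINT \<xi>|lborel. (cmod (ft h \<xi>))\<^sup>2 * g m \<xi>) \<longlonglongrightarrow> Re (LINT x|lborel. h x * cnj (h x))"
    using tendsto_Re by fastforce
  have "(\<integral>\<^sup>+ \<xi>. ennreal ((cmod (ft h \<xi>))\<^sup>2) \<partial>lborel) =
      (\<integral>\<^sup>+ \<xi>. liminf (\<lambda>m. ennreal ((cmod (ft h \<xi>))\<^sup>2 * g m \<xi>)) \<partial>lborel)"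
  proof (rule nn_integral_cong)
    fix \<xi>
    have "(\<lambda>m. ennreal ((cmod (ft h \<xi>))\<^sup>2 * g m \<xi>)) \<longlonglongrightarrow> ennreal ((cmod (ft h \<xi>))\<^sup>2 * 1)"
      by (intro tendsto_intros g1)
    then show "ennreal ((cmod (ft h \<xi>))\<^sup>2) = liminf (\<lambda>m. ennreal ((cmod (ft h \<xi>))\<^sup>2 * g m \<xi>))"
      by (subst lim_imp_Liminf[where f = "\<lambda>m. ennreal ((cmod (ft h \<xi>))\<^sup>2 * g m \<xi>)"]) auto
  qed
  also have "\<dots> \<le> liminf (\<lambda>m. \<integral>\<^sup>+ \<xi>. ennreal ((cmod (ft h \<xi>))\<^sup>2 * g m \<xi>) \<partial>lborel)"
    by (rule nn_integral_liminf) (simp add: g_def)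
  also have "(\<lambda>m. \<integral>\<^sup>+ \<xi>. ennreal ((cmod (ft h \<xi>))\<^sup>2 * g m \<xi>) \<partial>lborel) =
      (\<lambda>m. ennreal (LINT \<xi>|lborel. (cmod (ft h \<xi>))\<^sup>2 * g m \<xi>))"
    using g0 by (intro ext nn_integral_eq_integral int) auto
  also have "liminf \<dots> = ennreal (Re (LINT x|lborel. h x * cnj (h x)))"
    using lim by (intro lim_imp_Liminf tendsto_ennrealI) auto
  also have "\<dots> < \<infinity>" by simp
  finally show ?thesis by (simp add: sq_int_def)
qed

text \<open>Both transforms are now known to be in L2, so their product is an integrable majorant
  and the Gaussian factor, which lies between 0 and 1, is removed by dominated convergence.\<close>

lemma parseval_nice:
  assumes "nice h" "nice u"
  shows "(LINT \<xi>|lborel. ft h \<xi> * cnj (ft u \<xi>)) = (LINT x|lborel. h x * cnj (u x))"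
proof (rule LIMSEQ_unique[OF _ parseval_gaussian[OF assms]])
  have [measurable]: "h \<in> borel_measurable borel" "u \<in> borel_measurable borel"
    using assms by (auto simp: nice_def)
  have [measurable]: "ft h \<in> borel_measurable borel" "ft u \<in> borel_measurable borel" by auto
  have si: "sq_int (ft h)" "sq_int (ft u)" using assms nice_ft_sq_int by auto
  show "(\<lambda>m. LINT \<xi>|lborel. ft h \<xi> * cnj (ft u \<xi>) *
       complex_of_real (sqrt (2 * pi) * std_normal_density (inverse (real (Suc m)) * \<xi>)))
    \<longlonglongrightarrow> (LINT \<xi>|lborel. ft h \<xi> * cnj (ft u \<xi>))"
  proof (rule integral_dominated_convergence[where w = "\<lambda>\<xi>. cmod (ft h \<xi> * cnj (ft u \<xi>) * 1)"])
    show "integrable lborel (\<lambda>\<xi>. cmod (ft h \<xi> * cnj (ft u \<xi>) * 1))"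
      by (intro integrable_norm integrable_sq_int_mult si) auto
    show "AE \<xi> in lborel. (\<lambda>m. ft h \<xi> * cnj (ft u \<xi>) *
       complex_of_real (sqrt (2 * pi) * std_normal_density (inverse (real (Suc m)) * \<xi>))) \<longlonglongrightarrow>
       ft h \<xi> * cnj (ft u \<xi>)"
    proof (rule AE_I2)
      fix \<xi> :: real
      have "(\<lambda>m. exp (- ((inverse (real (Suc m)) * \<xi>)\<^sup>2) / 2)) \<longlonglongrightarrow> exp (- ((0 * \<xi>)\<^sup>2) / 2)"
        by (intro tendsto_intros LIMSEQ_inverse_real_of_nat) auto
      then have "(\<lambda>m. sqrt (2 * pi) * std_normal_density (inverse (real (Suc m)) * \<xi>)) \<longlonglongrightarrow> 1"
        by (simp add: std_normal_density_def real_sqrt_mult)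
      then have "(\<lambda>m. ft h \<xi> * cnj (ft u \<xi>) *
         complex_of_real (sqrt (2 * pi) * std_normal_density (inverse (real (Suc m)) * \<xi>)))
         \<longlonglongrightarrow> ft h \<xi> * cnj (ft u \<xi>) * complex_of_real 1"
        by (intro tendsto_intros)
      then show "(\<lambda>m. ft h \<xi> * cnj (ft u \<xi>) *
         complex_of_real (sqrt (2 * pi) * std_normal_density (inverse (real (Suc m)) * \<xi>)))
         \<longlonglongrightarrow> ft h \<xi> * cnj (ft u \<xi>)" by simp
    qed
    show "AE \<xi> in lborel. norm (ft h \<xi> * cnj (ft u \<xi>) *
       complex_of_real (sqrt (2 * pi) * std_normal_density (inverse (real (Suc m)) * \<xi>))) \<le>
       cmod (ft h \<xi> * cnj (ft u \<xi>) * 1)" for m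
    proof (rule AE_I2)
      fix \<xi>
      have "sqrt (2 * pi) * std_normal_density (inverse (real (Suc m)) * \<xi>) \<le> 1"
        by (simp add: std_normal_density_def real_sqrt_mult)
      then show "norm (ft h \<xi> * cnj (ft u \<xi>) *
         complex_of_real (sqrt (2 * pi) * std_normal_density (inverse (real (Suc m)) * \<xi>))) \<le>
         cmod (ft h \<xi> * cnj (ft u \<xi>) * 1)"
        unfolding norm_mult norm_of_real by (intro mult_left_mono) auto
    qed
  qed auto
qed

lemma ennreal_tendsto_0_if_power2:
  assumes "((\<lambda>n. (X n)\<^sup>2) \<longlongrightarrow> (0::ennreal)) F"
  shows "(X \<longlongrightarrow> 0) F"
proof (rule order_tendstoI)
  fix a :: ennreal assume "0 < a"
  then have "0 < a\<^sup>2" by (simp add: zero_less_iff_neq_zero)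
  with assms have "\<forall>\<^sub>F n in F. (X n)\<^sup>2 < a\<^sup>2" by (rule order_tendstoD)
  then show "\<forall>\<^sub>F n in F. X n < a"
    by eventually_elim (meson linorder_not_le power_mono zero_le)
qed simp

text \<open>Cauchy-Schwarz. The square of the integral is what it controls, hence the detour through
  squares in \<open>ennreal\<close>.\<close>

lemma nn_integral_mult_tendsto_0:
  fixes f g :: "nat \<Rightarrow> real \<Rightarrow> complex"
  assumes [measurable]: "\<And>n. f n \<in> borel_measurable borel" "\<And>n. g n \<in> borel_measurable borel"
    and "(\<lambda>n. \<integral>\<^sup>+ x. ennreal ((cmod (f n x))\<^sup>2) \<partial>lborel) \<longlonglongrightarrow> 0"
    and "(\<lambda>n. \<integral>\<^sup>+ x. ennreal ((cmod (g n x))\<^sup>2) \<partial>lborel) \<longlonglongrightarrow> c" "c < \<infinity>"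
  shows "(\<lambda>n. \<integral>\<^sup>+ x. ennreal (cmod (f n x) * cmod (g n x)) \<partial>lborel) \<longlonglongrightarrow> 0"
proof (rule ennreal_tendsto_0_if_power2, rule tendsto_sandwich[OF _ _ tendsto_const])
  show "\<forall>\<^sub>F n in sequentially. (\<integral>\<^sup>+ x. ennreal (cmod (f n x) * cmod (g n x)) \<partial>lborel)\<^sup>2 \<le>
     (\<integral>\<^sup>+ x. ennreal ((cmod (f n x))\<^sup>2) \<partial>lborel) * (\<integral>\<^sup>+ x. ennreal ((cmod (g n x))\<^sup>2) \<partial>lborel)"
    using Cauchy_Schwarz_nn_integral[of "\<lambda>x. ennreal (cmod (f n x))" lborel "\<lambda>x. ennreal (cmod (g n x))" for n]
    by (intro always_eventually allI) (simp add: ennreal_mult ennreal_power)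
  have "(\<lambda>n. (\<integral>\<^sup>+ x. ennreal ((cmod (f n x))\<^sup>2) \<partial>lborel) * (\<integral>\<^sup>+ x. ennreal ((cmod (g n x))\<^sup>2) \<partial>lborel))
      \<longlonglongrightarrow> 0 * c"
    using assms(3-5) by (intro tendsto_mult_ennreal) auto
  then show "(\<lambda>n. (\<integral>\<^sup>+ x. ennreal ((cmod (f n x))\<^sup>2) \<partial>lborel) * (\<integral>\<^sup>+ x. ennreal ((cmod (g n x))\<^sup>2) \<partial>lborel))
      \<longlonglongrightarrow> 0" by simp
qed auto

text \<open>The difference of the products splits into three terms, each with a factor tending to 0
  in L2. The bounded weight w makes room for the character that a translation produces.\<close>

lemma L2_pair_tendsto:
  fixes h k :: "nat \<Rightarrow> real \<Rightarrow> complex"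
  assumes si: "\<And>n. sq_int (h n)" "\<And>n. sq_int (k n)" "sq_int F" "sq_int G"
    and hF: "(\<lambda>n. L2dist2 (h n) F) \<longlonglongrightarrow> 0" and kG: "(\<lambda>n. L2dist2 (k n) G) \<longlonglongrightarrow> 0"
    and w [measurable]: "w \<in> borel_measurable borel" and w1: "\<And>x. cmod (w x) \<le> 1"
  shows "(\<lambda>n. LINT x|lborel. h n x * cnj (k n x) * w x) \<longlonglongrightarrow> (LINT x|lborel. F x * cnj (G x) * w x)"
proof (rule tendsto_L1_int)
  note [measurable] = si[THEN sq_int_measurable]
  show "integrable lborel (\<lambda>x. h n x * cnj (k n x) * w x)" for n
    by (rule integrable_sq_int_mult) (use si w w1 in auto)
  show "integrable lborel (\<lambda>x. F x * cnj (G x) * w x)"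
    by (rule integrable_sq_int_mult) (use si w w1 in auto)
  define A where "A n = (\<integral>\<^sup>+ x. ennreal (cmod (h n x - F x) * cmod (k n x - G x)) \<partial>lborel)" for n
  define B where "B n = (\<integral>\<^sup>+ x. ennreal (cmod (h n x - F x) * cmod (G x)) \<partial>lborel)" for n
  define C where "C n = (\<integral>\<^sup>+ x. ennreal (cmod (k n x - G x) * cmod (F x)) \<partial>lborel)" for n
  have "A \<longlonglongrightarrow> 0" unfolding A_def
    by (rule nn_integral_mult_tendsto_0[where c = 0]) (use hF kG in \<open>auto simp: L2dist2_def\<close>)
  moreover have "B \<longlonglongrightarrow> 0" unfolding B_def
    by (rule nn_integral_mult_tendsto_0[OF _ _ _ tendsto_const])
      (use hF si(4) in \<open>auto simp: L2dist2_def sq_int_def\<close>)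
  moreover have "C \<longlonglongrightarrow> 0" unfolding C_def
    by (rule nn_integral_mult_tendsto_0[OF _ _ _ tendsto_const])
      (use kG si(3) in \<open>auto simp: L2dist2_def sq_int_def\<close>)
  ultimately have "(\<lambda>n. A n + B n + C n) \<longlonglongrightarrow> 0 + 0 + 0"
    by (intro tendsto_add)
  then have lim: "(\<lambda>n. A n + B n + C n) \<longlonglongrightarrow> 0" by simp
  have "(\<integral>\<^sup>+ x. norm (h n x * cnj (k n x) * w x - F x * cnj (G x) * w x) \<partial>lborel) \<le> A n + B n + C n" for n
  proof -
    have "norm (h n x * cnj (k n x) * w x - F x * cnj (G x) * w x) \<le>
        cmod (h n x - F x) * cmod (k n x - G x) + cmod (h n x - F x) * cmod (G x) +
        cmod (k n x - G x) * cmod (F x)" for x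
    proof -
      have "norm (h n x * cnj (k n x) * w x - F x * cnj (G x) * w x) =
          norm (h n x * cnj (k n x) - F x * cnj (G x)) * norm (w x)"
        by (simp add: algebra_simps flip: norm_mult)
      also have "\<dots> \<le> norm (h n x * cnj (k n x) - F x * cnj (G x))"
        using w1 by (intro mult_left_le) auto
      also have "h n x * cnj (k n x) - F x * cnj (G x) =
          (h n x - F x) * cnj (k n x - G x) + (h n x - F x) * cnj (G x) + cnj (k n x - G x) * F x"
        by (simp add: algebra_simps)
      also have "norm \<dots> \<le> norm ((h n x - F x) * cnj (k n x - G x)) +
          norm ((h n x - F x) * cnj (G x)) + norm (cnj (k n x - G x) * F x)"
        by (intro order_trans[OF norm_triangle_ineq] add_mono order_refl norm_triangle_ineq)
      finally show ?thesis unfolding norm_mult complex_mod_cnj .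
    qed
    then have "(\<integral>\<^sup>+ x. norm (h n x * cnj (k n x) * w x - F x * cnj (G x) * w x) \<partial>lborel) \<le>
        (\<integral>\<^sup>+ x. ennreal (cmod (h n x - F x) * cmod (k n x - G x) + cmod (h n x - F x) * cmod (G x) +
        cmod (k n x - G x) * cmod (F x)) \<partial>lborel)"
      by (intro nn_integral_mono ennreal_leI)
    also have "\<dots> = A n + B n + C n"
      unfolding A_def B_def C_def by (simp add: nn_integral_add ennreal_plus)
    finally show ?thesis .
  qed
  then show "(\<lambda>n. \<integral>\<^sup>+ x. norm (h n x * cnj (k n x) * w x - F x * cnj (G x) * w x) \<partial>lborel) \<longlonglongrightarrow> 0"
    by (intro tendsto_sandwich[OF _ _ tendsto_const lim]) auto
qed

section \<open>Inversion, autocorrelation and positivity\<close>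

definition trunc :: "real \<Rightarrow> (real \<Rightarrow> complex) \<Rightarrow> real \<Rightarrow> complex"
  where "trunc R f x = indicator {-R..R} x *\<^sub>R f x"

lemma cmod_trunc_le: "cmod (trunc R f x) \<le> cmod (f x)"
  by (simp add: trunc_def indicator_def)

lemma borel_measurable_trunc [measurable]:
  "f \<in> borel_measurable borel \<Longrightarrow> trunc R f \<in> borel_measurable borel"
  unfolding trunc_def[abs_def] by measurable

lemma trunc_fourier_eq_ft: "trunc_fourier f R = ft (trunc R f)"
  by (rule ext) (simp add: trunc_fourier_def ft_def trunc_def set_lebesgue_integral_def
      cis_conv_exp)

text \<open>Continuity can fail only at the two endpoints, a null set.\<close>

lemma nice_indicator:
  assumes "continuous_on UNIV g"
  shows "nice (\<lambda>x. indicator {a..b} x *\<^sub>R g x)"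
  unfolding nice_def
proof (intro conjI)
  have [measurable]: "g \<in> borel_measurable borel"
    using assms by (rule borel_measurable_continuous_onI)
  show "(\<lambda>x. indicator {a..b} x *\<^sub>R g x) \<in> borel_measurable borel" by measurable
  have "bounded (g ` {a..b})"
    by (intro compact_imp_bounded compact_continuous_image continuous_on_subset[OF assms]) auto
  then obtain B where B: "\<And>x. x \<in> {a..b} \<Longrightarrow> cmod (g x) \<le> B" "B > 0"
    unfolding bounded_pos by blast
  then show "\<exists>B. \<forall>x. cmod (indicator {a..b} x *\<^sub>R g x) \<le> B"
    by (intro exI[of _ B]) (auto simp: indicator_def less_imp_le)
  show "\<exists>M. \<forall>x. x \<notin> {- M..M} \<longrightarrow> indicator {a..b} x *\<^sub>R g x = 0"
    by (intro exI[of _ "max \<bar>a\<bar> \<bar>b\<bar>"]) (auto simp: indicator_def)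
  have "frontier {a..b} \<subseteq> {a, b}" by (auto simp: frontier_def)
  then have "countable (frontier {a..b})" by (rule countable_subset) auto
  then have "AE x in lborel. x \<notin> frontier {a..b}"
    by (intro AE_not_in countable_imp_null_set_lborel)
  then show "AE x in lborel. isCont (\<lambda>x. indicator {a..b} x *\<^sub>R g x) x"
  proof eventually_elim
    case (elim x)
    then have "isCont (indicator {a..b} :: real \<Rightarrow> real) x" by (simp add: isCont_indicator)
    moreover have "isCont g x" using assms by (simp add: continuous_on_eq_continuous_at)
    ultimately show ?case by (intro continuous_intros)
  qed
qed

lemma nice_trunc_shift:
  assumes "continuous_on UNIV f"
  shows "nice (\<lambda>x. trunc R f (x - s))"
proof -
  have "(\<lambda>x. trunc R f (x - s)) = (\<lambda>x. indicator {s - R..s + R} x *\<^sub>R f (x - s))"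
    by (intro ext) (auto simp: trunc_def indicator_def of_bool_def)
  moreover have "continuous_on UNIV (\<lambda>x. f (x - s))"
    by (intro continuous_on_compose2[OF assms] continuous_intros) auto
  ultimately show ?thesis using nice_indicator[of "\<lambda>x. f (x - s)"] by simp
qed

lemma ft_shift: "ft (\<lambda>x. h (x - s)) \<xi> = cis (- (\<xi> * s)) * ft h \<xi>"
proof -
  have "(LINT x|lborel. h (x - s) * cis (- (\<xi> * x))) =
      (LINT x|lborel. h ((s + 1 * x) - s) * cis (- (\<xi> * (s + 1 * x))))"
    by (subst lborel_integral_real_affine[where c = 1 and t = s]) auto
  also have "\<dots> = (LINT x|lborel. cis (- (\<xi> * s)) * (h x * cis (- (\<xi> * x))))"
  proof (intro Bochner_Integration.integral_cong refl)
    fix x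
    have "cis (- (\<xi> * (s + 1 * x))) = cis (- (\<xi> * s)) * cis (- (\<xi> * x))"
      unfolding cis_mult by (simp add: algebra_simps)
    then show "h ((s + 1 * x) - s) * cis (- (\<xi> * (s + 1 * x))) = cis (- (\<xi> * s)) * (h x * cis (- (\<xi> * x)))"
      by simp
  qed
  finally show ?thesis by (simp add: ft_def)
qed

lemma fourier_L2_sequence:
  assumes "fourier_L2 f F"
  shows "(\<lambda>n. L2dist2 (ft (trunc (real n) f)) F) \<longlonglongrightarrow> 0"
  using assms filterlim_compose[OF _ filterlim_real_sequentially]
  unfolding fourier_L2_def trunc_fourier_eq_ft by blast

text \<open>A mean value over a shrinking interval, written as a pairing with a box of integral one
  so that \<open>parseval_nice\<close> can be applied to it. Rescaling to [0,1] makes the domain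
  independent of m.\<close>

lemma average_tendsto:
  fixes g :: "real \<Rightarrow> complex"
  assumes "continuous_on UNIV g"
  shows "(\<lambda>m. LINT y|lborel. g y * cnj (indicator {x..x + 1 / real (Suc m)} y *\<^sub>R complex_of_real (real (Suc m))))
    \<longlonglongrightarrow> g x"
proof -
  have [measurable]: "g \<in> borel_measurable borel"
    using assms by (rule borel_measurable_continuous_onI)
  have "bounded (g ` {x..x+1})"
    by (intro compact_imp_bounded compact_continuous_image continuous_on_subset[OF assms]) auto
  then obtain B where B: "\<And>y. y \<in> {x..x+1} \<Longrightarrow> cmod (g y) \<le> B"
    unfolding bounded_pos by blast
  have eq: "(LINT y|lborel. g y * cnj (indicator {x..x + 1 / real (Suc m)} y *\<^sub>R complex_of_real (real (Suc m)))) =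
      (LINT t|lborel. indicator {0..1} t *\<^sub>R g (x + t / real (Suc m)))" for m
  proof -
    have "(LINT y|lborel. g y * cnj (indicator {x..x + 1 / real (Suc m)} y *\<^sub>R complex_of_real (real (Suc m)))) =
      \<bar>1 / real (Suc m)\<bar> *\<^sub>R (LINT t|lborel. g (x + 1 / real (Suc m) * t) *
        cnj (indicator {x..x + 1 / real (Suc m)} (x + 1 / real (Suc m) * t) *\<^sub>R complex_of_real (real (Suc m))))"
      by (rule lborel_integral_real_affine) simp
    also have "(\<lambda>t. indicator {x..x + 1 / real (Suc m)} (x + 1 / real (Suc m) * t) :: real) = indicator {0..1}"
    proof
      fix t
      have "x \<le> x + 1 / real (Suc m) * t \<longleftrightarrow> 0 \<le> t"
        by (simp add: zero_le_divide_iff del: of_nat_Suc)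
      moreover have "x + 1 / real (Suc m) * t \<le> x + 1 / real (Suc m) \<longleftrightarrow> t \<le> 1"
        by (simp add: divide_le_cancel del: of_nat_Suc)
      ultimately show "indicator {x..x + 1 / real (Suc m)} (x + 1 / real (Suc m) * t) = (indicator {0..1} t :: real)"
        unfolding indicator_def atLeastAtMost_iff by simp
    qed
    also have "\<bar>1 / real (Suc m)\<bar> *\<^sub>R (LINT t|lborel. g (x + 1 / real (Suc m) * t) *
        cnj (indicator {0..1} t *\<^sub>R complex_of_real (real (Suc m)))) =
        (LINT t|lborel. \<bar>1 / real (Suc m)\<bar> *\<^sub>R (g (x + 1 / real (Suc m) * t) *
        cnj (indicator {0..1} t *\<^sub>R complex_of_real (real (Suc m)))))"
      by (rule integral_scaleR_right[symmetric])
    also have "\<dots> = (LINT t|lborel. indicator {0..1} t *\<^sub>R g (x + t / real (Suc m)))"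
      by (intro Bochner_Integration.integral_cong)
        (auto simp: scaleR_conv_of_real indicator_def field_simps simp del: of_nat_Suc)
    finally show ?thesis .
  qed
  have "(\<lambda>m. LINT t|lborel. indicator {0..1} t *\<^sub>R g (x + t / real (Suc m)))
      \<longlonglongrightarrow> (LINT t|lborel. indicator {0..1::real} t *\<^sub>R g x)"
  proof (rule integral_dominated_convergence[where w = "\<lambda>t. indicator {0..1} t * B"])
    show "AE t in lborel. (\<lambda>m. indicator {0..1} t *\<^sub>R g (x + t / real (Suc m))) \<longlonglongrightarrow> indicator {0..1} t *\<^sub>R g x"
    proof (intro AE_I2 tendsto_scaleR tendsto_const)
      fix t :: real
      have "(\<lambda>m. t / real (Suc m)) \<longlonglongrightarrow> 0"
        using LIMSEQ_Suc[OF lim_const_over_n[of t]] by simp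
      then have "(\<lambda>m. x + t / real (Suc m)) \<longlonglongrightarrow> x + 0" by (intro tendsto_intros)
      moreover have "isCont g x" using assms by (simp add: continuous_on_eq_continuous_at)
      ultimately show "(\<lambda>m. g (x + t / real (Suc m))) \<longlonglongrightarrow> g x"
        using isCont_tendsto_compose by force
    qed
    show "AE t in lborel. norm (indicator {0..1} t *\<^sub>R g (x + t / real (Suc m))) \<le> indicator {0..1} t * B" for m
    proof (rule AE_I2)
      fix t :: real
      have "x + t / real (Suc m) \<in> {x..x+1}" if "t \<in> {0..1}"
        using that by (auto simp: field_simps)
      then show "norm (indicator {0..1} t *\<^sub>R g (x + t / real (Suc m))) \<le> indicator {0..1} t * B"
        using B by (auto simp: indicator_def)
    qed
  qed auto
  then show ?thesis unfolding eq by simp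
qed

text \<open>Pair f with boxes of mass one shrinking to x. Parseval moves the pairing to F; on one
  side continuity of f gives f(x), on the other the transforms of the boxes tend to the character at
  x, dominated because F is integrable.\<close>

lemma fourier_L2_inversion:
  assumes fF: "fourier_L2 f F" and cont: "continuous_on UNIV f" and Fi: "integrable lborel F"
  shows "f x = complex_of_real (1 / sqrt (2 * pi)) * (LINT \<xi>|lborel. F \<xi> * cis (\<xi> * x))"
proof -
  define u where "u m y = indicator {x..x + 1 / real (Suc m)} y *\<^sub>R complex_of_real (real (Suc m))" for m y
  have si: "sq_int f" "sq_int F" using fF by (auto simp: fourier_L2_def)
  have [measurable]: "F \<in> borel_measurable borel" using Fi by auto
  have nu: "nice (u m)" for m
    unfolding u_def by (rule nice_indicator) (intro continuous_intros)
  have nf: "nice (trunc R f)" for R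
    using nice_trunc_shift[OF cont, of R 0] by simp
  have [measurable]: "u m \<in> borel_measurable borel" for m using nu by (simp add: nice_def)
  have key: "(LINT \<xi>|lborel. F \<xi> * cnj (ft (u m) \<xi>)) = (LINT y|lborel. f y * cnj (u m y))" for m
  proof (rule LIMSEQ_unique)
    have "(\<lambda>n. LINT \<xi>|lborel. ft (trunc (real n) f) \<xi> * cnj (ft (u m) \<xi>) * 1)
        \<longlonglongrightarrow> (LINT \<xi>|lborel. F \<xi> * cnj (ft (u m) \<xi>) * 1)"
      by (rule L2_pair_tendsto)
        (use nf nu si nice_ft_sq_int fourier_L2_sequence[OF fF] in \<open>auto simp: L2dist2_def\<close>)
    then show "(\<lambda>n. LINT y|lborel. trunc (real n) f y * cnj (u m y))
        \<longlonglongrightarrow> (LINT \<xi>|lborel. F \<xi> * cnj (ft (u m) \<xi>))"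
      by (simp add: parseval_nice[OF nf nu])
    \<comment> \<open>All boxes lie in [x, x+1], so truncations at n >= N do not affect the
      pairing.\<close>
    obtain N :: nat where N: "real N \<ge> \<bar>x\<bar> + 1" using real_arch_simple by blast
    have "trunc (real n) f y * cnj (u m y) = f y * cnj (u m y)" if "n \<ge> N" for n y
    proof (cases "y \<in> {x..x + 1 / real (Suc m)}")
      case True
      have "1 / real (Suc m) \<le> 1" by simp
      then have "y \<in> {- real n..real n}"
        using True N that unfolding atLeastAtMost_iff by linarith
      then show ?thesis by (simp add: trunc_def)
    qed (simp add: u_def)
    then have "\<forall>\<^sub>F n in sequentially. (LINT y|lborel. trunc (real n) f y * cnj (u m y)) =
        (LINT y|lborel. f y * cnj (u m y))"
      unfolding eventually_sequentially
      by (intro exI[of _ N] allI impI Bochner_Integration.integral_cong refl)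
    then show "(\<lambda>n. LINT y|lborel. trunc (real n) f y * cnj (u m y)) \<longlonglongrightarrow> (LINT y|lborel. f y * cnj (u m y))"
      by (rule tendsto_eventually)
  qed
  have l1: "(\<lambda>m. LINT y|lborel. f y * cnj (u m y)) \<longlonglongrightarrow> f x"
    unfolding u_def by (rule average_tendsto[OF cont])
  have l2: "(\<lambda>m. cnj (ft (u m) \<xi>)) \<longlonglongrightarrow> complex_of_real (1 / sqrt (2 * pi)) * cis (\<xi> * x)" for \<xi>
  proof -
    have "continuous_on UNIV (\<lambda>y. cis (\<xi> * y))"
      by (auto simp: cis_conv_exp intro!: continuous_intros)
    from average_tendsto[OF this]
    have "(\<lambda>m. LINT y|lborel. cis (\<xi> * y) * cnj (u m y)) \<longlonglongrightarrow> cis (\<xi> * x)"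
      unfolding u_def .
    moreover have "cnj (ft (u m) \<xi>) = complex_of_real (1 / sqrt (2 * pi)) *
        (LINT y|lborel. cis (\<xi> * y) * cnj (u m y))" for m
    proof -
      have "cnj (LINT y|lborel. u m y * cis (- (\<xi> * y))) = (LINT y|lborel. cis (\<xi> * y) * cnj (u m y))"
        unfolding Bochner_Integration.integral_cnj[symmetric] by (simp add: cis_cnj mult.commute)
      then show ?thesis by (simp add: ft_def)
    qed
    ultimately show ?thesis by (simp only:) (intro tendsto_intros)
  qed
  have "(\<lambda>m. LINT \<xi>|lborel. F \<xi> * cnj (ft (u m) \<xi>)) \<longlonglongrightarrow>
      (LINT \<xi>|lborel. F \<xi> * (complex_of_real (1 / sqrt (2 * pi)) * cis (\<xi> * x)))"
  proof (rule integral_dominated_convergence[where w = "\<lambda>\<xi>. cmod (F \<xi>) * (1 / sqrt (2 * pi))"])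
    show "AE \<xi> in lborel. (\<lambda>m. F \<xi> * cnj (ft (u m) \<xi>)) \<longlonglongrightarrow>
        F \<xi> * (complex_of_real (1 / sqrt (2 * pi)) * cis (\<xi> * x))"
      using l2 by (intro AE_I2 tendsto_intros)
    show "AE \<xi> in lborel. norm (F \<xi> * cnj (ft (u m) \<xi>)) \<le> cmod (F \<xi>) * (1 / sqrt (2 * pi))" for m
    proof (rule AE_I2)
      fix \<xi>
      \<comment> \<open>The boxes have L1 norm one for every m, which bounds their transforms
        uniformly.\<close>
      have "(LINT y|lborel. cmod (u m y)) = 1" by (simp add: u_def del: of_nat_Suc)
      then have "cmod (ft (u m) \<xi>) \<le> 1 / sqrt (2 * pi)" using cmod_ft_le[of "u m" \<xi>] by simp
      then show "norm (F \<xi> * cnj (ft (u m) \<xi>)) \<le> cmod (F \<xi>) * (1 / sqrt (2 * pi))"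
        unfolding norm_mult complex_mod_cnj by (intro mult_left_mono) auto
    qed
  qed (use Fi in auto)
  then have "(\<lambda>m. LINT \<xi>|lborel. F \<xi> * cnj (ft (u m) \<xi>)) \<longlonglongrightarrow>
      complex_of_real (1 / sqrt (2 * pi)) * (LINT \<xi>|lborel. F \<xi> * cis (\<xi> * x))"
    by (simp add: mult.left_commute)
  then show ?thesis using l1 unfolding key by (rule LIMSEQ_unique[rotated])
qed

lemma sq_int_shift:
  assumes "sq_int f"
  shows "sq_int (\<lambda>x. f (x - s))"
proof -
  have [measurable]: "f \<in> borel_measurable borel" using assms by (rule sq_int_measurable)
  have "integrable lborel (\<lambda>x. (cmod (f (- s + 1 * x)))\<^sup>2)"
    by (rule lborel_integrable_real_affine[OF sq_int_integrable[OF assms]]) simp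
  then show ?thesis by (simp add: sq_int_iff)
qed

text \<open>Plancherel for two translates of f. Their transforms differ from F by unimodular
  factors, which combine to one character.\<close>

lemma fourier_L2_autocorrelation:
  assumes fF: "fourier_L2 f F" and cont: "continuous_on UNIV f"
  shows "(LINT x|lborel. f (x - s) * cnj (f (x - t))) =
    (LINT \<xi>|lborel. F \<xi> * cnj (F \<xi>) * cis (- (\<xi> * (s - t))))"
proof (rule LIMSEQ_unique)
  have si: "sq_int f" "sq_int F" using fF by (auto simp: fourier_L2_def)
  have [measurable]: "f \<in> borel_measurable borel" using si(1) by (rule sq_int_measurable)
  have nf: "nice (trunc R f)" for R
    using nice_trunc_shift[OF cont, of R 0] by simp
  \<comment> \<open>Truncating before shifting makes both factors translates of the same function,
    so one transform serves for both.\<close>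
  have eq: "(LINT \<xi>|lborel. ft (trunc R f) \<xi> * cnj (ft (trunc R f) \<xi>) * cis (- (\<xi> * (s - t)))) =
      (LINT x|lborel. trunc R f (x - s) * cnj (trunc R f (x - t)))" for R
    unfolding parseval_nice[OF nice_trunc_shift[OF cont] nice_trunc_shift[OF cont], symmetric] ft_shift
  proof (intro Bochner_Integration.integral_cong refl)
    fix \<xi> :: real
    have "cis (- (\<xi> * (s - t))) = cis (- (\<xi> * s)) * cnj (cis (- (\<xi> * t)))"
      unfolding cis_cnj cis_mult by (simp add: algebra_simps)
    then show "ft (trunc R f) \<xi> * cnj (ft (trunc R f) \<xi>) * cis (- (\<xi> * (s - t))) =
        cis (- (\<xi> * s)) * ft (trunc R f) \<xi> * cnj (cis (- (\<xi> * t)) * ft (trunc R f) \<xi>)"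
      by (simp only: complex_cnj_mult mult_ac)
  qed
  show "(\<lambda>n. LINT x|lborel. trunc (real n) f (x - s) * cnj (trunc (real n) f (x - t)))
      \<longlonglongrightarrow> (LINT \<xi>|lborel. F \<xi> * cnj (F \<xi>) * cis (- (\<xi> * (s - t))))"
    unfolding eq[symmetric]
    by (rule L2_pair_tendsto)
      (use nf si nice_ft_sq_int fourier_L2_sequence[OF fF] in auto)
  show "(\<lambda>n. LINT x|lborel. trunc (real n) f (x - s) * cnj (trunc (real n) f (x - t)))
      \<longlonglongrightarrow> (LINT x|lborel. f (x - s) * cnj (f (x - t)))"
  proof (rule integral_dominated_convergence[where w = "\<lambda>x. cmod (f (x - s) * cnj (f (x - t)) * 1)"])
    show "integrable lborel (\<lambda>x. cmod (f (x - s) * cnj (f (x - t)) * 1))"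
      by (intro integrable_norm integrable_sq_int_mult sq_int_shift si) auto
    show "AE x in lborel. (\<lambda>n. trunc (real n) f (x - s) * cnj (trunc (real n) f (x - t)))
        \<longlonglongrightarrow> f (x - s) * cnj (f (x - t))"
    proof (rule AE_I2, rule tendsto_eventually)
      fix x
      obtain N :: nat where N: "real N \<ge> \<bar>x - s\<bar> + \<bar>x - t\<bar>" using real_arch_simple by blast
      have "trunc (real n) f (x - s) * cnj (trunc (real n) f (x - t)) = f (x - s) * cnj (f (x - t))"
        if "n \<ge> N" for n
      proof -
        have "x - s \<in> {- real n..real n}" "x - t \<in> {- real n..real n}"
          using N that unfolding atLeastAtMost_iff by linarith+
        then show ?thesis by (simp add: trunc_def)
      qed
      then show "\<forall>\<^sub>F n in sequentially. trunc (real n) f (x - s) * cnj (trunc (real n) f (x - t)) =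
          f (x - s) * cnj (f (x - t))"
        unfolding eventually_sequentially by blast
    qed
    show "AE x in lborel. norm (trunc (real n) f (x - s) * cnj (trunc (real n) f (x - t))) \<le>
        cmod (f (x - s) * cnj (f (x - t)) * 1)" for n
      by (intro AE_I2) (auto simp: norm_mult intro!: mult_mono cmod_trunc_le)
  qed auto
qed


text \<open>Since cos^2 = 1 - sin^2, the left side is (1 + x_n / n)^n with x_n tending to -c^2. It
  is compared with (1 - c^2 / n)^n through |a^n - b^n| <= n |a - b|, valid in the unit disc.\<close>

lemma cos_power_tendsto_gaussian:
  "(\<lambda>n. ((cos (c / sqrt (real n)))\<^sup>2) ^ n) \<longlonglongrightarrow> exp (- c\<^sup>2)"
proof -
  define x where "x n = - (sqrt (real n) * sin (c / sqrt (real n)))\<^sup>2" for n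
  have "((\<lambda>t. sin (c * t)) has_real_derivative c) (at 0)"
    by (auto intro!: derivative_eq_intros)
  then have "((\<lambda>t. sin (c * t) / t) \<longlongrightarrow> c) (at 0)" by (simp add: DERIV_def)
  moreover have "filterlim (\<lambda>n. 1 / sqrt (real n)) (at 0) sequentially"
  proof (rule filterlim_atI)
    show "(\<lambda>n. 1 / sqrt (real n)) \<longlonglongrightarrow> 0"
      by (intro tendsto_divide_0[OF tendsto_const] filterlim_at_top_imp_at_infinity
          filterlim_compose[OF sqrt_at_top filterlim_real_sequentially])
    show "\<forall>\<^sub>F n in sequentially. 1 / sqrt (real n) \<noteq> 0"
      using eventually_gt_at_top[of 0] by eventually_elim simp
  qed
  ultimately have "(\<lambda>n. sin (c * (1 / sqrt (real n))) / (1 / sqrt (real n))) \<longlonglongrightarrow> c"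
    by (rule filterlim_compose)
  then have "(\<lambda>n. - (sin (c * (1 / sqrt (real n))) / (1 / sqrt (real n)))\<^sup>2) \<longlonglongrightarrow> - c\<^sup>2"
    by (intro tendsto_intros)
  then have x: "x \<longlonglongrightarrow> - c\<^sup>2"
    by (simp add: x_def[abs_def] mult.commute)
  have "(\<lambda>n. ((cos (c / sqrt (real n)))\<^sup>2) ^ n - (1 + (- c\<^sup>2) / real n) ^ n) \<longlonglongrightarrow> 0"
  proof (rule tendsto_norm_zero_cancel, rule tendsto_sandwich[OF _ _ tendsto_const])
    show "(\<lambda>n. \<bar>x n - - c\<^sup>2\<bar>) \<longlonglongrightarrow> 0"
      using tendsto_rabs[OF tendsto_diff[OF x tendsto_const[of "- c\<^sup>2"]]] by simp
    \<comment> \<open>From n >= c^2 on, 1 - c^2 / n lies in [0,1], as the comparison of powers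
      demands.\<close>
    obtain N :: nat where N: "real N \<ge> c\<^sup>2" using real_arch_simple by blast
    show "\<forall>\<^sub>F n in sequentially. norm (((cos (c / sqrt (real n)))\<^sup>2) ^ n - (1 + (- c\<^sup>2) / real n) ^ n)
        \<le> \<bar>x n - - c\<^sup>2\<bar>"
      using eventually_ge_at_top[of N] eventually_gt_at_top[of 0]
    proof eventually_elim
      case (elim n)
      have "c\<^sup>2 / real n \<le> 1" using N elim by (simp add: divide_le_eq)
      moreover have "0 \<le> c\<^sup>2 / real n" by simp
      ultimately have "norm (1 + (- c\<^sup>2) / real n) \<le> 1" by simp
      moreover have "(cos (c / sqrt (real n)))\<^sup>2 \<le> 1" by (simp add: abs_square_le_1)
      ultimately have "norm (((cos (c / sqrt (real n)))\<^sup>2) ^ n - (1 + (- c\<^sup>2) / real n) ^ n) \<le>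
          n * norm ((cos (c / sqrt (real n)))\<^sup>2 - (1 + (- c\<^sup>2) / real n))"
        by (intro norm_power_diff) auto
      also have "(cos (c / sqrt (real n)))\<^sup>2 - (1 + (- c\<^sup>2) / real n) = (x n - - c\<^sup>2) / n"
        using elim by (simp add: x_def cos_squared_eq power_mult_distrib field_simps)
      finally show ?case using elim by simp
    qed
  qed auto
  from tendsto_add[OF this tendsto_exp_limit_sequentially[of "- c\<^sup>2"]]
  show ?thesis by simp
qed

text \<open>The two index types and node families are independent, so the same identity serves for
  Hermitian forms, for samples at other nodes, and, with a one-point second index, for linear
  functionals.\<close>

lemma trig_sum_quadratic_form:
  fixes F :: "real \<Rightarrow> complex" and c :: "'i \<Rightarrow> complex" and x :: "'i \<Rightarrow> real"
  assumes Fi: "integrable lborel F"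
  shows "(\<Sum>j\<in>A. \<Sum>k\<in>B. c j * d k * (LINT \<xi>|lborel. F \<xi> * cis (\<xi> * (x j - y k)))) =
    (LINT \<xi>|lborel. F \<xi> * ((\<Sum>j\<in>A. c j * cis (\<xi> * x j)) * (\<Sum>k\<in>B. d k * cis (- (\<xi> * y k)))))"
proof -
  have int: "integrable lborel (\<lambda>\<xi>. c j * d k * (F \<xi> * cis (\<xi> * (x j - y k))))" for j k
    by (intro integrable_mult_right integrable_mult_bounded[of _ _ 1] Fi) auto
  have "(\<Sum>j\<in>A. \<Sum>k\<in>B. c j * d k * (LINT \<xi>|lborel. F \<xi> * cis (\<xi> * (x j - y k)))) =
      (LINT \<xi>|lborel. (\<Sum>j\<in>A. \<Sum>k\<in>B. c j * d k * (F \<xi> * cis (\<xi> * (x j - y k)))))"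
    using int by (simp add: Bochner_Integration.integral_sum integrable_sum)
  also have "\<dots> = (LINT \<xi>|lborel. F \<xi> * ((\<Sum>j\<in>A. c j * cis (\<xi> * x j)) * (\<Sum>k\<in>B. d k * cis (- (\<xi> * y k)))))"
  proof (intro Bochner_Integration.integral_cong refl)
    fix \<xi>
    have "cis (\<xi> * (x j - y k)) = cis (\<xi> * x j) * cis (- (\<xi> * y k))" for j k
      unfolding cis_mult by (simp add: algebra_simps)
    then show "(\<Sum>j\<in>A. \<Sum>k\<in>B. c j * d k * (F \<xi> * cis (\<xi> * (x j - y k)))) =
        F \<xi> * ((\<Sum>j\<in>A. c j * cis (\<xi> * x j)) * (\<Sum>k\<in>B. d k * cis (- (\<xi> * y k))))"
      unfolding sum_product unfolding sum_distrib_left by (intro sum.cong refl) (simp only: mult_ac)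
  qed
  finally show ?thesis .
qed

text \<open>The coefficients \<open>binom(n,j) 2\<^sup>-\<^sup>n cis(-h\<eta>j)\<close> at the nodes \<open>hj\<close> give a trigonometric polynomial with
  \<open>|q(\<xi>)|\<^sup>2 = cos\<^sup>2\<^sup>n(h(\<xi>-\<eta>)/2)\<close>, which tends boundedly to a Gaussian when \<open>h = 2s/\<surd>n\<close>.\<close>

lemma pos_def_gaussian_nonneg:
  assumes "pos_def f" "fourier_L2 f F" and Fi: "integrable lborel F"
  shows "(LINT \<xi>|lborel. F \<xi> * complex_of_real (exp (- (s * (\<xi> - \<eta>))\<^sup>2))) \<in> \<real>\<^sub>\<ge>\<^sub>0"
proof -
  have cont: "continuous_on UNIV f" using assms(1) by (simp add: pos_def_def)
  note inv = fourier_L2_inversion[OF assms(2) cont Fi]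
  have [measurable]: "F \<in> borel_measurable borel" using Fi by auto
  have fin: "(LINT \<xi>|lborel. F \<xi> * complex_of_real (((cos (s * (\<xi> - \<eta>) / sqrt (real n)))\<^sup>2) ^ n)) \<in> \<real>\<^sub>\<ge>\<^sub>0" for n
  proof -
    define h where "h = 2 * s / sqrt (real n)"
    define c where "c j = complex_of_real (real (n choose j) / 2 ^ n) * cis (- (h * \<eta> * real j))" for j
    define q where "q \<xi> = (\<Sum>j<Suc n. c j * cis (\<xi> * (h * real j)))" for \<xi>
    have q: "q \<xi> = ((1 + cis (h * (\<xi> - \<eta>))) / 2) ^ n" for \<xi>
    proof -
      have "(1 + cis (h * (\<xi> - \<eta>))) ^ n = (cis (h * (\<xi> - \<eta>)) + 1) ^ n" by (simp add: add.commute)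
      also have "\<dots> = (\<Sum>j\<le>n. of_nat (n choose j) * cis (h * (\<xi> - \<eta>)) ^ j * 1 ^ (n - j))"
        by (rule binomial_ring)
      also have "\<dots> = (\<Sum>j\<le>n. 2 ^ n * (c j * cis (\<xi> * (h * real j))))"
      proof (rule sum.cong[OF refl])
        fix j
        have "cis (h * (\<xi> - \<eta>)) ^ j = cis (- (h * \<eta> * real j)) * cis (\<xi> * (h * real j))"
          unfolding Complex.DeMoivre cis_mult by (rule arg_cong[of _ _ cis]) (simp add: algebra_simps)
        then show "of_nat (n choose j) * cis (h * (\<xi> - \<eta>)) ^ j * 1 ^ (n - j) =
            2 ^ n * (c j * cis (\<xi> * (h * real j)))"
          by (simp add: c_def)
      qed
      finally show ?thesis
        by (simp add: q_def power_divide lessThan_Suc_atMost flip: sum_distrib_left)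
    qed
    have cq: "cnj (q \<xi>) = (\<Sum>k<Suc n. cnj (c k) * cis (- (\<xi> * (h * real k))))" for \<xi>
      by (simp add: q_def cis_cnj del: sum.lessThan_Suc)
    have half: "cmod ((1 + cis \<theta>) / 2) ^ 2 = (cos (\<theta> / 2))\<^sup>2" for \<theta>
    proof -
      have "cmod ((1 + cis \<theta>) / 2) ^ 2 = ((1 + cos \<theta>) / 2)\<^sup>2 + (sin \<theta> / 2)\<^sup>2"
        unfolding cmod_power2 by simp
      also have "\<dots> = (1 + cos \<theta>) / 2"
        by (simp add: power_divide sin_squared_eq power2_sum diff_divide_distrib add_divide_distrib)
      also have "\<dots> = (cos (\<theta> / 2))\<^sup>2"
        using cos_double_cos[of "\<theta> / 2"] by simp
      finally show ?thesis .
    qed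
    have qq: "q \<xi> * cnj (q \<xi>) = complex_of_real (((cos (s * (\<xi> - \<eta>) / sqrt (real n)))\<^sup>2) ^ n)" for \<xi>
    proof -
      have "(cmod (q \<xi>))\<^sup>2 = (cmod ((1 + cis (h * (\<xi> - \<eta>))) / 2) ^ 2) ^ n"
        unfolding q norm_power by (simp add: power_mult[symmetric] mult.commute)
      also have "\<dots> = ((cos (s * (\<xi> - \<eta>) / sqrt (real n)))\<^sup>2) ^ n"
        unfolding half by (simp add: h_def)
      finally show ?thesis by (simp only: complex_norm_square[symmetric])
    qed
    define z where "z = (\<Sum>j<Suc n. \<Sum>k<Suc n. c j * cnj (c k) * f (h * real j - h * real k))"
    have "z \<in> \<real>\<^sub>\<ge>\<^sub>0"
    proof -
      have "Im (\<Sum>j<m. \<Sum>k<m. c j * cnj (c k) * f (x j - x k)) = 0 \<and>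
          0 \<le> Re (\<Sum>j<m. \<Sum>k<m. c j * cnj (c k) * f (x j - x k))" for m :: nat and x :: "nat \<Rightarrow> real"
        using assms(1) unfolding pos_def_def by blast
      from this[where m = "Suc n" and x = "\<lambda>j. h * real j"] show ?thesis
        unfolding z_def complex_nonneg_Reals_iff by blast
    qed
    define S where "S = (\<Sum>j<Suc n. \<Sum>k<Suc n. c j * cnj (c k) *
          (LINT \<xi>|lborel. F \<xi> * cis (\<xi> * (h * real j - h * real k))))"
    have "z = complex_of_real (1 / sqrt (2 * pi)) * S"
      unfolding z_def S_def sum_distrib_left
      by (intro sum.cong refl) (subst inv, simp only: mult_ac)
    then have "S = complex_of_real (sqrt (2 * pi)) * z" by simp
    with \<open>z \<in> \<real>\<^sub>\<ge>\<^sub>0\<close> have "S \<in> \<real>\<^sub>\<ge>\<^sub>0"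
      by (simp only:) (intro nonneg_Reals_mult_I, auto)
    then show ?thesis
      unfolding S_def trig_sum_quadratic_form[OF Fi] q_def[symmetric] cq[symmetric] qq .
  qed
  have "(\<lambda>n. LINT \<xi>|lborel. F \<xi> * complex_of_real (((cos (s * (\<xi> - \<eta>) / sqrt (real n)))\<^sup>2) ^ n))
      \<longlonglongrightarrow> (LINT \<xi>|lborel. F \<xi> * complex_of_real (exp (- (s * (\<xi> - \<eta>))\<^sup>2)))"
  proof (rule integral_dominated_convergence[where w = "\<lambda>\<xi>. cmod (F \<xi>)"])
    show "AE \<xi> in lborel. (\<lambda>n. F \<xi> * complex_of_real (((cos (s * (\<xi> - \<eta>) / sqrt (real n)))\<^sup>2) ^ n))
        \<longlonglongrightarrow> F \<xi> * complex_of_real (exp (- (s * (\<xi> - \<eta>))\<^sup>2))"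
      by (intro AE_I2 tendsto_mult tendsto_const tendsto_of_real cos_power_tendsto_gaussian)
    have "\<bar>((cos t)\<^sup>2) ^ n\<bar> \<le> 1" for t :: real and n
      using power_le_one[of "(cos t)\<^sup>2" n] by (simp add: abs_square_le_1)
    then show "AE \<xi> in lborel. norm (F \<xi> * complex_of_real (((cos (s * (\<xi> - \<eta>) / sqrt (real n)))\<^sup>2) ^ n))
        \<le> cmod (F \<xi>)" for n
      unfolding norm_mult norm_of_real by (intro AE_I2 mult_left_le) auto
  qed (use Fi in auto)
  from closed_sequentially[OF closed_nonneg_Reals_complex fin this] show ?thesis .
qed

text \<open>The indicator is replaced by its Gaussian averages. By Fubini, integrating F against
  such an average is integrating over y in [a,b] the numbers \<open>I y\<close>, which are
  nonnegative by \<open>pos_def_gaussian_nonneg\<close>; the averages then sharpen to the indicator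
  off its endpoints.\<close>

lemma pos_def_interval_nonneg:
  assumes "pos_def f" "fourier_L2 f F" and Fi: "integrable lborel F"
  shows "(LINT \<xi>|lborel. F \<xi> * indicator {a..b} \<xi>) \<in> \<real>\<^sub>\<ge>\<^sub>0"
proof -
  have [measurable]: "F \<in> borel_measurable borel" using Fi by auto
  define w :: "real \<Rightarrow> complex" where "w = indicator {a..b}"
  have [measurable]: "w \<in> borel_measurable borel" unfolding w_def by measurable
  have w1: "cmod (w x) \<le> 1" for x by (simp add: w_def indicator_def)
  have wi: "integrable lborel w"
    by (rule integrableI_bounded_set[where A = "{a..b}" and B = 1])
      (use w1 in \<open>auto simp: w_def emeasure_lborel_Icc_eq\<close>)
  define A where "A m \<xi> = (LINT t|lborel. w (\<xi> + t / real (Suc m)) * complex_of_real (std_normal_density t))"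
    for m \<xi>
  have A: "A m \<xi> = complex_of_real (real (Suc m)) *
      (LINT y|lborel. w y * complex_of_real (std_normal_density (real (Suc m) * (y - \<xi>))))" for m \<xi>
    unfolding A_def by (rule gaussian_average_rescale) simp
  have n1: "std_normal_density x \<le> 1" for x
  proof -
    have "exp (- x\<^sup>2 / 2) \<le> 1" by simp
    also have "1 \<le> sqrt (2 * pi)" using pi_ge_two by simp
    finally show ?thesis by (simp add: std_normal_density_def divide_le_eq)
  qed
  have pos: "(LINT \<xi>|lborel. F \<xi> * A m \<xi>) \<in> \<real>\<^sub>\<ge>\<^sub>0" for m
  proof -
    define I where "I y = (LINT \<xi>|lborel. F \<xi> * complex_of_real (std_normal_density (real (Suc m) * (y - \<xi>))))" for y
    have "I y \<in> \<real>\<^sub>\<ge>\<^sub>0" for y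
    proof -
      \<comment> \<open>The factor sqrt 2 absorbs the 1/2 in the exponent of the normal
        density.\<close>
      define s where "s = real (Suc m) / sqrt 2"
      have e: "std_normal_density (real (Suc m) * (y - \<xi>)) = 1 / sqrt (2 * pi) * exp (- (s * (\<xi> - y))\<^sup>2)" for \<xi>
        by (simp add: std_normal_density_def s_def power_mult_distrib power_divide power2_commute
            del: of_nat_Suc)
      have "I y = complex_of_real (1 / sqrt (2 * pi)) *
          (LINT \<xi>|lborel. F \<xi> * complex_of_real (exp (- (s * (\<xi> - y))\<^sup>2)))"
        unfolding I_def e integral_mult_right_zero[symmetric] by (simp add: mult_ac)
      moreover have "complex_of_real (1 / sqrt (2 * pi)) \<in> \<real>\<^sub>\<ge>\<^sub>0" by simp
      ultimately show ?thesis
        using pos_def_gaussian_nonneg[OF assms] nonneg_Reals_mult_I by metis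
    qed
    then have I: "I y = complex_of_real (Re (I y))" "0 \<le> Re (I y)" for y
      by (auto simp: complex_nonneg_Reals_iff complex_eq_iff)
    have "F \<xi> * A m \<xi> = complex_of_real (real (Suc m)) *
        ((LINT y|lborel. w y * complex_of_real (std_normal_density (real (Suc m) * (y - \<xi>)))) * F \<xi>)" for \<xi>
      unfolding A by simp
    then have "(LINT \<xi>|lborel. F \<xi> * A m \<xi>) = complex_of_real (real (Suc m)) *
        (LINT \<xi>|lborel. (LINT y|lborel. w y * complex_of_real (std_normal_density (real (Suc m) * (y - \<xi>)))) * F \<xi>)"
      by (simp only: integral_mult_right_zero)
    also have "(LINT \<xi>|lborel. (LINT y|lborel. w y * complex_of_real (std_normal_density (real (Suc m) * (y - \<xi>)))) * F \<xi>)
        = (LINT y|lborel. w y * I y)"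
      unfolding I_def
      by (rule fubini_kernel[OF wi Fi]) (use n1 in \<open>auto\<close>)
    also have "(\<lambda>y. w y * I y) = (\<lambda>y. complex_of_real (indicator {a..b} y * Re (I y)))"
      by (subst I(1)) (auto simp: w_def indicator_def)
    also have "(LINT y|lborel. complex_of_real (indicator {a..b} y * Re (I y))) =
        complex_of_real (LINT y|lborel. indicator {a..b} y * Re (I y))"
      by (rule integral_complex_of_real)
    finally have "(LINT \<xi>|lborel. F \<xi> * A m \<xi>) =
        complex_of_real (real (Suc m) * (LINT y|lborel. indicator {a..b} y * Re (I y)))"
      by (simp only: of_real_mult)
    moreover have "0 \<le> (LINT y|lborel. indicator {a..b} y * Re (I y))"
      using I(2) by (intro integral_nonneg_AE) auto
    ultimately show ?thesis by (simp only: nonneg_Reals_of_real_iff) simp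
  qed
  have "(\<lambda>m. LINT \<xi>|lborel. F \<xi> * A m \<xi>) \<longlonglongrightarrow> (LINT \<xi>|lborel. F \<xi> * w \<xi>)"
  proof (rule integral_dominated_convergence[where w = "\<lambda>\<xi>. cmod (F \<xi>)"])
    have "AE \<xi> in lborel. \<xi> \<notin> {a, b}"
      by (intro AE_not_in countable_imp_null_set_lborel) auto
    then show "AE \<xi> in lborel. (\<lambda>m. F \<xi> * A m \<xi>) \<longlonglongrightarrow> F \<xi> * w \<xi>"
    proof eventually_elim
      case (elim \<xi>)
      have "\<xi> \<notin> frontier {a..b}" using elim by (auto simp: frontier_def)
      then have "isCont (indicator {a..b} :: real \<Rightarrow> real) \<xi>" by (simp add: isCont_indicator)
      then have "isCont (\<lambda>x. complex_of_real (indicator {a..b} x)) \<xi>"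
        by (intro continuous_intros)
      then have "isCont w \<xi>" by (simp add: w_def of_real_indicator)
      then show ?case unfolding A_def
        by (intro tendsto_mult tendsto_const approx_identity[of w 1] w1) auto
    qed
    show "AE \<xi> in lborel. norm (F \<xi> * A m \<xi>) \<le> cmod (F \<xi>)" for m
      unfolding norm_mult A_def
      by (intro AE_I2 mult_left_le approx_identity_bound w1) auto
    show "(\<lambda>\<xi>. F \<xi> * A m \<xi>) \<in> borel_measurable lborel" for m
      unfolding A_def by measurable
  qed (use Fi in auto)
  from closed_sequentially[OF closed_nonneg_Reals_complex pos this] show ?thesis
    unfolding w_def .
qed

text \<open>Lebesgue differentiation: almost every F(x) is a limit of means over [x, x+h], and these
  lie in the closed cone of nonnegative reals.\<close>

lemma pos_def_fourier_nonneg: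
  assumes "pos_def f" "fourier_L2 f F" and Fi: "integrable lborel F"
  shows "AE \<xi> in lborel. F \<xi> \<in> \<real>\<^sub>\<ge>\<^sub>0"
proof -
  have si: "set_integrable lborel {a..b} F" for a b
    unfolding set_integrable_def using Fi by (intro integrable_mult_indicator) auto
  have io: "F integrable_on cbox a b" for a b
    using set_borel_integral_eq_integral(1)[OF si[of a b]] by simp
  obtain N where N: "negligible N"
    "\<And>x e. x \<notin> N \<Longrightarrow> 0 < e \<Longrightarrow> \<exists>d>0. \<forall>h. 0 < h \<and> h < d \<longrightarrow>
      norm (integral (cbox x (x + h *\<^sub>R One)) F /\<^sub>R h ^ DIM(real) - F x) < e"
    using integrable_ccontinuous_explicit[OF io] by blast
  have "F x \<in> \<real>\<^sub>\<ge>\<^sub>0" if "x \<notin> N" for x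
  proof -
    have "F x \<in> closure (\<real>\<^sub>\<ge>\<^sub>0)"
      unfolding closure_approachable
    proof (intro allI impI)
      fix e :: real assume "e > 0"
      from N(2)[OF that this] obtain d where d: "d > 0"
        "\<And>h. 0 < h \<and> h < d \<Longrightarrow> norm (integral (cbox x (x + h *\<^sub>R One)) F /\<^sub>R h ^ DIM(real) - F x) < e"
        by blast
      define h where "h = d / 2"
      have "integral {x..x+h} F = (LINT \<xi>|lborel. F \<xi> * indicator {x..x+h} \<xi>)"
        using set_borel_integral_eq_integral(2)[OF si[of x "x + h"]]
        by (simp add: set_lebesgue_integral_def scaleR_conv_of_real mult.commute of_real_indicator)
      then have "integral {x..x+h} F \<in> \<real>\<^sub>\<ge>\<^sub>0" using pos_def_interval_nonneg[OF assms] by simp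
      then have "complex_of_real (inverse h) * integral {x..x+h} F \<in> \<real>\<^sub>\<ge>\<^sub>0"
        using d(1) by (intro nonneg_Reals_mult_I) (auto simp: h_def)
      moreover have "dist (complex_of_real (inverse h) * integral {x..x+h} F) (F x) < e"
        using d(2)[of h] d(1) by (simp add: h_def dist_norm scaleR_conv_of_real)
      ultimately show "\<exists>y\<in>\<real>\<^sub>\<ge>\<^sub>0. dist y (F x) < e" by blast
    qed
    then show ?thesis using closed_nonneg_Reals_complex by (simp add: closure_closed)
  qed
  \<comment> \<open>\<open>negligible\<close> refers to the completed measure; almost-everywhere
    statements transfer back to \<open>lborel\<close>.\<close>
  moreover have "AE x in lborel. x \<notin> N"
    using N(1) AE_not_in[of N lebesgue] by (simp add: negligible_iff_null_sets AE_completion_iff)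
  ultimately show ?thesis by (auto elim: eventually_mono)
qed

section \<open>Riesz bounds for complete interpolating sequences\<close>

definition trig :: "int set \<Rightarrow> (int \<Rightarrow> real) \<Rightarrow> (int \<Rightarrow> complex) \<Rightarrow> real \<Rightarrow> complex"
  where "trig S Y a \<xi> = (\<Sum>j\<in>S. a j * cis (- (\<xi> * Y j)))"

definition torus_norm2 :: "int set \<Rightarrow> (int \<Rightarrow> real) \<Rightarrow> (int \<Rightarrow> complex) \<Rightarrow> real"
  where "torus_norm2 S Y a = (LINT \<xi>|lborel. indicator torus \<xi> * (cmod (trig S Y a \<xi>))\<^sup>2)"

lemma borel_measurable_trig [measurable]: "trig S Y a \<in> borel_measurable borel"
  unfolding trig_def[abs_def] by measurable

lemma sets_torus [measurable]: "torus \<in> sets borel"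
  by (simp add: torus_def)

lemma cmod_trig_le: "cmod (trig S Y a \<xi>) \<le> (\<Sum>j\<in>S. cmod (a j))"
  unfolding trig_def by (rule order_trans[OF norm_sum]) (simp add: norm_mult)

lemma trig_cmult: "trig S Y (\<lambda>j. z * a j) \<xi> = z * trig S Y a \<xi>"
  by (simp add: trig_def sum_distrib_left mult.assoc)

text \<open>A shift in frequency only multiplies the coefficients by unimodular factors. Their
  moduli, and with them any Bessel bound, are unaffected.\<close>

lemma trig_translate: "trig S Y a (\<xi> + t) = trig S Y (\<lambda>j. a j * cis (- (t * Y j))) \<xi>"
  unfolding trig_def mult.assoc cis_mult by (simp add: algebra_simps)

lemma integrable_torus_trig:
  "integrable lborel (\<lambda>\<xi>. indicator torus \<xi> * (cmod (trig S Y a \<xi>))\<^sup>2)"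
proof (rule integrableI_bounded_set[where A = torus and B = "(\<Sum>j\<in>S. cmod (a j))\<^sup>2"])
  show "AE \<xi> in lborel. \<xi> \<in> torus \<longrightarrow>
      norm (indicator torus \<xi> * (cmod (trig S Y a \<xi>))\<^sup>2) \<le> (\<Sum>j\<in>S. cmod (a j))\<^sup>2"
    by (auto simp: abs_mult intro!: power_mono cmod_trig_le)
qed (auto simp: torus_def)

lemma torus_norm2_nonneg: "0 \<le> torus_norm2 S Y a"
  unfolding torus_norm2_def by (rule integral_nonneg_AE) auto

lemma nn_integral_torus_trig:
  "(\<integral>\<^sup>+ \<xi>. ennreal ((cmod (trig S Y a \<xi>))\<^sup>2) * indicator torus \<xi> \<partial>lborel) = ennreal (torus_norm2 S Y a)"
proof -
  have "(\<integral>\<^sup>+ \<xi>. ennreal ((cmod (trig S Y a \<xi>))\<^sup>2) * indicator torus \<xi> \<partial>lborel) =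
      (\<integral>\<^sup>+ \<xi>. ennreal (indicator torus \<xi> * (cmod (trig S Y a \<xi>))\<^sup>2) \<partial>lborel)"
    by (intro nn_integral_cong) (auto simp: indicator_def)
  also have "\<dots> = ennreal (torus_norm2 S Y a)"
    unfolding torus_norm2_def by (intro nn_integral_eq_integral integrable_torus_trig) auto
  finally show ?thesis .
qed

lemma torus_norm2_scale:
  "torus_norm2 S Y (\<lambda>j. z * a j) = (cmod z)\<^sup>2 * torus_norm2 S Y a"
  unfolding torus_norm2_def trig_cmult
  by (subst integral_mult_right_zero[symmetric]) (simp add: norm_mult power_mult_distrib mult_ac)

text \<open>The endpoint pi, which separates the closed interval of \<open>PW_pi\<close> from the
  half-open \<open>torus\<close>, is a null set. Integrability of F follows from |F| <= 1 + |F|^2 on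
  the torus.\<close>

lemma PW_pi_inversion:
  assumes "PW_pi f"
  obtains F where "sq_int F" "integrable lborel F" "AE \<xi> in lborel. \<xi> \<notin> torus \<longrightarrow> F \<xi> = 0"
    "\<And>x. f x = complex_of_real (1 / sqrt (2 * pi)) * (LINT \<xi>|lborel. F \<xi> * cis (\<xi> * x))"
proof -
  obtain F where F: "fourier_L2 f F" "AE \<xi> in lborel. \<xi> \<notin> {-pi..pi} \<longrightarrow> F \<xi> = 0"
    and cont: "continuous_on UNIV f"
    using assms unfolding PW_pi_def by blast
  have si: "sq_int F" using F(1) by (simp add: fourier_L2_def)
  have [measurable]: "F \<in> borel_measurable borel" using si by (rule sq_int_measurable)
  have "AE \<xi> in lborel. \<xi> \<notin> {pi}" by (intro AE_not_in) auto
  with F(2) have F2: "AE \<xi> in lborel. \<xi> \<notin> torus \<longrightarrow> F \<xi> = 0"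
    by eventually_elim (auto simp: torus_def)
  have Fi: "integrable lborel F"
  proof (rule Bochner_Integration.integrable_bound)
    show "integrable lborel (\<lambda>\<xi>. indicator torus \<xi> + (cmod (F \<xi>))\<^sup>2)"
      by (intro Bochner_Integration.integrable_add sq_int_integrable si)
        (auto simp: torus_def)
    show "AE \<xi> in lborel. norm (F \<xi>) \<le> norm (indicator torus \<xi> + (cmod (F \<xi>))\<^sup>2)"
      using F2
    proof eventually_elim
      case (elim \<xi>)
      have "cmod (F \<xi>) \<le> 1 + (cmod (F \<xi>))\<^sup>2"
        using sum_squares_bound[of 1 "cmod (F \<xi>)"] norm_ge_zero[of "F \<xi>"] by (simp del: norm_ge_zero)
      then show ?case using elim by (cases "\<xi> \<in> torus") auto
    qed
  qed auto
  show ?thesis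
    by (rule that[OF si Fi F2 fourier_L2_inversion[OF F(1) cont Fi]])
qed

text \<open>\<open>E\<close> is the set of finitely supported a whose trigonometric sum lies in the
  unit ball of the torus norm; a norm bound on E is the claim after scaling. For fixed c, inversion
  for its interpolant writes <c,a> as an integral of F against the conjugate sum, and this is
  bounded on E.\<close>

lemma complete_interpolating_riesz_lower:
  assumes "complete_interpolating Y"
  obtains K where "K > 0" "\<And>S a. finite S \<Longrightarrow> (\<Sum>j\<in>S. (cmod (a j))\<^sup>2) \<le> K * torus_norm2 S Y a"
proof -
  define el where "el S a = Abs_l2 (\<lambda>j. if j \<in> S then a j else 0)" for S and a :: "int \<Rightarrow> complex"
  have el: "seq_of (el S a) = (\<lambda>j. if j \<in> S then a j else 0)" if "finite S" for S a
    unfolding el_def by (rule Abs_l2_inverse) (simp add: l2_seq_finite that)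
  define E where "E = {el S a |S a. finite S \<and> torus_norm2 S Y a \<le> 1}"
  have "bounded E"
  proof (rule pointwise_bounded_imp_bounded)
    fix c :: l2
    obtain f where f: "PW_pi f" "\<And>j. f (Y j) = seq_of c j"
      using assms[unfolded complete_interpolating_def, rule_format, OF l2_seq_seq_of[of c]] by blast
    obtain F where F: "sq_int F" "integrable lborel F" "AE \<xi> in lborel. \<xi> \<notin> torus \<longrightarrow> F \<xi> = 0"
      and inv: "\<And>x. f x = complex_of_real (1 / sqrt (2 * pi)) * (LINT \<xi>|lborel. F \<xi> * cis (\<xi> * x))"
      using PW_pi_inversion[OF f(1)] by blast
    have [measurable]: "F \<in> borel_measurable borel" using F(1) by (rule sq_int_measurable)
    \<comment> \<open>From |xy| <= |x|^2 + |y|^2; the summand 1 bounds the torus norm of members of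
      E.\<close>
    define Q where "Q = (LINT \<xi>|lborel. (cmod (F \<xi>))\<^sup>2) + 1"
    have "\<bar>inner c e\<bar> \<le> Q / sqrt (2 * pi)" if eE: "e \<in> E" for e
    proof -
      obtain S a where S: "finite S" and e: "e = el S a" and t: "torus_norm2 S Y a \<le> 1"
        using eE unfolding E_def by blast
      have "inner c e = (\<Sum>\<^sub>\<infinity>j\<in>S. Re (seq_of c j * cnj (a j)))"
        unfolding inner_l2_def e el[OF S] by (rule infsum_cong_neutral) auto
      also have "\<dots> = Re (\<Sum>j\<in>S. cnj (a j) * f (Y j))"
        using S by (simp add: f(2) mult.commute)
      also have "(\<Sum>j\<in>S. cnj (a j) * f (Y j)) = complex_of_real (1 / sqrt (2 * pi)) *
          (\<Sum>j\<in>S. \<Sum>k\<in>{()}. cnj (a j) * 1 * (LINT \<xi>|lborel. F \<xi> * cis (\<xi> * (Y j - 0))))"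
        unfolding inv sum_distrib_left by (simp add: mult_ac)
      also have "\<dots> = complex_of_real (1 / sqrt (2 * pi)) * (LINT \<xi>|lborel. F \<xi> * cnj (trig S Y a \<xi>))"
        by (subst trig_sum_quadratic_form[OF F(2)]) (simp add: trig_def cis_cnj)
      finally have "\<bar>inner c e\<bar> \<le> cmod (complex_of_real (1 / sqrt (2 * pi)) *
          (LINT \<xi>|lborel. F \<xi> * cnj (trig S Y a \<xi>)))"
        by (simp only: abs_Re_le_cmod)
      also have "\<dots> \<le> 1 / sqrt (2 * pi) * Q"
        unfolding norm_mult
      proof (intro mult_mono)
        have "cmod (LINT \<xi>|lborel. F \<xi> * cnj (trig S Y a \<xi>)) \<le>
            (LINT \<xi>|lborel. (cmod (F \<xi>))\<^sup>2 + indicator torus \<xi> * (cmod (trig S Y a \<xi>))\<^sup>2)"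
        proof (rule order_trans[OF integral_norm_bound integral_mono_AE'])
          show "integrable lborel (\<lambda>\<xi>. (cmod (F \<xi>))\<^sup>2 + indicator torus \<xi> * (cmod (trig S Y a \<xi>))\<^sup>2)"
            by (intro Bochner_Integration.integrable_add sq_int_integrable F integrable_torus_trig)
          show "AE \<xi> in lborel. norm (F \<xi> * cnj (trig S Y a \<xi>)) \<le>
              (cmod (F \<xi>))\<^sup>2 + indicator torus \<xi> * (cmod (trig S Y a \<xi>))\<^sup>2"
            using F(3)
          proof eventually_elim
            case (elim \<xi>)
            have "cmod (F \<xi>) * cmod (trig S Y a \<xi>) \<le> (cmod (F \<xi>))\<^sup>2 + (cmod (trig S Y a \<xi>))\<^sup>2"
              using sum_squares_bound[of "cmod (F \<xi>)" "cmod (trig S Y a \<xi>)"]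
                zero_le_power2[of "cmod (F \<xi>)"] zero_le_power2[of "cmod (trig S Y a \<xi>)"] by linarith
            then show ?case using elim by (cases "\<xi> \<in> torus") (auto simp: norm_mult)
          qed
        qed auto
        also have "\<dots> = (LINT \<xi>|lborel. (cmod (F \<xi>))\<^sup>2) + torus_norm2 S Y a"
          unfolding torus_norm2_def
          by (intro Bochner_Integration.integral_add sq_int_integrable F integrable_torus_trig)
        finally show "cmod (LINT \<xi>|lborel. F \<xi> * cnj (trig S Y a \<xi>)) \<le> Q"
          using t by (simp add: Q_def)
      qed (auto simp: norm_divide)
      finally show ?thesis by simp
    qed
    then show "\<exists>M. \<forall>a\<in>E. \<bar>inner c a\<bar> \<le> M" by blast
  qed
  then obtain K where K: "K > 0" "\<And>e. e \<in> E \<Longrightarrow> norm e \<le> K"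
    unfolding bounded_pos by blast
  have "(\<Sum>j\<in>S. (cmod (a j))\<^sup>2) \<le> K\<^sup>2 * torus_norm2 S Y a" if S: "finite S" for S a
  proof (rule field_le_epsilon)
    fix e :: real assume "e > 0"
    \<comment> \<open>The extra term permits scaling even when the torus norm vanishes, and it costs
      exactly e in the final bound.\<close>
    define I where "I = torus_norm2 S Y a + e / K\<^sup>2"
    have I: "I > 0" using \<open>e > 0\<close> K(1) torus_norm2_nonneg[of S Y a]
      by (auto simp: I_def intro!: add_nonneg_pos)
    define r where "r = complex_of_real (1 / sqrt I)"
    have r: "(cmod r)\<^sup>2 = 1 / I" using I by (simp add: r_def norm_divide power_divide)
    have "torus_norm2 S Y (\<lambda>j. r * a j) \<le> 1"
      unfolding torus_norm2_scale r using I \<open>e > 0\<close> K(1) by (simp add: I_def)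
    then have "el S (\<lambda>j. r * a j) \<in> E" using S unfolding E_def by blast
    then have "(norm (el S (\<lambda>j. r * a j)))\<^sup>2 \<le> K\<^sup>2" using K by (intro power_mono) auto
    moreover have "(\<Sum>j\<in>S. (cmod (r * a j))\<^sup>2) \<le> (norm (el S (\<lambda>j. r * a j)))\<^sup>2"
      using sum_le_norm_l2[OF S, of "el S (\<lambda>j. r * a j)"] by (simp add: el[OF S])
    ultimately have "(\<Sum>j\<in>S. (cmod (a j))\<^sup>2) / I \<le> K\<^sup>2"
      by (simp add: norm_mult power_mult_distrib r sum_divide_distrib)
    then have "(\<Sum>j\<in>S. (cmod (a j))\<^sup>2) \<le> K\<^sup>2 * I" using I by (simp add: divide_le_eq)
    also have "\<dots> = K\<^sup>2 * torus_norm2 S Y a + e" using K(1) by (simp add: I_def field_simps)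
    finally show "(\<Sum>j\<in>S. (cmod (a j))\<^sup>2) \<le> K\<^sup>2 * torus_norm2 S Y a + e" .
  qed
  then show ?thesis using that[of "K\<^sup>2"] K(1) by simp
qed

section \<open>From the lower Riesz bound to separated nodes and the Bessel bound\<close>

lemma cmod_cis_diff_le: "cmod (cis s - cis t) \<le> \<bar>s - t\<bar>"
proof -
  have "cis s - cis t = cis t * (cis (s - t) - 1)" by (simp add: cis_mult right_diff_distrib)
  moreover have "cmod (cis (s - t) - 1) \<le> \<bar>s - t\<bar>"
    using iexp_approx1[of "s - t" 0] by (simp add: cis_conv_exp)
  ultimately show ?thesis by (simp add: norm_mult)
qed

lemma complete_interpolating_separated:
  assumes "complete_interpolating Y"
  obtains d where "d > 0" "\<And>j k. j \<noteq> k \<Longrightarrow> d \<le> \<bar>Y j - Y k\<bar>"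
proof -
  obtain K where K: "K > 0" "\<And>S a. finite S \<Longrightarrow> (\<Sum>j\<in>S. (cmod (a j))\<^sup>2) \<le> K * torus_norm2 S Y a"
    using complete_interpolating_riesz_lower[OF assms] by blast
  \<comment> \<open>On the torus |\<xi>| <= pi, so a difference of two characters has squared
    modulus at most pi^2 times the squared distance of the nodes; 2 pi is the length of the
    torus.\<close>
  define C where "C = K * (2 * pi * pi\<^sup>2)"
  have C: "C > 0" using K(1) by (simp add: C_def)
  have "1 / sqrt C \<le> \<bar>Y j - Y k\<bar>" if "j \<noteq> k" for j k
  proof -
    \<comment> \<open>Coefficients 1 and -1: nearby nodes would make the trigonometric sum small
      while the coefficients keep squared norm 2.\<close>
    define a :: "int \<Rightarrow> complex" where "a i = (if i = j then 1 else - 1)" for i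
    have t: "trig {j, k} Y a \<xi> = cis (- (\<xi> * Y j)) - cis (- (\<xi> * Y k))" for \<xi>
      using that by (simp add: trig_def a_def)
    have "torus_norm2 {j, k} Y a \<le> (LINT \<xi>|lborel. indicator torus \<xi> * (pi * \<bar>Y j - Y k\<bar>)\<^sup>2)"
      unfolding torus_norm2_def
    proof (rule integral_mono[OF integrable_torus_trig])
      show "integrable lborel (\<lambda>\<xi>. indicator torus \<xi> * (pi * \<bar>Y j - Y k\<bar>)\<^sup>2)"
        by (auto simp: torus_def)
      fix \<xi>
      show "indicator torus \<xi> * (cmod (trig {j, k} Y a \<xi>))\<^sup>2 \<le> indicator torus \<xi> * (pi * \<bar>Y j - Y k\<bar>)\<^sup>2"
      proof (cases "\<xi> \<in> torus")
        case True
        have "cmod (trig {j, k} Y a \<xi>) \<le> \<bar>\<xi>\<bar> * \<bar>Y j - Y k\<bar>"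
          unfolding t by (rule order_trans[OF cmod_cis_diff_le])
            (simp add: abs_mult[symmetric] right_diff_distrib abs_minus_commute)
        also have "\<dots> \<le> pi * \<bar>Y j - Y k\<bar>"
          using True by (intro mult_right_mono) (auto simp: torus_def)
        finally show ?thesis by (intro mult_left_mono power_mono) auto
      qed auto
    qed
    also have "\<dots> = 2 * pi * pi\<^sup>2 * \<bar>Y j - Y k\<bar>\<^sup>2"
      by (simp add: torus_def power_mult_distrib)
    finally have "K * torus_norm2 {j, k} Y a \<le> C * \<bar>Y j - Y k\<bar>\<^sup>2"
      using K(1) by (simp add: C_def mult_left_mono mult.assoc)
    moreover have "2 \<le> K * torus_norm2 {j, k} Y a"
      using K(2)[of "{j, k}" a] that by (simp add: a_def)
    ultimately have "1 / C \<le> \<bar>Y j - Y k\<bar>\<^sup>2" using C by (simp add: divide_le_eq mult.commute)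
    then have "sqrt (1 / C) \<le> sqrt (\<bar>Y j - Y k\<bar>\<^sup>2)" by (rule real_sqrt_le_mono)
    then show ?thesis by (simp add: real_sqrt_divide)
  qed
  then show ?thesis using that[of "1 / sqrt C"] C by simp
qed

text \<open>Disjoint intervals of length \<open>d\<close> around the nodes are packed into a wider normal density.\<close>

lemma separated_gaussian_sum:
  fixes Y :: "int \<Rightarrow> real"
  assumes d: "d > 0" "\<And>j k. j \<noteq> k \<Longrightarrow> d \<le> \<bar>Y j - Y k\<bar>" and S: "finite S"
  shows "(\<Sum>k\<in>S. exp (- (Y k - y)\<^sup>2 / 2)) \<le> sqrt (4 * pi) * exp (d\<^sup>2 / 8) / d"
proof -
  \<comment> \<open>Within d/2 of the node, (t-y)^2 <= 2 (Y k - y)^2 + d^2 / 2, so passing to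
    variance 2 costs exp(-d^2 / 8); sqrt(4 pi) normalises that density.\<close>
  define c where "c = exp (- (d\<^sup>2 / 8)) / sqrt (4 * pi)"
  \<comment> \<open>Half-open, so the intervals stay disjoint when two nodes are exactly d
    apart.\<close>
  define I where "I k = {Y k - d / 2..<Y k + d / 2}" for k
  define e where "e k = c * exp (- (Y k - y)\<^sup>2 / 2)" for k
  have e0: "0 \<le> e k" for k by (simp add: e_def c_def)
  have le: "e k \<le> normal_density y (sqrt 2) t" if "t \<in> I k" for k t
  proof -
    have "(t - y)\<^sup>2 \<le> 2 * (Y k - y)\<^sup>2 + 2 * (t - Y k)\<^sup>2"
      using sum_squares_bound[of "Y k - y" "t - Y k"] power2_sum[of "Y k - y" "t - Y k"] by simp
    moreover have "\<bar>t - Y k\<bar> \<le> \<bar>d / 2\<bar>"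
      using that unfolding I_def atLeastLessThan_iff by linarith
    then have "(t - Y k)\<^sup>2 \<le> (d / 2)\<^sup>2" by (simp only: abs_le_square_iff)
    ultimately have "- (Y k - y)\<^sup>2 / 2 - d\<^sup>2 / 8 \<le> - (t - y)\<^sup>2 / 4" by (simp add: power_divide)
    then have "exp (- (Y k - y)\<^sup>2 / 2 - d\<^sup>2 / 8) \<le> exp (- (t - y)\<^sup>2 / 4)" by simp
    then have "exp (- (d\<^sup>2 / 8)) * exp (- (Y k - y)\<^sup>2 / 2) \<le> exp (- (t - y)\<^sup>2 / 4)"
      by (simp add: exp_add[symmetric] algebra_simps)
    then show ?thesis
      by (simp add: e_def c_def normal_density_def divide_right_mono)
  qed
  have "(\<Sum>k\<in>S. indicator (I k) t * e k) \<le> normal_density y (sqrt 2) t" for t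
  proof (cases "\<exists>k\<in>S. t \<in> I k")
    case True
    then obtain k where k: "k \<in> S" "t \<in> I k" by blast
    have "t \<notin> I j" if "j \<noteq> k" for j
      using d(2)[OF that] k(2) by (auto simp: I_def)
    then have "(\<Sum>j\<in>S - {k}. indicator (I j) t * e j) = 0"
      by (intro sum.neutral) auto
    then show ?thesis
      using le[OF k(2)] k S by (simp add: sum.remove[OF S k(1)])
  next
    case False
    then have "(\<Sum>k\<in>S. indicator (I k) t * e k) = 0" by (intro sum.neutral) auto
    then show ?thesis by simp
  qed
  moreover have "integrable lborel (\<lambda>t. \<Sum>k\<in>S. indicator (I k) t * e k)"
    unfolding I_def
    by (intro Bochner_Integration.integrable_sum integrable_mult_left integrable_real_indicator)
      (use d(1) in auto)
  ultimately have "(LINT t|lborel. (\<Sum>k\<in>S. indicator (I k) t * e k)) \<le>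
      (LINT t|lborel. normal_density y (sqrt 2) t)"
    by (intro integral_mono) auto
  also have "(LINT t|lborel. normal_density y (sqrt 2) t) = 1" by simp
  also have "(LINT t|lborel. (\<Sum>k\<in>S. indicator (I k) t * e k)) = (\<Sum>k\<in>S. d * e k)"
    using d(1) by (subst Bochner_Integration.integral_sum) (auto simp: I_def)
  also have "(\<Sum>k\<in>S. d * e k) = d * c * (\<Sum>k\<in>S. exp (- (Y k - y)\<^sup>2 / 2))"
    by (simp add: e_def sum_distrib_left mult.assoc)
  finally have "(\<Sum>k\<in>S. exp (- (Y k - y)\<^sup>2 / 2)) \<le> 1 / (d * c)"
    using d(1) by (simp add: le_divide_eq c_def mult.commute)
  also have "\<dots> = sqrt (4 * pi) * exp (d\<^sup>2 / 8) / d"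
    by (simp add: c_def exp_minus field_simps)
  finally show ?thesis .
qed

text \<open>Tied to one index set S, so that it covers both finite pieces of an interpolating
  sequence and a single arbitrary point.\<close>

definition bessel :: "int set \<Rightarrow> (int \<Rightarrow> real) \<Rightarrow> real \<Rightarrow> bool"
  where "bessel S Y B \<longleftrightarrow> (\<forall>a. torus_norm2 S Y a \<le> B * (\<Sum>j\<in>S. (cmod (a j))\<^sup>2))"

text \<open>Makes evaluation at an arbitrary x an instance of sampling; see
  \<open>comb_pointwise\<close>.\<close>

lemma bessel_single: "bessel {j} Y (2 * pi)"
  by (simp add: bessel_def torus_norm2_def trig_def norm_mult torus_def)

text \<open>Under the Gaussian weight the Gram matrix has entries exp(-(Y k - Y j)^2 / 2), whose row
  sums are bounded for separated nodes. The quadratic form is then controlled by Schur's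
  test.\<close>

lemma complete_interpolating_bessel:
  assumes "complete_interpolating Y"
  obtains B where "B > 0" "\<And>S. finite S \<Longrightarrow> bessel S Y B"
proof -
  obtain d where d: "d > 0" "\<And>j k. j \<noteq> k \<Longrightarrow> d \<le> \<bar>Y j - Y k\<bar>"
    using complete_interpolating_separated[OF assms] by blast
  define M where "M = sqrt (4 * pi) * exp (d\<^sup>2 / 8) / d"
  have M: "M > 0" using d(1) by (simp add: M_def)
  \<comment> \<open>The least value of the density on the torus, so that n times its indicator lies
    below the weight.\<close>
  define n where "n = std_normal_density pi"
  have n: "n > 0" unfolding n_def by (rule normal_density_pos) simp
  have "torus_norm2 S Y a \<le> M / n * (\<Sum>j\<in>S. (cmod (a j))\<^sup>2)" if S: "finite S" for S a
  proof -
    define e where "e j k = exp (- (Y k - Y j)\<^sup>2 / 2)" for j k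
    have es: "e j k = e k j" for j k by (simp add: e_def power2_commute)
    have eM: "(\<Sum>k\<in>S. e j k) \<le> M" for j
      unfolding e_def M_def by (rule separated_gaussian_sum[OF d S])
    have ni: "integrable lborel (\<lambda>\<xi>. complex_of_real (std_normal_density \<xi>))"
      by (intro integrable_of_real) simp
    have gi: "integrable lborel (\<lambda>\<xi>. (cmod (trig S Y a \<xi>))\<^sup>2 * std_normal_density \<xi>)"
    proof (rule Bochner_Integration.integrable_bound)
      show "integrable lborel (\<lambda>\<xi>. (\<Sum>j\<in>S. cmod (a j))\<^sup>2 * std_normal_density \<xi>)" by simp
      show "AE \<xi> in lborel. norm ((cmod (trig S Y a \<xi>))\<^sup>2 * std_normal_density \<xi>) \<le>
          norm ((\<Sum>j\<in>S. cmod (a j))\<^sup>2 * std_normal_density \<xi>)"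
        by (auto simp: abs_mult intro!: mult_right_mono power_mono cmod_trig_le)
    qed auto
    have "n * torus_norm2 S Y a = (LINT \<xi>|lborel. n * (indicator torus \<xi> * (cmod (trig S Y a \<xi>))\<^sup>2))"
      unfolding torus_norm2_def by simp
    also have "\<dots> \<le> (LINT \<xi>|lborel. (cmod (trig S Y a \<xi>))\<^sup>2 * std_normal_density \<xi>)"
    proof (rule integral_mono[OF _ gi])
      show "integrable lborel (\<lambda>\<xi>. n * (indicator torus \<xi> * (cmod (trig S Y a \<xi>))\<^sup>2))"
        by (intro integrable_mult_right integrable_torus_trig)
      fix \<xi>
      have "n \<le> std_normal_density \<xi>" if "\<xi> \<in> torus"
      proof -
        have "\<xi>\<^sup>2 \<le> pi\<^sup>2" using that by (intro power2_le_iff_abs_le[THEN iffD2]) (auto simp: torus_def)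
        then show ?thesis by (simp add: n_def std_normal_density_def divide_right_mono)
      qed
      then show "n * (indicator torus \<xi> * (cmod (trig S Y a \<xi>))\<^sup>2) \<le>
          (cmod (trig S Y a \<xi>))\<^sup>2 * std_normal_density \<xi>"
        by (cases "\<xi> \<in> torus") (auto simp: mult.commute[of n] intro!: mult_left_mono)
    qed
    finally have 1: "n * torus_norm2 S Y a \<le> (LINT \<xi>|lborel. (cmod (trig S Y a \<xi>))\<^sup>2 * std_normal_density \<xi>)" .
    have "complex_of_real (LINT \<xi>|lborel. (cmod (trig S Y a \<xi>))\<^sup>2 * std_normal_density \<xi>) =
        (LINT \<xi>|lborel. complex_of_real (std_normal_density \<xi>) *
          ((\<Sum>j\<in>S. a j * cis (\<xi> * - Y j)) * (\<Sum>k\<in>S. cnj (a k) * cis (- (\<xi> * - Y k)))))"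
      unfolding integral_complex_of_real[symmetric] of_real_mult complex_norm_square
      by (simp add: trig_def cis_cnj mult_ac)
    also have "\<dots> = (\<Sum>j\<in>S. \<Sum>k\<in>S. a j * cnj (a k) *
        (LINT \<xi>|lborel. complex_of_real (std_normal_density \<xi>) * cis (\<xi> * (- Y j - - Y k))))"
      by (rule trig_sum_quadratic_form[OF ni, symmetric])
    also have "\<dots> = (\<Sum>j\<in>S. \<Sum>k\<in>S. a j * cnj (a k) * complex_of_real (e j k))"
    proof (intro sum.cong refl arg_cong2[where f = "(*)"])
      fix j k
      show "(LINT \<xi>|lborel. complex_of_real (std_normal_density \<xi>) * cis (\<xi> * (- Y j - - Y k))) =
          complex_of_real (e j k)"
        using gaussian_fourier[of "- Y j - - Y k"] by (simp only: mult.commute) (simp add: e_def)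
    qed
    finally have "cmod (complex_of_real (LINT \<xi>|lborel. (cmod (trig S Y a \<xi>))\<^sup>2 * std_normal_density \<xi>)) =
        cmod (\<Sum>j\<in>S. \<Sum>k\<in>S. a j * cnj (a k) * complex_of_real (e j k))" by (rule arg_cong)
    then have "(LINT \<xi>|lborel. (cmod (trig S Y a \<xi>))\<^sup>2 * std_normal_density \<xi>) \<le>
        cmod (\<Sum>j\<in>S. \<Sum>k\<in>S. a j * cnj (a k) * complex_of_real (e j k))" by simp
    also have "\<dots> \<le> (\<Sum>j\<in>S. \<Sum>k\<in>S. cmod (a j) * cmod (a k) * e j k)"
      by (intro order_trans[OF norm_sum] sum_mono) (auto simp: norm_mult e_def)
    \<comment> \<open>Schur's test: after the arithmetic-geometric inequality, symmetry of
      \<open>e\<close> makes the two halves equal and leaves row sums of \<open>e\<close>.\<close>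
    also have "\<dots> \<le> (\<Sum>j\<in>S. \<Sum>k\<in>S. ((cmod (a j))\<^sup>2 * e j k + (cmod (a k))\<^sup>2 * e j k) / 2)"
    proof (intro sum_mono)
      fix j k
      have "cmod (a j) * cmod (a k) * e j k \<le> ((cmod (a j))\<^sup>2 + (cmod (a k))\<^sup>2) / 2 * e j k"
        using sum_squares_bound[of "cmod (a j)" "cmod (a k)"]
        by (intro mult_right_mono) (auto simp: e_def)
      then show "cmod (a j) * cmod (a k) * e j k \<le> ((cmod (a j))\<^sup>2 * e j k + (cmod (a k))\<^sup>2 * e j k) / 2"
        by (simp add: algebra_simps)
    qed
    also have "\<dots> = ((\<Sum>j\<in>S. \<Sum>k\<in>S. (cmod (a j))\<^sup>2 * e j k) + (\<Sum>j\<in>S. \<Sum>k\<in>S. (cmod (a k))\<^sup>2 * e j k)) / 2"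
      by (simp add: sum.distrib sum_divide_distrib[symmetric])
    also have "(\<Sum>j\<in>S. \<Sum>k\<in>S. (cmod (a k))\<^sup>2 * e j k) = (\<Sum>j\<in>S. \<Sum>k\<in>S. (cmod (a j))\<^sup>2 * e j k)"
      by (subst sum.swap) (simp add: es)
    also have "((\<Sum>j\<in>S. \<Sum>k\<in>S. (cmod (a j))\<^sup>2 * e j k) + (\<Sum>j\<in>S. \<Sum>k\<in>S. (cmod (a j))\<^sup>2 * e j k)) / 2 =
        (\<Sum>j\<in>S. (cmod (a j))\<^sup>2 * (\<Sum>k\<in>S. e j k))"
      by (simp only: sum_distrib_left add_divide_distrib field_sum_of_halves)
    also have "\<dots> \<le> (\<Sum>j\<in>S. (cmod (a j))\<^sup>2 * M)"
      using eM by (intro sum_mono mult_left_mono) auto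
    also have "\<dots> = M * (\<Sum>j\<in>S. (cmod (a j))\<^sup>2)" by (simp add: sum_distrib_left mult.commute)
    finally have "n * torus_norm2 S Y a \<le> M * (\<Sum>j\<in>S. (cmod (a j))\<^sup>2)" using 1 by linarith
    then show ?thesis using n by (simp add: field_simps)
  qed
  then show ?thesis using that[of "M / n"] M n by (simp add: bessel_def)
qed

section \<open>Generators with transform in the amalgam space\<close>

lemma nn_integral_translate:
  fixes f :: "real \<Rightarrow> ennreal"
  assumes "f \<in> borel_measurable borel"
  shows "(\<integral>\<^sup>+ x. f (x + t) \<partial>lborel) = (\<integral>\<^sup>+ x. f x \<partial>lborel)"
  using nn_integral_real_affine[OF assms, of 1 t] by (simp add: add.commute)

lemma nn_integral_torus_translates:
  fixes f :: "real \<Rightarrow> ennreal"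
  assumes [measurable]: "f \<in> borel_measurable borel"
  shows "(\<integral>\<^sup>+ x. f x \<partial>lborel) =
    (SUP n::nat. \<Sum>m\<in>{- int n..int n}. \<integral>\<^sup>+ x. f (x + 2 * pi * of_int m) * indicator torus x \<partial>lborel)"
proof -
  \<comment> \<open>The index of the translate of the torus that contains x; it is unique because
    the torus is half-open.\<close>
  define i where "i x = \<lfloor>(x + pi) / (2 * pi)\<rfloor>" for x :: real
  have [measurable]: "i \<in> measurable borel (count_space UNIV)"
    unfolding i_def by measurable
  have i0: "i (x + 2 * pi * of_int m) = i x + m" for x m
  proof -
    have "(x + 2 * pi * of_int m + pi) / (2 * pi) = (x + pi) / (2 * pi) + of_int m"
      by (simp add: field_simps)
    then show ?thesis by (simp add: i_def)
  qed
  have it: "i x = 0 \<longleftrightarrow> x \<in> torus" for x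
    unfolding i_def torus_def floor_eq_iff by (auto simp: field_simps)
  have piece: "(\<integral>\<^sup>+ x. f x * (if i x = m then 1 else 0) \<partial>lborel) =
      (\<integral>\<^sup>+ x. f (x + 2 * pi * of_int m) * indicator torus x \<partial>lborel)" for m
  proof -
    have "(\<integral>\<^sup>+ x. f x * (if i x = m then 1 else 0) \<partial>lborel) =
        (\<integral>\<^sup>+ x. f (x + 2 * pi * of_int m) * (if i (x + 2 * pi * of_int m) = m then 1 else 0) \<partial>lborel)"
      by (rule nn_integral_translate[symmetric]) measurable
    also have "\<dots> = (\<integral>\<^sup>+ x. f (x + 2 * pi * of_int m) * indicator torus x \<partial>lborel)"
      unfolding i0 by (intro nn_integral_cong) (simp add: it indicator_def)
    finally show ?thesis .
  qed
  have "(\<integral>\<^sup>+ x. f x \<partial>lborel) =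
      (\<integral>\<^sup>+ x. (SUP n::nat. \<Sum>m\<in>{- int n..int n}. f x * (if i x = m then 1 else 0)) \<partial>lborel)"
  proof (rule nn_integral_cong)
    fix x
    have s: "(\<Sum>m\<in>{- int n..int n}. f x * (if i x = m then 1 else 0)) =
        (if \<bar>i x\<bar> \<le> int n then f x else 0)" for n :: nat
      by (simp add: sum.delta flip: sum_distrib_left) auto
    show "f x = (SUP n::nat. \<Sum>m\<in>{- int n..int n}. f x * (if i x = m then 1 else 0))"
      unfolding s
    proof (rule antisym)
      show "f x \<le> (SUP n::nat. if \<bar>i x\<bar> \<le> int n then f x else 0)"
        by (rule SUP_upper2[of "nat \<bar>i x\<bar>"]) auto
      show "(SUP n::nat. if \<bar>i x\<bar> \<le> int n then f x else 0) \<le> f x"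
        by (rule SUP_least) simp
    qed
  qed
  also have "\<dots> = (SUP n::nat. \<integral>\<^sup>+ x. (\<Sum>m\<in>{- int n..int n}. f x * (if i x = m then 1 else 0)) \<partial>lborel)"
  proof (rule nn_integral_monotone_convergence_SUP)
    show "incseq (\<lambda>n x. \<Sum>m\<in>{- int n..int n}. f x * (if i x = m then 1 else 0))"
      by (intro incseq_SucI le_funI sum_mono2) auto
  qed measurable
  also have "\<dots> = (SUP n::nat. \<Sum>m\<in>{- int n..int n}.
      \<integral>\<^sup>+ x. f (x + 2 * pi * of_int m) * indicator torus x \<partial>lborel)"
    by (simp add: nn_integral_sum piece)
  finally show ?thesis .
qed

lemma nn_integral_torus_Linf:
  fixes w :: "real \<Rightarrow> ennreal"
  assumes [measurable]: "G \<in> borel_measurable borel" "w \<in> borel_measurable borel"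
  shows "(\<integral>\<^sup>+ \<xi>. ennreal (cmod (G \<xi>)) * w \<xi> * indicator torus \<xi> \<partial>lborel) \<le>
    Linf_T G * (\<integral>\<^sup>+ \<xi>. w \<xi> * indicator torus \<xi> \<partial>lborel)"
proof -
  have "AE \<xi> in restrict_space lborel torus. ennreal (cmod (G \<xi>)) \<le> Linf_T G"
    unfolding Linf_T_def by (rule esssup_AE)
  then have "AE \<xi> in lborel. \<xi> \<in> torus \<longrightarrow> ennreal (cmod (G \<xi>)) \<le> Linf_T G"
    by (subst (asm) AE_restrict_space_iff) auto
  then have "AE \<xi> in lborel. ennreal (cmod (G \<xi>)) * w \<xi> * indicator torus \<xi> \<le>
      Linf_T G * (w \<xi> * indicator torus \<xi>)"
  proof eventually_elim
    case (elim \<xi>)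
    then show ?case
      by (cases "\<xi> \<in> torus") (auto intro!: mult_right_mono)
  qed
  then have "(\<integral>\<^sup>+ \<xi>. ennreal (cmod (G \<xi>)) * w \<xi> * indicator torus \<xi> \<partial>lborel) \<le>
      (\<integral>\<^sup>+ \<xi>. Linf_T G * (w \<xi> * indicator torus \<xi>) \<partial>lborel)"
    by (rule nn_integral_mono_AE)
  also have "\<dots> = Linf_T G * (\<integral>\<^sup>+ \<xi>. w \<xi> * indicator torus \<xi> \<partial>lborel)"
    by (rule nn_integral_cmult) measurable
  finally show ?thesis .
qed

text \<open>Hoelder's inequality on each translate of the torus, with F in L-infinity and w in L1;
  summing the suprema gives the amalgam norm.\<close>

lemma nn_integral_amalgam:
  fixes w :: "real \<Rightarrow> ennreal"
  assumes [measurable]: "F \<in> borel_measurable borel" "w \<in> borel_measurable borel"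
    and w: "\<And>m::int. (\<integral>\<^sup>+ \<xi>. w (\<xi> + 2 * pi * of_int m) * indicator torus \<xi> \<partial>lborel) \<le> K"
  shows "(\<integral>\<^sup>+ \<xi>. ennreal (cmod (F \<xi>)) * w \<xi> \<partial>lborel) \<le> amalgam_norm F * K"
proof -
  define L where "L m = Linf_T (\<lambda>\<xi>. F (\<xi> + 2 * pi * of_int m))" for m :: int
  have "(\<Sum>m\<in>{- int n..int n}. \<integral>\<^sup>+ \<xi>. ennreal (cmod (F (\<xi> + 2 * pi * of_int m))) *
      w (\<xi> + 2 * pi * of_int m) * indicator torus \<xi> \<partial>lborel) \<le> amalgam_norm F * K" for n
  proof -
    have "(\<Sum>m\<in>{- int n..int n}. \<integral>\<^sup>+ \<xi>. ennreal (cmod (F (\<xi> + 2 * pi * of_int m))) *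
        w (\<xi> + 2 * pi * of_int m) * indicator torus \<xi> \<partial>lborel) \<le> (\<Sum>m\<in>{- int n..int n}. L m * K)"
    proof (rule sum_mono)
      fix m
      have "(\<integral>\<^sup>+ \<xi>. ennreal (cmod (F (\<xi> + 2 * pi * of_int m))) *
          w (\<xi> + 2 * pi * of_int m) * indicator torus \<xi> \<partial>lborel) \<le>
          L m * (\<integral>\<^sup>+ \<xi>. w (\<xi> + 2 * pi * of_int m) * indicator torus \<xi> \<partial>lborel)"
        unfolding L_def by (rule nn_integral_torus_Linf) measurable
      also have "\<dots> \<le> L m * K" by (intro mult_left_mono w) auto
      finally show "(\<integral>\<^sup>+ \<xi>. ennreal (cmod (F (\<xi> + 2 * pi * of_int m))) *
          w (\<xi> + 2 * pi * of_int m) * indicator torus \<xi> \<partial>lborel) \<le> L m * K" .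
    qed
    also have "\<dots> = (\<Sum>m\<in>{- int n..int n}. L m) * K" by (rule sum_distrib_right[symmetric])
    also have "\<dots> \<le> amalgam_norm F * K"
      unfolding amalgam_norm_def L_def[symmetric]
    proof (rule mult_right_mono)
      \<comment> \<open>In \<open>ennreal\<close> the infinite sum is the supremum of the finite
        ones.\<close>
      show "(\<Sum>m\<in>{- int n..int n}. L m) \<le> infsum L UNIV"
        by (subst nonneg_infsum_complete) (auto intro!: SUP_upper)
    qed simp
    finally show ?thesis .
  qed
  then show ?thesis
    by (subst nn_integral_torus_translates) (auto intro!: SUP_least)
qed

text \<open>Real constants W and \<delta> stand in for the extended-real quantities of (A2). The
  sign of F enters separately, as an assumption of \<open>comb_coercive\<close>.\<close>

locale generator =
  fixes \<phi> F :: "real \<Rightarrow> complex" and W \<delta> :: real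
  assumes cont: "continuous_on UNIV \<phi>"
    and fourier: "fourier_L2 \<phi> F"
    and W: "0 < W" "amalgam_norm F \<le> ennreal W"
    and \<delta>: "0 < \<delta>" "AE \<xi> in lborel. \<xi> \<in> torus \<longrightarrow> \<delta> \<le> cmod (F \<xi>)"
begin

lemma sq_int_gen: "sq_int \<phi>" and sq_int_F: "sq_int F"
  using fourier by (auto simp: fourier_L2_def)

lemma measurable_F [measurable]: "F \<in> borel_measurable borel"
  using sq_int_F by (rule sq_int_measurable)

lemma measurable_gen [measurable]: "\<phi> \<in> borel_measurable borel"
  using sq_int_gen by (rule sq_int_measurable)

lemma nn_integral_weighted:
  assumes [measurable]: "w \<in> borel_measurable borel"
    and "\<And>m::int. (\<integral>\<^sup>+ \<xi>. w (\<xi> + 2 * pi * of_int m) * indicator torus \<xi> \<partial>lborel) \<le> ennreal K"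
  shows "(\<integral>\<^sup>+ \<xi>. ennreal (cmod (F \<xi>)) * w \<xi> \<partial>lborel) \<le> ennreal (W * K)"
proof -
  have "(\<integral>\<^sup>+ \<xi>. ennreal (cmod (F \<xi>)) * w \<xi> \<partial>lborel) \<le> amalgam_norm F * ennreal K"
    using assms by (intro nn_integral_amalgam) auto
  also have "\<dots> \<le> ennreal W * ennreal K" by (intro mult_right_mono W) auto
  finally show ?thesis using W by (simp add: ennreal_mult')
qed

text \<open>The amalgam space embeds in L1: the constant weight 1 has integral 2 pi over each
  translate of the torus.\<close>

lemma integrable_F: "integrable lborel F"
proof (rule integrableI_bounded)
  have "(\<integral>\<^sup>+ \<xi>. ennreal (cmod (F \<xi>)) * 1 \<partial>lborel) \<le> ennreal (W * (2 * pi))"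
    by (rule nn_integral_weighted) (auto simp: torus_def)
  then show "(\<integral>\<^sup>+ \<xi>. ennreal (norm (F \<xi>)) \<partial>lborel) < \<infinity>"
    by (auto intro: le_less_trans)
qed measurable

lemma inversion: "\<phi> x = complex_of_real (1 / sqrt (2 * pi)) * (LINT \<xi>|lborel. F \<xi> * cis (\<xi> * x))"
  by (rule fourier_L2_inversion[OF fourier cont integrable_F])

lemma nn_integral_F_trig:
  assumes "bessel S Y B"
  shows "(\<integral>\<^sup>+ \<xi>. ennreal (cmod (F \<xi>)) * ennreal ((cmod (trig S Y a \<xi>))\<^sup>2) \<partial>lborel) \<le>
    ennreal (W * (B * (\<Sum>j\<in>S. (cmod (a j))\<^sup>2)))"
proof (rule nn_integral_weighted)
  fix m :: int
  have "torus_norm2 S Y (\<lambda>j. a j * cis (- (2 * pi * of_int m * Y j))) \<le>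
      B * (\<Sum>j\<in>S. (cmod (a j * cis (- (2 * pi * of_int m * Y j))))\<^sup>2)"
    using assms unfolding bessel_def by blast
  then show "(\<integral>\<^sup>+ \<xi>. ennreal ((cmod (trig S Y a (\<xi> + 2 * pi * of_int m)))\<^sup>2) * indicator torus \<xi> \<partial>lborel)
      \<le> ennreal (B * (\<Sum>j\<in>S. (cmod (a j))\<^sup>2))"
    unfolding trig_translate nn_integral_torus_trig by (simp add: norm_mult ennreal_leI)
qed measurable

text \<open>The weighted estimate is applied a second time, with weight |F||p|^2. Its integral over
  the whole line is already bounded, hence so is its integral over each translate of the
  torus.\<close>

lemma nn_integral_F2_trig:
  assumes "bessel S Y B"
  shows "(\<integral>\<^sup>+ \<xi>. ennreal ((cmod (F \<xi>))\<^sup>2 * (cmod (trig S Y a \<xi>))\<^sup>2) \<partial>lborel) \<le>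
    ennreal (W * (W * (B * (\<Sum>j\<in>S. (cmod (a j))\<^sup>2))))"
proof -
  define w where "w \<xi> = ennreal (cmod (F \<xi>)) * ennreal ((cmod (trig S Y a \<xi>))\<^sup>2)" for \<xi>
  have [measurable]: "w \<in> borel_measurable borel" unfolding w_def by measurable
  have "(\<integral>\<^sup>+ \<xi>. ennreal (cmod (F \<xi>)) * w \<xi> \<partial>lborel) \<le>
      ennreal (W * (W * (B * (\<Sum>j\<in>S. (cmod (a j))\<^sup>2))))"
  proof (rule nn_integral_weighted)
    fix m :: int
    have "(\<integral>\<^sup>+ \<xi>. w (\<xi> + 2 * pi * of_int m) * indicator torus \<xi> \<partial>lborel) \<le>
        (\<integral>\<^sup>+ \<xi>. w (\<xi> + 2 * pi * of_int m) \<partial>lborel)"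
      by (intro nn_integral_mono) (auto simp: indicator_def)
    also have "\<dots> = (\<integral>\<^sup>+ \<xi>. w \<xi> \<partial>lborel)" by (rule nn_integral_translate) measurable
    also have "\<dots> \<le> ennreal (W * (B * (\<Sum>j\<in>S. (cmod (a j))\<^sup>2)))"
      unfolding w_def by (rule nn_integral_F_trig[OF assms])
    finally show "(\<integral>\<^sup>+ \<xi>. w (\<xi> + 2 * pi * of_int m) * indicator torus \<xi> \<partial>lborel) \<le> \<dots>" .
  qed measurable
  then show ?thesis
    by (simp add: w_def ennreal_mult' power2_eq_square mult.assoc)
qed

lemma integrable_F_trig: "integrable lborel (\<lambda>\<xi>. cmod (F \<xi>) * (cmod (trig S Y a \<xi>))\<^sup>2)"
proof (rule Bochner_Integration.integrable_bound)
  show "integrable lborel (\<lambda>\<xi>. cmod (F \<xi>) * (\<Sum>j\<in>S. cmod (a j))\<^sup>2)"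
    using integrable_F by auto
  show "AE \<xi> in lborel. norm (cmod (F \<xi>) * (cmod (trig S Y a \<xi>))\<^sup>2) \<le>
      norm (cmod (F \<xi>) * (\<Sum>j\<in>S. cmod (a j))\<^sup>2)"
    by (auto simp: abs_mult intro!: mult_left_mono power_mono cmod_trig_le)
qed measurable

lemma integral_F_trig_le:
  assumes "bessel S Y B" "0 \<le> B"
  shows "(LINT \<xi>|lborel. cmod (F \<xi>) * (cmod (trig S Y a \<xi>))\<^sup>2) \<le> W * (B * (\<Sum>j\<in>S. (cmod (a j))\<^sup>2))"
proof (rule integral_real_bounded)
  show "0 \<le> W * (B * (\<Sum>j\<in>S. (cmod (a j))\<^sup>2))" using W assms by (auto intro!: mult_nonneg_nonneg sum_nonneg)
  show "(\<integral>\<^sup>+ \<xi>. ennreal (cmod (F \<xi>) * (cmod (trig S Y a \<xi>))\<^sup>2) \<partial>lborel) \<le>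
      ennreal (W * (B * (\<Sum>j\<in>S. (cmod (a j))\<^sup>2)))"
    using nn_integral_F_trig[OF assms(1)] by (simp add: ennreal_mult')
qed

definition comb :: "int set \<Rightarrow> (int \<Rightarrow> real) \<Rightarrow> (int \<Rightarrow> complex) \<Rightarrow> real \<Rightarrow> complex"
  where "comb S Y a x = (\<Sum>j\<in>S. a j * \<phi> (x - Y j))"

lemma measurable_comb [measurable]: "comb S Y a \<in> borel_measurable borel"
  unfolding comb_def[abs_def] by measurable

lemma continuous_on_comb: "continuous_on UNIV (comb S Y a)"
  unfolding comb_def[abs_def]
  by (intro continuous_intros continuous_on_compose2[OF cont]) auto

text \<open>The transform of the combination is F times \<open>trig\<close>. Expanding the square
  reduces this Plancherel identity to autocorrelations of the generator.\<close>

lemma comb_L2: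
  "integrable lborel (\<lambda>x. (cmod (comb S Y a x))\<^sup>2)"
  "(\<integral>\<^sup>+ x. ennreal ((cmod (comb S Y a x))\<^sup>2) \<partial>lborel) =
   (\<integral>\<^sup>+ \<xi>. ennreal ((cmod (F \<xi>))\<^sup>2 * (cmod (trig S Y a \<xi>))\<^sup>2) \<partial>lborel)"
proof -
  have int: "integrable lborel (\<lambda>x. \<phi> (x - s) * cnj (\<phi> (x - t)))" for s t
    using integrable_sq_int_mult[OF sq_int_shift[OF sq_int_gen] sq_int_shift[OF sq_int_gen], of "\<lambda>_. 1"]
    by simp
  have FF: "integrable lborel (\<lambda>\<xi>. F \<xi> * cnj (F \<xi>))"
    using integrable_sq_int_mult[OF sq_int_F sq_int_F, of "\<lambda>_. 1"] by simp
  have sq: "complex_of_real ((cmod (comb S Y a x))\<^sup>2) =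
      (\<Sum>j\<in>S. \<Sum>k\<in>S. a j * cnj (a k) * (\<phi> (x - Y j) * cnj (\<phi> (x - Y k))))" for x
    unfolding complex_norm_square comb_def by (simp add: sum_product mult_ac)
  have ci: "integrable lborel (\<lambda>x. complex_of_real ((cmod (comb S Y a x))\<^sup>2))"
    unfolding sq by (intro Bochner_Integration.integrable_sum integrable_mult_right int)
  then show i1: "integrable lborel (\<lambda>x. (cmod (comb S Y a x))\<^sup>2)"
    unfolding complex_of_real_integrable_eq .
  have i2: "integrable lborel (\<lambda>\<xi>. (cmod (F \<xi>))\<^sup>2 * (cmod (trig S Y a \<xi>))\<^sup>2)"
  proof (rule Bochner_Integration.integrable_bound)
    show "integrable lborel (\<lambda>\<xi>. (cmod (F \<xi>))\<^sup>2 * (\<Sum>j\<in>S. cmod (a j))\<^sup>2)"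
      by (intro integrable_mult_left sq_int_integrable sq_int_F)
    show "AE \<xi> in lborel. norm ((cmod (F \<xi>))\<^sup>2 * (cmod (trig S Y a \<xi>))\<^sup>2) \<le>
        norm ((cmod (F \<xi>))\<^sup>2 * (\<Sum>j\<in>S. cmod (a j))\<^sup>2)"
      by (auto simp: abs_mult intro!: mult_left_mono power_mono cmod_trig_le)
  qed measurable
  have "complex_of_real (LINT x|lborel. (cmod (comb S Y a x))\<^sup>2) =
      (\<Sum>j\<in>S. \<Sum>k\<in>S. a j * cnj (a k) * (LINT x|lborel. \<phi> (x - Y j) * cnj (\<phi> (x - Y k))))"
    unfolding integral_complex_of_real[symmetric] sq
    by (simp add: Bochner_Integration.integral_sum int)
  \<comment> \<open>Nodes are negated to match the sign convention of
    \<open>trig_sum_quadratic_form\<close>.\<close>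
  also have "\<dots> = (\<Sum>j\<in>S. \<Sum>k\<in>S. a j * cnj (a k) *
      (LINT \<xi>|lborel. F \<xi> * cnj (F \<xi>) * cis (\<xi> * (- Y j - - Y k))))"
    unfolding fourier_L2_autocorrelation[OF fourier cont] by (simp add: algebra_simps)
  also have "\<dots> = (LINT \<xi>|lborel. F \<xi> * cnj (F \<xi>) *
      ((\<Sum>j\<in>S. a j * cis (\<xi> * - Y j)) * (\<Sum>k\<in>S. cnj (a k) * cis (- (\<xi> * - Y k)))))"
    by (rule trig_sum_quadratic_form[OF FF])
  also have "\<dots> = complex_of_real (LINT \<xi>|lborel. (cmod (F \<xi>))\<^sup>2 * (cmod (trig S Y a \<xi>))\<^sup>2)"
    unfolding integral_complex_of_real[symmetric] of_real_mult complex_norm_square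
    by (simp add: trig_def cis_cnj)
  finally have "(LINT x|lborel. (cmod (comb S Y a x))\<^sup>2) =
      (LINT \<xi>|lborel. (cmod (F \<xi>))\<^sup>2 * (cmod (trig S Y a \<xi>))\<^sup>2)"
    by (simp only: of_real_eq_iff)
  then show "(\<integral>\<^sup>+ x. ennreal ((cmod (comb S Y a x))\<^sup>2) \<partial>lborel) =
      (\<integral>\<^sup>+ \<xi>. ennreal ((cmod (F \<xi>))\<^sup>2 * (cmod (trig S Y a \<xi>))\<^sup>2) \<partial>lborel)"
    using i1 i2 by (simp add: nn_integral_eq_integral)
qed

lemma comb_L2_upper:
  assumes "bessel S Y B"
  shows "(\<integral>\<^sup>+ x. ennreal ((cmod (comb S Y a x))\<^sup>2) \<partial>lborel) \<le>
    ennreal (W * (W * (B * (\<Sum>j\<in>S. (cmod (a j))\<^sup>2))))"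
  unfolding comb_L2(2) by (rule nn_integral_F2_trig[OF assms])

text \<open>By \<open>comb_L2\<close> the norm is an integral of |F|^2 |p|^2; keeping only the
  torus, where |F| >= \<delta>, leaves the norm in the Riesz bound.\<close>

lemma comb_L2_lower:
  assumes "(\<Sum>j\<in>S. (cmod (a j))\<^sup>2) \<le> K * torus_norm2 S Y a" "0 < K" "0 \<le> r"
    and "(\<integral>\<^sup>+ x. ennreal ((cmod (comb S Y a x))\<^sup>2) \<partial>lborel) \<le> ennreal r"
  shows "(\<Sum>j\<in>S. (cmod (a j))\<^sup>2) \<le> K / \<delta>\<^sup>2 * r"
proof -
  have "ennreal (\<delta>\<^sup>2 * torus_norm2 S Y a) =
      ennreal (\<delta>\<^sup>2) * (\<integral>\<^sup>+ \<xi>. ennreal ((cmod (trig S Y a \<xi>))\<^sup>2) * indicator torus \<xi> \<partial>lborel)"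
    by (simp add: nn_integral_torus_trig ennreal_mult')
  also have "\<dots> = (\<integral>\<^sup>+ \<xi>. ennreal (\<delta>\<^sup>2) * (ennreal ((cmod (trig S Y a \<xi>))\<^sup>2) * indicator torus \<xi>) \<partial>lborel)"
    by (rule nn_integral_cmult[symmetric]) measurable
  also have "\<dots> \<le> (\<integral>\<^sup>+ \<xi>. ennreal ((cmod (F \<xi>))\<^sup>2 * (cmod (trig S Y a \<xi>))\<^sup>2) \<partial>lborel)"
    using \<delta>(2)
  proof (intro nn_integral_mono_AE, eventually_elim)
    case (elim \<xi>)
    show ?case
    proof (cases "\<xi> \<in> torus")
      case True
      then have "\<delta>\<^sup>2 \<le> (cmod (F \<xi>))\<^sup>2" using elim \<delta>(1) by (intro power_mono) auto
      then have "\<delta>\<^sup>2 * (cmod (trig S Y a \<xi>))\<^sup>2 \<le> (cmod (F \<xi>))\<^sup>2 * (cmod (trig S Y a \<xi>))\<^sup>2"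
        by (intro mult_right_mono) auto
      then show ?thesis using True by (simp add: ennreal_leI flip: ennreal_mult')
    qed simp
  qed
  also have "\<dots> \<le> ennreal r" using assms(4) unfolding comb_L2(2) .
  finally have "\<delta>\<^sup>2 * torus_norm2 S Y a \<le> r" using assms(3) by simp
  then have "torus_norm2 S Y a \<le> r / \<delta>\<^sup>2" using \<delta>(1) by (simp add: le_divide_eq mult.commute)
  then have "K * torus_norm2 S Y a \<le> K * (r / \<delta>\<^sup>2)" using assms(2) by (intro mult_left_mono) auto
  with assms(1) show ?thesis by simp
qed

text \<open>Inversion turns samples of a combination, tested against b, into a pairing of two
  trigonometric sums with weight F. It yields the sampling bound and, with Z = Y,
  coercivity.\<close>

lemma comb_pairing:
  "(\<Sum>k\<in>T. b k * comb S Y a (Z k)) = complex_of_real (1 / sqrt (2 * pi)) *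
    (LINT \<xi>|lborel. F \<xi> * (cnj (trig T Z (\<lambda>k. cnj (b k)) \<xi>) * trig S Y a \<xi>))"
proof -
  have "(\<Sum>k\<in>T. b k * comb S Y a (Z k)) = complex_of_real (1 / sqrt (2 * pi)) *
      (\<Sum>k\<in>T. \<Sum>j\<in>S. b k * a j * (LINT \<xi>|lborel. F \<xi> * cis (\<xi> * (Z k - Y j))))"
    unfolding comb_def sum_distrib_left by (intro sum.cong refl) (subst inversion, simp only: mult_ac)
  also have "(\<Sum>k\<in>T. \<Sum>j\<in>S. b k * a j * (LINT \<xi>|lborel. F \<xi> * cis (\<xi> * (Z k - Y j)))) =
      (LINT \<xi>|lborel. F \<xi> * ((\<Sum>k\<in>T. b k * cis (\<xi> * Z k)) * (\<Sum>j\<in>S. a j * cis (- (\<xi> * Y j)))))"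
    by (rule trig_sum_quadratic_form[OF integrable_F])
  finally show ?thesis by (simp add: trig_def cis_cnj)
qed

text \<open>Duality: the samples are tested against their own conjugates, so their squared norm is
  itself a pairing. A weighted arithmetic-geometric inequality separates the two sums, and the part
  containing the samples is absorbed on the left.\<close>

lemma comb_sampling:
  assumes S: "bessel S Y B" and T: "bessel T Z B'" and B: "0 \<le> B" "0 < B'"
  shows "(\<Sum>k\<in>T. (cmod (comb S Y a (Z k)))\<^sup>2) \<le> W\<^sup>2 * B * B' / (2 * pi) * (\<Sum>j\<in>S. (cmod (a j))\<^sup>2)"
proof -
  define \<alpha> where "\<alpha> = (\<Sum>j\<in>S. (cmod (a j))\<^sup>2)"
  define \<beta> where "\<beta> = (\<Sum>k\<in>T. (cmod (comb S Y a (Z k)))\<^sup>2)"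
  \<comment> \<open>Chosen so that the term to be absorbed is exactly half of \<beta>.\<close>
  define t where "t = W * B' / sqrt (2 * pi)"
  have t: "t > 0" using W B by (simp add: t_def)
  define p where "p = trig S Y a"
  define q where "q = trig T Z (\<lambda>k. comb S Y a (Z k))"
  have [measurable]: "p \<in> borel_measurable borel" "q \<in> borel_measurable borel"
    unfolding p_def q_def by auto
  define P where "P = (LINT \<xi>|lborel. cmod (F \<xi>) * (cmod (p \<xi>))\<^sup>2)"
  define Q where "Q = (LINT \<xi>|lborel. cmod (F \<xi>) * (cmod (q \<xi>))\<^sup>2)"
  have PQ: "P \<le> W * (B * \<alpha>)" "Q \<le> W * (B' * \<beta>)"
    unfolding P_def Q_def p_def q_def \<alpha>_def \<beta>_def
    using S T B by (auto intro!: integral_F_trig_le)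
  have "complex_of_real \<beta> = (\<Sum>k\<in>T. cnj (comb S Y a (Z k)) * comb S Y a (Z k))"
    unfolding \<beta>_def of_real_sum complex_norm_square by (simp add: mult.commute)
  also have "\<dots> = complex_of_real (1 / sqrt (2 * pi)) * (LINT \<xi>|lborel. F \<xi> * (cnj (q \<xi>) * p \<xi>))"
    unfolding comb_pairing p_def q_def by simp
  finally have "cmod (complex_of_real \<beta>) =
      cmod (complex_of_real (1 / sqrt (2 * pi)) * (LINT \<xi>|lborel. F \<xi> * (cnj (q \<xi>) * p \<xi>)))"
    by (rule arg_cong)
  moreover have "0 \<le> \<beta>" by (simp add: \<beta>_def sum_nonneg)
  ultimately have "\<beta> = 1 / sqrt (2 * pi) * cmod (LINT \<xi>|lborel. F \<xi> * (cnj (q \<xi>) * p \<xi>))"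
    unfolding norm_mult norm_of_real by simp
  also have "cmod (LINT \<xi>|lborel. F \<xi> * (cnj (q \<xi>) * p \<xi>)) \<le>
      (LINT \<xi>|lborel. t / 2 * (cmod (F \<xi>) * (cmod (p \<xi>))\<^sup>2) + 1 / (2 * t) * (cmod (F \<xi>) * (cmod (q \<xi>))\<^sup>2))"
  proof (rule order_trans[OF integral_norm_bound integral_mono_AE'])
    show "integrable lborel (\<lambda>\<xi>. t / 2 * (cmod (F \<xi>) * (cmod (p \<xi>))\<^sup>2) +
        1 / (2 * t) * (cmod (F \<xi>) * (cmod (q \<xi>))\<^sup>2))"
      unfolding p_def q_def
      by (intro Bochner_Integration.integrable_add integrable_mult_right integrable_F_trig)
    have am: "x * y \<le> t / 2 * y\<^sup>2 + 1 / (2 * t) * x\<^sup>2" for x y :: real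
    proof -
      have "0 \<le> (t * y - x)\<^sup>2 / (2 * t)" using t by simp
      also have "\<dots> = t / 2 * y\<^sup>2 + 1 / (2 * t) * x\<^sup>2 - x * y"
        using t by (simp add: power2_eq_square field_simps)
      finally show ?thesis by simp
    qed
    show "AE \<xi> in lborel. norm (F \<xi> * (cnj (q \<xi>) * p \<xi>)) \<le>
        t / 2 * (cmod (F \<xi>) * (cmod (p \<xi>))\<^sup>2) + 1 / (2 * t) * (cmod (F \<xi>) * (cmod (q \<xi>))\<^sup>2)"
    proof (rule AE_I2)
      fix \<xi>
      have "cmod (F \<xi>) * (cmod (q \<xi>) * cmod (p \<xi>)) \<le>
          cmod (F \<xi>) * (t / 2 * (cmod (p \<xi>))\<^sup>2 + 1 / (2 * t) * (cmod (q \<xi>))\<^sup>2)"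
        by (intro mult_left_mono am) auto
      then show "norm (F \<xi> * (cnj (q \<xi>) * p \<xi>)) \<le>
        t / 2 * (cmod (F \<xi>) * (cmod (p \<xi>))\<^sup>2) + 1 / (2 * t) * (cmod (F \<xi>) * (cmod (q \<xi>))\<^sup>2)"
        unfolding norm_mult complex_mod_cnj by (simp only: distrib_left mult.left_commute)
    qed
  qed (use t in auto)
  also have "(LINT \<xi>|lborel. t / 2 * (cmod (F \<xi>) * (cmod (p \<xi>))\<^sup>2) + 1 / (2 * t) * (cmod (F \<xi>) * (cmod (q \<xi>))\<^sup>2))
      = t / 2 * P + 1 / (2 * t) * Q"
    unfolding P_def Q_def p_def q_def
    by (subst Bochner_Integration.integral_add)
      (intro integrable_mult_right integrable_F_trig | simp only: integral_mult_right_zero)+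
  also have "\<dots> \<le> t / 2 * (W * (B * \<alpha>)) + 1 / (2 * t) * (W * (B' * \<beta>))"
    using t PQ by (intro add_mono mult_left_mono) auto
  finally have "\<beta> \<le> 1 / sqrt (2 * pi) * (t / 2 * (W * (B * \<alpha>)) + 1 / (2 * t) * (W * (B' * \<beta>)))"
    by (simp add: divide_right_mono)
  also have "\<dots> = W\<^sup>2 * B * B' / (2 * pi) * \<alpha> / 2 + \<beta> / 2"
  proof -
    have "sqrt (2 * pi) * sqrt (2 * pi) = 2 * pi" by simp
    then show ?thesis using W B by (simp add: t_def field_simps power2_eq_square)
  qed
  finally show ?thesis unfolding \<alpha>_def \<beta>_def by simp
qed

text \<open>With F = |F| the form is an integral of |F||p|^2. The constant collects the inversion
  factor, the lower bound of F on the torus and the Riesz constant.\<close>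

lemma comb_coercive:
  assumes pos: "AE \<xi> in lborel. F \<xi> \<in> \<real>\<^sub>\<ge>\<^sub>0"
    and K: "(\<Sum>j\<in>S. (cmod (a j))\<^sup>2) \<le> K * torus_norm2 S Y a" "0 < K"
  shows "\<delta> / (sqrt (2 * pi) * K) * (\<Sum>j\<in>S. (cmod (a j))\<^sup>2) \<le> Re (\<Sum>k\<in>S. cnj (a k) * comb S Y a (Y k))"
proof -
  have "(\<Sum>k\<in>S. cnj (a k) * comb S Y a (Y k)) = complex_of_real (1 / sqrt (2 * pi)) *
      (LINT \<xi>|lborel. F \<xi> * (cnj (trig S Y a \<xi>) * trig S Y a \<xi>))"
    unfolding comb_pairing by simp
  also have "(LINT \<xi>|lborel. F \<xi> * (cnj (trig S Y a \<xi>) * trig S Y a \<xi>)) =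
      (LINT \<xi>|lborel. complex_of_real (cmod (F \<xi>) * (cmod (trig S Y a \<xi>))\<^sup>2))"
  proof (rule integral_cong_AE)
    show "AE \<xi> in lborel. F \<xi> * (cnj (trig S Y a \<xi>) * trig S Y a \<xi>) =
        complex_of_real (cmod (F \<xi>) * (cmod (trig S Y a \<xi>))\<^sup>2)"
      using pos
    proof eventually_elim
      case (elim \<xi>)
      then have "F \<xi> = complex_of_real (cmod (F \<xi>))" by (auto elim: nonneg_Reals_cases)
      then show ?case
        unfolding of_real_mult complex_norm_square by (simp only: mult_ac)
    qed
  qed measurable
  finally have "(\<Sum>k\<in>S. cnj (a k) * comb S Y a (Y k)) = complex_of_real (1 / sqrt (2 * pi) *
      (LINT \<xi>|lborel. cmod (F \<xi>) * (cmod (trig S Y a \<xi>))\<^sup>2))"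
    unfolding integral_complex_of_real of_real_mult[symmetric] .
  then have re: "Re (\<Sum>k\<in>S. cnj (a k) * comb S Y a (Y k)) =
      1 / sqrt (2 * pi) * (LINT \<xi>|lborel. cmod (F \<xi>) * (cmod (trig S Y a \<xi>))\<^sup>2)"
    by (simp only: Re_complex_of_real)
  have "\<delta> * torus_norm2 S Y a = (LINT \<xi>|lborel. \<delta> * (indicator torus \<xi> * (cmod (trig S Y a \<xi>))\<^sup>2))"
    unfolding torus_norm2_def by simp
  also have "\<dots> \<le> (LINT \<xi>|lborel. cmod (F \<xi>) * (cmod (trig S Y a \<xi>))\<^sup>2)"
  proof (rule integral_mono_AE[OF _ integrable_F_trig])
    show "integrable lborel (\<lambda>\<xi>. \<delta> * (indicator torus \<xi> * (cmod (trig S Y a \<xi>))\<^sup>2))"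
      by (intro integrable_mult_right integrable_torus_trig)
    show "AE \<xi> in lborel. \<delta> * (indicator torus \<xi> * (cmod (trig S Y a \<xi>))\<^sup>2) \<le>
        cmod (F \<xi>) * (cmod (trig S Y a \<xi>))\<^sup>2"
      using \<delta>(2)
    proof eventually_elim
      case (elim \<xi>)
      then show ?case by (cases "\<xi> \<in> torus") (auto intro!: mult_right_mono)
    qed
  qed
  finally have "\<delta> * (K * torus_norm2 S Y a) \<le> K * (LINT \<xi>|lborel. cmod (F \<xi>) * (cmod (trig S Y a \<xi>))\<^sup>2)"
    using K(2) by (simp add: mult.left_commute mult_left_mono)
  then have "\<delta> * (\<Sum>j\<in>S. (cmod (a j))\<^sup>2) \<le> K * (LINT \<xi>|lborel. cmod (F \<xi>) * (cmod (trig S Y a \<xi>))\<^sup>2)"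
    using mult_left_mono[OF K(1), of \<delta>] \<delta>(1) by linarith
  then have "\<delta> * (\<Sum>j\<in>S. (cmod (a j))\<^sup>2) / K \<le> (LINT \<xi>|lborel. cmod (F \<xi>) * (cmod (trig S Y a \<xi>))\<^sup>2)"
    using K(2) by (simp add: divide_le_eq mult.commute)
  then have "1 / sqrt (2 * pi) * (\<delta> * (\<Sum>j\<in>S. (cmod (a j))\<^sup>2) / K) \<le>
      Re (\<Sum>k\<in>S. cnj (a k) * comb S Y a (Y k))"
    unfolding re by (intro mult_left_mono) auto
  then show ?thesis by simp
qed

end

section \<open>Decay, series and samples\<close>

lemma continuous_AE_eq_imp_eq:
  fixes f g :: "real \<Rightarrow> complex"
  assumes "continuous_on UNIV f" "continuous_on UNIV g" "AE x in lborel. f x = g x"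
  shows "f = g"
proof -
  have "open {x. f x \<noteq> g x}"
    using assms(1,2) by (rule open_Collect_neq)
  moreover have "negligible {x. f x \<noteq> g x}"
  proof -
    have "AE x in lebesgue. f x = g x" using assms(3) by (rule AE_completion)
    then show ?thesis
      using calculation by (simp add: negligible_iff_null_sets AE_iff_null_sets)
  qed
  ultimately have "{x. f x \<noteq> g x} = {}" using open_not_negligible by blast
  then show ?thesis by auto
qed

text \<open>The factor 2 is the price of working with squared distances.\<close>

lemma L2_triangle:
  assumes [measurable]: "f \<in> borel_measurable borel" "g \<in> borel_measurable borel" "h \<in> borel_measurable borel"
  shows "L2dist2 f h \<le> 2 * L2dist2 f g + 2 * L2dist2 g h"
proof -
  have "(cmod (f x - h x))\<^sup>2 \<le> 2 * (cmod (f x - g x))\<^sup>2 + 2 * (cmod (g x - h x))\<^sup>2" for x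
  proof -
    have "cmod (f x - h x) \<le> cmod (f x - g x) + cmod (g x - h x)"
      using norm_triangle_ineq[of "f x - g x" "g x - h x"] by simp
    then have "(cmod (f x - h x))\<^sup>2 \<le> (cmod (f x - g x) + cmod (g x - h x))\<^sup>2"
      by (intro power_mono) auto
    also have "\<dots> \<le> 2 * (cmod (f x - g x))\<^sup>2 + 2 * (cmod (g x - h x))\<^sup>2"
      using sum_squares_bound[of "cmod (f x - g x)" "cmod (g x - h x)"] by (simp add: power2_sum)
    finally show ?thesis .
  qed
  then have "L2dist2 f h \<le>
      (\<integral>\<^sup>+ x. ennreal (2 * (cmod (f x - g x))\<^sup>2 + 2 * (cmod (g x - h x))\<^sup>2) \<partial>lborel)"
    unfolding L2dist2_def by (intro nn_integral_mono ennreal_leI)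
  also have "\<dots> = 2 * L2dist2 f g + 2 * L2dist2 g h"
    unfolding L2dist2_def by (simp add: ennreal_plus ennreal_mult nn_integral_add nn_integral_cmult)
  finally show ?thesis .
qed

lemma L2dist2_commute: "L2dist2 f g = L2dist2 g f"
  by (simp add: L2dist2_def norm_minus_commute)

text \<open>Links the symmetric partial sums of \<open>series_rep\<close> to the unordered sums that
  \<open>infsum\<close> computes.\<close>

lemma filterlim_int_intervals:
  "filterlim (\<lambda>N::nat. {- int N..int N}) (finite_subsets_at_top UNIV) sequentially"
  unfolding filterlim_finite_subsets_at_top
proof (intro allI impI)
  fix A :: "int set" assume "finite A \<and> A \<subseteq> UNIV"
  define M where "M = (\<Sum>j\<in>A. \<bar>j\<bar>)"
  have M: "\<bar>j\<bar> \<le> M" if "j \<in> A" for j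
    unfolding M_def using \<open>finite A \<and> A \<subseteq> UNIV\<close> that by (intro member_le_sum) auto
  show "\<forall>\<^sub>F N in sequentially. finite {- int N..int N} \<and> A \<subseteq> {- int N..int N} \<and> {- int N..int N} \<subseteq> UNIV"
    using eventually_ge_at_top[of "nat M"]
  proof eventually_elim
    case (elim N)
    then have "\<bar>j\<bar> \<le> int N" if "j \<in> A" for j using M[OF that] by linarith
    then show ?case by (force simp: abs_le_iff)
  qed
qed

section \<open>Decay of the generator, convergence of the series, and samples of V\<close>

context generator
begin

text \<open>By inversion the increment is bounded by an integral of |F| |cis(\<xi> h) - 1|, which
  does not involve x and tends to 0 with h.\<close>

lemma uniform_modulus:
  assumes "e > 0"
  obtains d where "d > 0" "\<And>x h. \<bar>h\<bar> < d \<Longrightarrow> cmod (\<phi> (x + h) - \<phi> x) < e"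
proof -
  define \<omega> where "\<omega> h = 1 / sqrt (2 * pi) * (LINT \<xi>|lborel. cmod (F \<xi> * (cis (\<xi> * h) - 1)))" for h
  have le: "cmod (\<phi> (x + h) - \<phi> x) \<le> \<omega> h" for x h
  proof -
    have int: "integrable lborel (\<lambda>\<xi>. F \<xi> * cis (\<xi> * y))" for y
      by (rule integrable_mult_bounded[OF integrable_F, of _ 1]) auto
    have "\<phi> (x + h) - \<phi> x = complex_of_real (1 / sqrt (2 * pi)) *
        ((LINT \<xi>|lborel. F \<xi> * cis (\<xi> * (x + h))) - (LINT \<xi>|lborel. F \<xi> * cis (\<xi> * x)))"
      unfolding right_diff_distrib inversion[symmetric] ..
    also have "(LINT \<xi>|lborel. F \<xi> * cis (\<xi> * (x + h))) - (LINT \<xi>|lborel. F \<xi> * cis (\<xi> * x)) =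
        (LINT \<xi>|lborel. F \<xi> * (cis (\<xi> * h) - 1) * cis (\<xi> * x))"
      unfolding Bochner_Integration.integral_diff[OF int int, symmetric]
      by (intro Bochner_Integration.integral_cong refl)
        (simp add: ring_distribs flip: cis_mult)
    finally have "cmod (\<phi> (x + h) - \<phi> x) =
        1 / sqrt (2 * pi) * cmod (LINT \<xi>|lborel. F \<xi> * (cis (\<xi> * h) - 1) * cis (\<xi> * x))"
      by (simp add: norm_mult norm_divide)
    also have "\<dots> \<le> 1 / sqrt (2 * pi) *
        (LINT \<xi>|lborel. cmod (F \<xi> * (cis (\<xi> * h) - 1) * cis (\<xi> * x)))"
      by (intro mult_left_mono integral_norm_bound) auto
    also have "\<dots> = \<omega> h" by (simp add: \<omega>_def norm_mult)
    finally show ?thesis .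
  qed
  have "(\<omega> \<longlongrightarrow> 0) (at 0)"
    unfolding tendsto_at_iff_sequentially comp_def
  proof (intro allI impI)
    fix X :: "nat \<Rightarrow> real" assume X: "X \<longlonglongrightarrow> 0"
    have "(\<lambda>n. LINT \<xi>|lborel. cmod (F \<xi> * (cis (\<xi> * X n) - 1))) \<longlonglongrightarrow> integral\<^sup>L lborel (\<lambda>\<xi>::real. 0)"
    proof (rule integral_dominated_convergence[where w = "\<lambda>\<xi>. cmod (F \<xi>) * 2"])
      show "AE \<xi> in lborel. (\<lambda>n. cmod (F \<xi> * (cis (\<xi> * X n) - 1))) \<longlonglongrightarrow> 0"
      proof (rule AE_I2)
        fix \<xi>
        have "(\<lambda>n. cmod (F \<xi> * (cis (\<xi> * X n) - 1))) \<longlonglongrightarrow> cmod (F \<xi> * (cis (\<xi> * 0) - 1))"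
          by (intro tendsto_intros X)
        then show "(\<lambda>n. cmod (F \<xi> * (cis (\<xi> * X n) - 1))) \<longlonglongrightarrow> 0" by simp
      qed
      have "cmod (cis t - 1) \<le> 2" for t
        using norm_triangle_ineq4[of "cis t" 1] by simp
      then show "AE \<xi> in lborel. norm (cmod (F \<xi> * (cis (\<xi> * X n) - 1))) \<le> cmod (F \<xi>) * 2" for n
        by (intro AE_I2) (auto simp: norm_mult intro!: mult_left_mono)
    qed (use integrable_F in auto)
    from tendsto_mult_left[OF this, of "1 / sqrt (2 * pi)"]
    show "(\<lambda>n. \<omega> (X n)) \<longlonglongrightarrow> 0" by (simp add: \<omega>_def)
  qed
  then have "\<forall>\<^sub>F h in at 0. \<omega> h < e" using assms by (rule order_tendstoD)
  then obtain d where d: "d > 0" "\<And>h. h \<noteq> 0 \<Longrightarrow> \<bar>h\<bar> < d \<Longrightarrow> \<omega> h < e"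
    unfolding eventually_at by (auto simp: dist_real_def)
  have "cmod (\<phi> (x + h) - \<phi> x) < e" if "\<bar>h\<bar> < d" for x h
    using le[of x h] d(2)[OF _ that] assms by (cases "h = 0") auto
  then show ?thesis using that d(1) by blast
qed

text \<open>Uniform continuity and square-integrability: a value of size e stays above e/2 on an
  interval of length d and contributes d (e/2)^2 to a tail integral that tends to 0.\<close>

lemma gen_tendsto_0: "(\<phi> \<longlongrightarrow> 0) at_infinity"
  unfolding Lim_at_infinity
proof (intro allI impI)
  fix e :: real assume e: "e > 0"
  obtain d where d: "d > 0" "\<And>x h. \<bar>h\<bar> < d \<Longrightarrow> cmod (\<phi> (x + h) - \<phi> x) < e / 2"
    using uniform_modulus[of "e / 2"] e by auto
  define \<tau> where "\<tau> n = (LINT x|lborel. indicator {x. real n < \<bar>x\<bar>} x * (cmod (\<phi> x))\<^sup>2)" for n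
  have ti: "integrable lborel (\<lambda>x. indicator {x. real n < \<bar>x\<bar>} x * (cmod (\<phi> x))\<^sup>2)" for n
    by (rule Bochner_Integration.integrable_bound[OF sq_int_integrable[OF sq_int_gen]])
      (auto simp: indicator_def)
  have "\<tau> \<longlonglongrightarrow> integral\<^sup>L lborel (\<lambda>x::real. 0)"
    unfolding \<tau>_def
  proof (rule integral_dominated_convergence[where w = "\<lambda>x. (cmod (\<phi> x))\<^sup>2"])
    show "AE x in lborel. (\<lambda>n. indicator {x. real n < \<bar>x\<bar>} x * (cmod (\<phi> x))\<^sup>2) \<longlonglongrightarrow> 0"
    proof (rule AE_I2, rule tendsto_eventually)
      fix x :: real
      obtain N :: nat where "\<bar>x\<bar> \<le> real N" using real_arch_simple by blast
      then show "\<forall>\<^sub>F n in sequentially. indicator {x. real n < \<bar>x\<bar>} x * (cmod (\<phi> x))\<^sup>2 = 0"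
        unfolding eventually_sequentially by (intro exI[of _ N]) (auto simp: indicator_def)
    qed
  qed (use sq_int_integrable[OF sq_int_gen] in \<open>auto simp: indicator_def\<close>)
  moreover have "0 < d * (e / 2)\<^sup>2" using d(1) e by simp
  ultimately have "\<forall>\<^sub>F n in sequentially. \<tau> n < d * (e / 2)\<^sup>2" by (simp add: order_tendstoD)
  then obtain n where n: "\<tau> n < d * (e / 2)\<^sup>2" by (auto simp: eventually_sequentially)
  \<comment> \<open>The margin d keeps the interval around x outside [-n, n].\<close>
  have "dist (\<phi> x) 0 < e" if x: "real n + d \<le> norm x" for x
  proof (rule ccontr)
    assume "\<not> dist (\<phi> x) 0 < e"
    then have ge: "e \<le> cmod (\<phi> x)" by simp
    have "indicator {x - d / 2..x + d / 2} t * (e / 2)\<^sup>2 \<le> indicator {x. real n < \<bar>x\<bar>} t * (cmod (\<phi> t))\<^sup>2" for t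
    proof (cases "t \<in> {x - d / 2..x + d / 2}")
      case True
      then have td: "\<bar>t - x\<bar> < d" using d(1) by (auto simp: abs_less_iff)
      then have "real n < \<bar>t\<bar>" using x by simp
      moreover have "e / 2 \<le> cmod (\<phi> t)"
        using d(2)[OF td, of x] ge norm_triangle_ineq2[of "\<phi> x" "\<phi> t"]
        by (simp add: norm_minus_commute)
      then have "(e / 2)\<^sup>2 \<le> (cmod (\<phi> t))\<^sup>2" using e by (intro power_mono) auto
      ultimately show ?thesis using True by simp
    qed simp
    then have "(LINT t|lborel. indicator {x - d / 2..x + d / 2} t * (e / 2)\<^sup>2) \<le> \<tau> n"
      unfolding \<tau>_def using d(1)
      by (intro integral_mono ti integrable_mult_left integrable_real_indicator) auto
    moreover have "(LINT t|lborel. indicator {x - d / 2..x + d / 2} t * (e / 2)\<^sup>2) = d * (e / 2)\<^sup>2"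
      using d(1) by simp
    ultimately show False using n by linarith
  qed
  then show "\<exists>b. \<forall>x. b \<le> norm x \<longrightarrow> dist (\<phi> x) 0 < e" by blast
qed

lemma comb_tendsto_0: "(comb S Y a \<longlongrightarrow> 0) at_infinity"
proof -
  have "((\<lambda>x. \<phi> (x - y)) \<longlongrightarrow> 0) at_infinity" for y
  proof (rule filterlim_compose[OF gen_tendsto_0])
    show "filterlim (\<lambda>x. x - y) at_infinity at_infinity"
      unfolding filterlim_at_infinity[OF order_refl]
    proof (intro allI impI)
      fix r :: real
      show "\<forall>\<^sub>F x in at_infinity. r \<le> norm (x - y)"
        unfolding eventually_at_infinity by (rule exI[of _ "r + \<bar>y\<bar>"]) auto
    qed
  qed
  then have "((\<lambda>x. \<Sum>j\<in>S. a j * \<phi> (x - Y j)) \<longlongrightarrow> (\<Sum>j\<in>S. a j * 0)) at_infinity"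
    by (intro tendsto_sum tendsto_mult tendsto_const)
  then show ?thesis by (simp add: comb_def[abs_def])
qed

text \<open>Sampling at the single node x, whose Bessel constant 2 pi cancels the denominator. The
  bound is uniform in x, so smallness of the coefficients gives uniform smallness.\<close>

lemma comb_pointwise:
  assumes "bessel S Y B" "0 \<le> B"
  shows "(cmod (comb S Y a x))\<^sup>2 \<le> W\<^sup>2 * B * (\<Sum>j\<in>S. (cmod (a j))\<^sup>2)"
  using comb_sampling[OF assms(1) bessel_single[of 0 "\<lambda>_. x"] assms(2), of a] by simp

text \<open>The pointwise bound says that a matrix with the single nonzero row \<phi>(x - Y j) is
  bounded, so that row is in l2 and its products with a are summable.\<close>

lemma series_summable:
  assumes B: "\<And>S. finite S \<Longrightarrow> bessel S Y B" "0 \<le> B" and a: "l2_seq a"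
  shows "(\<lambda>j. a j * \<phi> (x - Y j)) summable_on UNIV"
proof -
  interpret bounded_matrix "\<lambda>k j. if k = 0 then \<phi> (x - Y j) else 0" "W * sqrt B"
  proof
    show "0 \<le> W * sqrt B" using W B(2) by simp
    fix S T :: "int set" and a :: "int \<Rightarrow> complex"
    assume "finite S" "finite T"
    have eq: "(\<Sum>j\<in>S. (if k = 0 then \<phi> (x - Y j) else 0) * a j) = (if k = 0 then comb S Y a x else 0)" for k :: int
      by (simp add: comb_def mult.commute)
    have "(\<Sum>k\<in>T. (cmod (\<Sum>j\<in>S. (if k = 0 then \<phi> (x - Y j) else 0) * a j))\<^sup>2) =
        (\<Sum>k\<in>T. if k = 0 then (cmod (comb S Y a x))\<^sup>2 else 0)"
      unfolding eq by (intro sum.cong) auto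
    also have "\<dots> \<le> (cmod (comb S Y a x))\<^sup>2"
      using \<open>finite T\<close> by (simp add: sum.delta)
    also have "\<dots> \<le> (W * sqrt B)\<^sup>2 * (\<Sum>j\<in>S. (cmod (a j))\<^sup>2)"
      using comb_pointwise[OF B(1)[OF \<open>finite S\<close>] B(2)] B(2) by (simp add: power_mult_distrib)
    finally show "(\<Sum>k\<in>T. (cmod (\<Sum>j\<in>S. (if k = 0 then \<phi> (x - Y j) else 0) * a j))\<^sup>2) \<le>
        (W * sqrt B)\<^sup>2 * (\<Sum>j\<in>S. (cmod (a j))\<^sup>2)" .
  qed
  show ?thesis using row_summable'[OF a, of 0] by (simp add: mult.commute)
qed

text \<open>Tails are bounded uniformly in x by tails of the coefficients, so the partial sums
  converge uniformly and pass on continuity and decay. Square-integrability follows from the uniform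
  L2 bound by Fatou.\<close>

lemma series_in_C0_L2:
  assumes B: "\<And>S. finite S \<Longrightarrow> bessel S Y B" "0 \<le> B" and a: "l2_seq a"
  defines "I \<equiv> \<lambda>x. \<Sum>\<^sub>\<infinity>j. a j * \<phi> (x - Y j)"
  shows "series_rep \<phi> Y a I" "C0 I" "sq_int I"
proof -
  define P where "P N = comb {- int N..int N} Y a" for N :: nat
  define Q where "Q N = (\<Sum>j\<in>{- int N..int N}. (cmod (a j))\<^sup>2)" for N :: nat
  define q where "q = (\<Sum>\<^sub>\<infinity>j. (cmod (a j))\<^sup>2)"
  have sum: "(\<lambda>j. (cmod (a j))\<^sup>2) summable_on UNIV" using a by (simp add: l2_seq_def)
  have lim: "(\<lambda>N. P N x) \<longlonglongrightarrow> I x" for x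
    unfolding P_def I_def comb_def
    by (rule filterlim_compose[OF infsum_tendsto[OF series_summable[OF B a]] filterlim_int_intervals])
  then show "series_rep \<phi> Y a I" by (simp add: series_rep_def P_def comb_def)
  have Q: "Q \<longlonglongrightarrow> q"
    unfolding Q_def q_def
    by (rule filterlim_compose[OF infsum_tendsto[OF sum] filterlim_int_intervals])
  have Qq: "Q N \<le> q" for N
    unfolding Q_def q_def by (rule finite_sum_le_infsum[OF sum]) auto
  have bd: "(cmod (I x - P N x))\<^sup>2 \<le> W\<^sup>2 * B * (q - Q N)" for x N
  proof (rule tendsto_upperbound)
    show "(\<lambda>M. (cmod (P M x - P N x))\<^sup>2) \<longlonglongrightarrow> (cmod (I x - P N x))\<^sup>2"
      by (intro tendsto_intros lim)
    show "\<forall>\<^sub>F M in sequentially. (cmod (P M x - P N x))\<^sup>2 \<le> W\<^sup>2 * B * (q - Q N)"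
      using eventually_ge_at_top[of N]
    proof eventually_elim
      case (elim M)
      then have sub: "{- int N..int N} \<subseteq> {- int M..int M}" by auto
      have "P M x - P N x = comb ({- int M..int M} - {- int N..int N}) Y a x"
        unfolding P_def comb_def using sub by (simp add: sum_diff)
      then have "(cmod (P M x - P N x))\<^sup>2 \<le>
          W\<^sup>2 * B * (\<Sum>j\<in>{- int M..int M} - {- int N..int N}. (cmod (a j))\<^sup>2)"
        using comb_pointwise[OF B(1) B(2)] by simp
      also have "(\<Sum>j\<in>{- int M..int M} - {- int N..int N}. (cmod (a j))\<^sup>2) = Q M - Q N"
        unfolding Q_def using sub by (simp add: sum_diff)
      also have "W\<^sup>2 * B * (Q M - Q N) \<le> W\<^sup>2 * B * (q - Q N)"
        using Qq[of M] B(2) by (intro mult_left_mono) auto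
      finally show ?case .
    qed
  qed simp
  have ul: "uniform_limit UNIV P I sequentially"
  proof (rule uniform_limitI)
    fix e :: real assume e: "e > 0"
    have "(\<lambda>N. W\<^sup>2 * B * (q - Q N)) \<longlonglongrightarrow> W\<^sup>2 * B * (q - q)" by (intro tendsto_intros Q)
    then have "\<forall>\<^sub>F N in sequentially. W\<^sup>2 * B * (q - Q N) < e\<^sup>2"
      by (rule order_tendstoD) (use e in simp)
    then show "\<forall>\<^sub>F N in sequentially. \<forall>x\<in>UNIV. dist (P N x) (I x) < e"
    proof eventually_elim
      case (elim N)
      have "cmod (I x - P N x) < e" for x
        using le_less_trans[OF bd elim] e by (meson less_imp_le power2_less_imp_less)
      then show ?case by (simp add: dist_norm norm_minus_commute)
    qed
  qed
  have cont_I: "continuous_on UNIV I"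
    by (rule uniform_limit_theorem[OF _ ul]) (auto simp: P_def continuous_on_comb)
  moreover have "(I \<longlongrightarrow> 0) at_infinity"
    by (rule swap_uniform_limit'[OF _ _ ul, where g = "\<lambda>_. 0"]) (auto simp: P_def comb_tendsto_0)
  ultimately show "C0 I" by (simp add: C0_def)
  have [measurable]: "I \<in> borel_measurable borel"
    using cont_I by (rule borel_measurable_continuous_onI)
  have "(\<integral>\<^sup>+ x. ennreal ((cmod (I x))\<^sup>2) \<partial>lborel) = (\<integral>\<^sup>+ x. liminf (\<lambda>N. ennreal ((cmod (P N x))\<^sup>2)) \<partial>lborel)"
  proof (rule nn_integral_cong)
    fix x
    have "(\<lambda>N. ennreal ((cmod (P N x))\<^sup>2)) \<longlonglongrightarrow> ennreal ((cmod (I x))\<^sup>2)"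
      by (intro tendsto_intros lim)
    then show "ennreal ((cmod (I x))\<^sup>2) = liminf (\<lambda>N. ennreal ((cmod (P N x))\<^sup>2))"
      by (intro lim_imp_Liminf[symmetric]) auto
  qed
  also have "\<dots> \<le> liminf (\<lambda>N. \<integral>\<^sup>+ x. ennreal ((cmod (P N x))\<^sup>2) \<partial>lborel)"
    by (rule nn_integral_liminf) (simp add: P_def)
  also have "\<dots> \<le> ennreal (W * (W * (B * q)))"
  proof (rule Liminf_le)
    have "(\<integral>\<^sup>+ x. ennreal ((cmod (P N x))\<^sup>2) \<partial>lborel) \<le> ennreal (W * (W * (B * q)))" for N
    proof -
      have "(\<integral>\<^sup>+ x. ennreal ((cmod (P N x))\<^sup>2) \<partial>lborel) \<le> ennreal (W * (W * (B * Q N)))"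
        unfolding P_def Q_def by (rule comb_L2_upper[OF B(1)]) simp
      also have "\<dots> \<le> ennreal (W * (W * (B * q)))"
        using Qq[of N] W B(2) by (intro ennreal_leI mult_left_mono) auto
      finally show ?thesis .
    qed
    then show "\<forall>\<^sub>F N in sequentially. (\<integral>\<^sup>+ x. ennreal ((cmod (P N x))\<^sup>2) \<partial>lborel) \<le> ennreal (W * (W * (B * q)))"
      by simp
  qed simp
  finally show "sq_int I"
    unfolding sq_int_def by (auto intro: le_less_trans)
qed

text \<open>Approximants of f that are close in L2 have close coefficients by
  \<open>comb_L2_lower\<close>, hence are uniformly close. Their uniform limit is continuous and
  equals f almost everywhere, thus everywhere, so their samples converge to those of f; the sampling
  bound is inherited.\<close>

lemma V_space_samples_l2:
  assumes f: "f \<in> V_space \<phi> X"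
    and K: "\<And>S a. finite S \<Longrightarrow> (\<Sum>j\<in>S. (cmod (a j))\<^sup>2) \<le> K * torus_norm2 S X a" "0 < K"
    and B: "\<And>S. finite S \<Longrightarrow> bessel S X B" "0 \<le> B"
    and B': "\<And>S. finite S \<Longrightarrow> bessel S Y B'" "0 < B'"
  shows "l2_seq (\<lambda>k. f (Y k))"
proof -
  have fc: "continuous_on UNIV f" and fi: "sq_int f"
    using f by (auto simp: V_space_def)
  have [measurable]: "f \<in> borel_measurable borel" using fi by (rule sq_int_measurable)
  have "\<exists>S c. finite S \<and> L2dist2 f (comb S X c) < ennreal (1 / real (Suc n))" for n
  proof -
    have "\<exists>S c. finite S \<and> L2dist2 f (\<lambda>x. \<Sum>j\<in>S. c j * \<phi> (x - X j)) < ennreal (1 / real (Suc n))"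
      using f unfolding V_space_def by (auto simp del: of_nat_Suc)
    then show ?thesis by (simp add: comb_def[abs_def])
  qed
  then obtain S c where S: "\<And>n. finite (S n)"
    and close: "\<And>n. L2dist2 f (comb (S n) X (c n)) < ennreal (1 / real (Suc n))"
    by metis
  define g where "g n = comb (S n) X (c n)" for n
  have [measurable]: "g n \<in> borel_measurable borel" for n by (simp add: g_def)
  define D where "D = W\<^sup>2 * B * (K / \<delta>\<^sup>2)"
  have D: "0 \<le> D" using K(2) B(2) \<delta>(1) by (simp add: D_def)
  have cau: "(cmod (g m x - g n x))\<^sup>2 \<le> D * (2 / real (Suc m) + 2 / real (Suc n))" for m n x
  proof -
    \<comment> \<open>The approximants may use different nodes; on the union their difference is
      again a single combination.\<close>
    define T where "T = S m \<union> S n"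
    define b where "b j = (if j \<in> S m then c m j else 0) - (if j \<in> S n then c n j else 0)" for j
    have T: "finite T" using S by (simp add: T_def)
    have gb: "g m x - g n x = comb T X b x" for x
    proof -
      have "comb T X b x = (\<Sum>j\<in>T. if j \<in> S m then c m j * \<phi> (x - X j) else 0) -
          (\<Sum>j\<in>T. if j \<in> S n then c n j * \<phi> (x - X j) else 0)"
        unfolding comb_def sum_subtractf[symmetric] by (intro sum.cong) (auto simp: b_def algebra_simps)
      also have "(\<Sum>j\<in>T. if j \<in> S m then c m j * \<phi> (x - X j) else 0) = g m x"
        unfolding g_def comb_def T_def using S by (subst sum.inter_restrict[symmetric]) (auto intro: sum.cong)
      also have "(\<Sum>j\<in>T. if j \<in> S n then c n j * \<phi> (x - X j) else 0) = g n x"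
        unfolding g_def comb_def T_def using S by (subst sum.inter_restrict[symmetric]) (auto intro: sum.cong)
      finally show ?thesis by simp
    qed
    have "(\<integral>\<^sup>+ x. ennreal ((cmod (comb T X b x))\<^sup>2) \<partial>lborel) = L2dist2 (g m) (g n)"
      unfolding L2dist2_def gb ..
    also have "\<dots> \<le> 2 * L2dist2 (g m) f + 2 * L2dist2 f (g n)"
      by (rule L2_triangle) measurable
    also have "\<dots> \<le> 2 * ennreal (1 / real (Suc m)) + 2 * ennreal (1 / real (Suc n))"
      using close[of m] close[of n]
      by (intro add_mono mult_left_mono) (auto simp: g_def L2dist2_commute[of _ f] less_imp_le)
    also have "\<dots> = ennreal (2 / real (Suc m) + 2 / real (Suc n))"
      by (simp add: ennreal_plus ennreal_mult[symmetric] ennreal_numeral[symmetric] del: of_nat_Suc ennreal_numeral)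
    finally have "(\<Sum>j\<in>T. (cmod (b j))\<^sup>2) \<le> K / \<delta>\<^sup>2 * (2 / real (Suc m) + 2 / real (Suc n))"
      by (rule comb_L2_lower[OF K(1)[OF T] K(2), rotated]) simp
    then have "W\<^sup>2 * B * (\<Sum>j\<in>T. (cmod (b j))\<^sup>2) \<le> W\<^sup>2 * B * (K / \<delta>\<^sup>2 * (2 / real (Suc m) + 2 / real (Suc n)))"
      using B(2) by (intro mult_left_mono) auto
    also have "\<dots> = D * (2 / real (Suc m) + 2 / real (Suc n))"
      by (simp add: D_def mult.assoc)
    finally show ?thesis
      using comb_pointwise[OF B(1)[OF T] B(2), of b x] unfolding gb by linarith
  qed
  have "uniformly_Cauchy_on UNIV g"
  proof (rule uniformly_Cauchy_onI)
    fix e :: real assume e: "e > 0"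
    \<comment> \<open>Beyond N the two errors in \<open>cau\<close> add up to at most
      4/(N+1).\<close>
    obtain N :: nat where N: "real N > 4 * D / e\<^sup>2" using reals_Archimedean2 by blast
    have "dist (g m x) (g n x) < e" if "m \<ge> N" "n \<ge> N" for m n x
    proof -
      have "2 / real (Suc m) \<le> 2 / real (Suc N)" "2 / real (Suc n) \<le> 2 / real (Suc N)"
        using that by (auto intro!: divide_left_mono)
      then have "D * (2 / real (Suc m) + 2 / real (Suc n)) \<le> D * (4 / real (Suc N))"
        using D by (intro mult_left_mono) auto
      also have "\<dots> < e\<^sup>2"
      proof -
        have "4 * D < e\<^sup>2 * real (Suc N)"
          using N e by (simp add: divide_less_eq algebra_simps) (metis add_strict_increasing2 less_add_same_cancel2 zero_less_power less_trans)
        then show ?thesis by (simp add: divide_less_eq mult.commute)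
      qed
      finally have "(cmod (g m x - g n x))\<^sup>2 < e\<^sup>2" using cau[of m x n] by linarith
      then show ?thesis using e by (simp add: dist_norm power2_less_imp_less less_imp_le)
    qed
    then show "\<exists>M. \<forall>x\<in>UNIV. \<forall>m\<ge>M. \<forall>n\<ge>M. dist (g m x) (g n x) < e" by blast
  qed
  then obtain l where ul: "uniform_limit UNIV g l sequentially"
    unfolding uniformly_convergent_eq_Cauchy[symmetric] uniformly_convergent_on_def by blast
  have gl: "(\<lambda>n. g n x) \<longlonglongrightarrow> l x" for x
    using tendsto_uniform_limitI[OF ul] by simp
  have lc: "continuous_on UNIV l"
    by (rule uniform_limit_theorem[OF _ ul]) (auto simp: g_def continuous_on_comb)
  have [measurable]: "l \<in> borel_measurable borel" using lc by (rule borel_measurable_continuous_onI)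
  have "(\<integral>\<^sup>+ x. ennreal ((cmod (f x - l x))\<^sup>2) \<partial>lborel) =
      (\<integral>\<^sup>+ x. liminf (\<lambda>n. ennreal ((cmod (f x - g n x))\<^sup>2)) \<partial>lborel)"
  proof (rule nn_integral_cong)
    fix x
    have "(\<lambda>n. ennreal ((cmod (f x - g n x))\<^sup>2)) \<longlonglongrightarrow> ennreal ((cmod (f x - l x))\<^sup>2)"
      by (intro tendsto_intros gl)
    then show "ennreal ((cmod (f x - l x))\<^sup>2) = liminf (\<lambda>n. ennreal ((cmod (f x - g n x))\<^sup>2))"
      by (intro lim_imp_Liminf[symmetric]) auto
  qed
  also have "\<dots> \<le> liminf (\<lambda>n. \<integral>\<^sup>+ x. ennreal ((cmod (f x - g n x))\<^sup>2) \<partial>lborel)"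
    by (rule nn_integral_liminf) simp
  also have "\<dots> \<le> liminf (\<lambda>n. ennreal (1 / real (Suc n)))"
    using close by (intro Liminf_mono always_eventually allI less_imp_le) (simp only: g_def L2dist2_def)
  also have "\<dots> = 0"
  proof -
    have "(\<lambda>n. ennreal (1 / real (Suc n))) \<longlonglongrightarrow> ennreal 0"
      by (intro tendsto_ennrealI LIMSEQ_Suc lim_1_over_n)
    then show ?thesis by (intro lim_imp_Liminf) auto
  qed
  finally have "AE x in lborel. ennreal ((cmod (f x - l x))\<^sup>2) = 0"
    by (subst (asm) le_zero_eq, subst (asm) nn_integral_0_iff_AE) auto
  then have "f = l"
    by (intro continuous_AE_eq_imp_eq fc lc) (auto elim: eventually_mono)
  \<comment> \<open>From \<open>L2_triangle\<close>: twice the squared norm of f plus twice the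
    approximation error, which is at most 1.\<close>
  define r where "r = 2 * (LINT x|lborel. (cmod (f x))\<^sup>2) + 2"
  have r: "0 \<le> r" by (simp add: r_def)
  have gr: "(\<integral>\<^sup>+ x. ennreal ((cmod (g n x))\<^sup>2) \<partial>lborel) \<le> ennreal r" for n
  proof -
    have "(\<integral>\<^sup>+ x. ennreal ((cmod (g n x))\<^sup>2) \<partial>lborel) = L2dist2 (\<lambda>_. 0) (g n)"
      by (simp add: L2dist2_def)
    also have "\<dots> \<le> 2 * L2dist2 (\<lambda>_. 0) f + 2 * L2dist2 f (g n)"
      by (rule L2_triangle) measurable
    also have "L2dist2 (\<lambda>_. 0) f = ennreal (LINT x|lborel. (cmod (f x))\<^sup>2)"
      using sq_int_integrable[OF fi] by (simp add: L2dist2_def nn_integral_eq_integral)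
    also have "L2dist2 f (g n) \<le> ennreal 1"
    proof -
      have "ennreal (1 / real (Suc n)) \<le> ennreal 1" by (rule ennreal_leI) simp
      then show ?thesis using close[of n] unfolding g_def by (meson less_imp_le order_trans)
    qed
    finally have "(\<integral>\<^sup>+ x. ennreal ((cmod (g n x))\<^sup>2) \<partial>lborel) \<le>
        2 * ennreal (LINT x|lborel. (cmod (f x))\<^sup>2) + 2 * ennreal 1"
      by (simp add: add_left_mono mult_left_mono)
    also have "\<dots> = ennreal r"
      by (simp add: r_def ennreal_plus ennreal_mult)
    finally show ?thesis .
  qed
  define E where "E = W\<^sup>2 * B * B' / (2 * pi)"
  have E: "0 \<le> E" using B(2) B'(2) by (simp add: E_def)
  show ?thesis
  proof (rule l2_seq_bounded_sums)
    fix T :: "int set" assume T: "finite T"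
    show "(\<Sum>k\<in>T. (cmod (f (Y k)))\<^sup>2) \<le> E * (K / \<delta>\<^sup>2 * r)"
    proof (rule LIMSEQ_le_const2)
      show "(\<lambda>n. \<Sum>k\<in>T. (cmod (g n (Y k)))\<^sup>2) \<longlonglongrightarrow> (\<Sum>k\<in>T. (cmod (f (Y k)))\<^sup>2)"
        unfolding \<open>f = l\<close> by (intro tendsto_intros gl)
      have "(\<Sum>k\<in>T. (cmod (g n (Y k)))\<^sup>2) \<le> E * (K / \<delta>\<^sup>2 * r)" for n
      proof -
        have "(\<Sum>j\<in>S n. (cmod (c n j))\<^sup>2) \<le> K / \<delta>\<^sup>2 * r"
          using gr[of n] unfolding g_def by (rule comb_L2_lower[OF K(1)[OF S] K(2) r])
        then have "E * (\<Sum>j\<in>S n. (cmod (c n j))\<^sup>2) \<le> E * (K / \<delta>\<^sup>2 * r)"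
          using E by (rule mult_left_mono)
        moreover have "(\<Sum>k\<in>T. (cmod (g n (Y k)))\<^sup>2) \<le> E * (\<Sum>j\<in>S n. (cmod (c n j))\<^sup>2)"
          unfolding g_def E_def by (rule comb_sampling[OF B(1)[OF S] B'(1)[OF T] B(2) B'(2)])
        ultimately show ?thesis by linarith
      qed
      then show "\<exists>N. \<forall>n\<ge>N. (\<Sum>k\<in>T. (cmod (g n (Y k)))\<^sup>2) \<le> E * (K / \<delta>\<^sup>2 * r)" by blast
    qed
  qed
qed

end

section \<open>Constants extracted from (A1) and (A2), and the linear system for the
  coefficients\<close>

lemma generator_of_A1_A2:
  assumes "A1 \<phi>" "A2 \<phi>"
  obtains F W \<delta> where "generator \<phi> F W \<delta>"
proof -
  obtain F where F: "fourier_L2 \<phi> F" "amalgam_norm F < \<infinity>" "essinf_T F > 0"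
    using assms(2) by (auto simp: A2_def)
  obtain d where d: "AE \<xi> in restrict_space lborel torus. d \<le> ennreal (cmod (F \<xi>))" "0 < d"
    using F(3) unfolding essinf_T_def less_Sup_iff by auto
  \<comment> \<open>The minimum with 1 makes the value finite, so that \<open>enn2real\<close> does
    not collapse an infinite \<open>d\<close> to 0.\<close>
  define \<delta> where "\<delta> = enn2real (min d 1)"
  have \<delta>: "0 < \<delta>" "ennreal \<delta> \<le> d"
    using d(2) by (auto simp: \<delta>_def enn2real_positive_iff min_less_iff_disj)
  \<comment> \<open>Adding 1 makes the constant strictly positive.\<close>
  have "generator \<phi> F (enn2real (amalgam_norm F) + 1) \<delta>"
  proof
    show "continuous_on UNIV \<phi>" using assms(1) by (simp add: A1_def pos_def_def)
    show "fourier_L2 \<phi> F" by fact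
    show "0 < enn2real (amalgam_norm F) + 1" by (simp add: add_nonneg_pos)
    have "amalgam_norm F = ennreal (enn2real (amalgam_norm F))"
      using F(2) by simp
    also have "\<dots> \<le> ennreal (enn2real (amalgam_norm F) + 1)" by (rule ennreal_leI) simp
    finally show "amalgam_norm F \<le> ennreal (enn2real (amalgam_norm F) + 1)" .
    show "0 < \<delta>" by fact
    have "AE \<xi> in lborel. \<xi> \<in> torus \<longrightarrow> d \<le> ennreal (cmod (F \<xi>))"
      using d(1) by (subst (asm) AE_restrict_space_iff) auto
    then show "AE \<xi> in lborel. \<xi> \<in> torus \<longrightarrow> \<delta> \<le> cmod (F \<xi>)"
    proof eventually_elim
      case (elim \<xi>)
      then show ?case using \<delta>(2) by (metis ennreal_le_iff norm_ge_zero order_trans)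
    qed
  qed
  then show ?thesis by (rule that)
qed

theorem theorem2:
  fixes X Y :: "int \<Rightarrow> real" and \<psi> \<phi> f :: "real \<Rightarrow> complex"
  assumes "complete_interpolating X" and "complete_interpolating Y"
    and "A1 \<psi>" and "A2 \<psi>"
    and "f \<in> V_space \<psi> X"
    and "A1 \<phi>" and "A2 \<phi>"
  shows "\<exists>!a. l2_seq a \<and>
           (\<exists>I. series_rep \<phi> Y a I \<and> (\<forall>k. I (Y k) = f (Y k)) \<and> C0 I \<and> sq_int I)"
proof -
  obtain KX where KX: "KX > 0" "\<And>S a. finite S \<Longrightarrow> (\<Sum>j\<in>S. (cmod (a j))\<^sup>2) \<le> KX * torus_norm2 S X a"
    using complete_interpolating_riesz_lower[OF assms(1)] by blast
  obtain BX where BX: "BX > 0" "\<And>S. finite S \<Longrightarrow> bessel S X BX"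
    using complete_interpolating_bessel[OF assms(1)] by blast
  obtain KY where KY: "KY > 0" "\<And>S a. finite S \<Longrightarrow> (\<Sum>j\<in>S. (cmod (a j))\<^sup>2) \<le> KY * torus_norm2 S Y a"
    using complete_interpolating_riesz_lower[OF assms(2)] by blast
  obtain BY where BY: "BY > 0" "\<And>S. finite S \<Longrightarrow> bessel S Y BY"
    using complete_interpolating_bessel[OF assms(2)] by blast
  obtain F\<psi> W\<psi> \<delta>\<psi> where "generator \<psi> F\<psi> W\<psi> \<delta>\<psi>"
    using generator_of_A1_A2[OF assms(3,4)] by blast
  \<comment> \<open>Here X carries the generating nodes of \<psi> and Y the sampling points; this
    provides the right-hand side of the linear system.\<close>
  then have d: "l2_seq (\<lambda>k. f (Y k))"
    using generator.V_space_samples_l2[OF _ assms(5) KX(2,1) BX(2) _ BY(2,1)] BX(1) by simp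
  obtain F W \<delta> where "generator \<phi> F W \<delta>"
    using generator_of_A1_A2[OF assms(6,7)] by blast
  then interpret generator \<phi> F W \<delta> .
  define M where "M k j = \<phi> (Y k - Y j)" for k j
  have Mc: "(\<Sum>j\<in>S. M k j * a j) = comb S Y a (Y k)" for S k a
    by (simp add: M_def comb_def mult.commute)
  have pos: "AE \<xi> in lborel. F \<xi> \<in> \<real>\<^sub>\<ge>\<^sub>0"
    using assms(6) by (intro pos_def_fourier_nonneg[OF _ fourier integrable_F]) (simp add: A1_def)
  interpret bounded_matrix M "W * BY / sqrt (2 * pi)"
  proof
    show "0 \<le> W * BY / sqrt (2 * pi)" using W BY by simp
    fix S T :: "int set" and a :: "int \<Rightarrow> complex"
    assume "finite S" "finite T"
    then have "(\<Sum>k\<in>T. (cmod (comb S Y a (Y k)))\<^sup>2) \<le>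
        W\<^sup>2 * BY * BY / (2 * pi) * (\<Sum>j\<in>S. (cmod (a j))\<^sup>2)"
      using BY by (intro comb_sampling) auto
    also have "W\<^sup>2 * BY * BY / (2 * pi) = (W * BY / sqrt (2 * pi))\<^sup>2"
      by (simp add: power_divide power_mult_distrib power2_eq_square[of BY] mult.assoc)
    finally show "(\<Sum>k\<in>T. (cmod (\<Sum>j\<in>S. M k j * a j))\<^sup>2) \<le>
        (W * BY / sqrt (2 * pi))\<^sup>2 * (\<Sum>j\<in>S. (cmod (a j))\<^sup>2)"
      unfolding Mc .
  qed
  have "\<exists>!a. l2_seq a \<and> (\<forall>k. (\<Sum>\<^sub>\<infinity>j. M k j * a j) = f (Y k))"
  proof (rule ex1_solution[OF _ _ d])
    show "\<delta> / (sqrt (2 * pi) * KY) > 0" using \<delta>(1) KY(1) by simp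
    fix S :: "int set" and a :: "int \<Rightarrow> complex"
    assume S: "finite S"
    have "(\<Sum>k\<in>S. \<Sum>j\<in>S. M k j * a j * cnj (a k)) = (\<Sum>k\<in>S. cnj (a k) * comb S Y a (Y k))"
      unfolding Mc[symmetric] by (simp add: sum_distrib_left mult_ac)
    then show "\<delta> / (sqrt (2 * pi) * KY) * (\<Sum>j\<in>S. (cmod (a j))\<^sup>2) \<le>
        Re (\<Sum>k\<in>S. \<Sum>j\<in>S. M k j * a j * cnj (a k))"
      using comb_coercive[OF pos KY(2)[OF S] KY(1)] by simp
  qed
  \<comment> \<open>For a in l2 the series has a pointwise limit J with all the regularity required,
    and any I represented by the series equals J. Only the interpolation condition remains, and it
    is the matrix equation.\<close>
  moreover have "(\<exists>I. series_rep \<phi> Y a I \<and> (\<forall>k. I (Y k) = f (Y k)) \<and> C0 I \<and> sq_int I) \<longleftrightarrow>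
      (\<forall>k. (\<Sum>\<^sub>\<infinity>j. M k j * a j) = f (Y k))" if a: "l2_seq a" for a
  proof -
    define J where "J x = (\<Sum>\<^sub>\<infinity>j. a j * \<phi> (x - Y j))" for x
    have J: "series_rep \<phi> Y a J" "C0 J" "sq_int J"
      using series_in_C0_L2[OF BY(2) _ a] BY(1) unfolding J_def[abs_def] by auto
    have "I = J" if "series_rep \<phi> Y a I" for I
      using that J(1) LIMSEQ_unique unfolding series_rep_def by blast
    moreover have "J (Y k) = (\<Sum>\<^sub>\<infinity>j. M k j * a j)" for k
      by (simp add: J_def M_def mult.commute)
    ultimately show ?thesis using J by metis
  qed
  ultimately show ?thesis by (simp cong: conj_cong)
qed

end
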